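(* Let $\Lambda\in\mathtt P^+$, $i\in I$, $\beta\in\mathtt Q^+$ with $|\beta|=n$, and $\nu\in I^\beta$. For $1\le a\le n$ let $$g_a=\sum_{\mu\in I^{\beta+\alpha_i},\,\mu_a\ne\mu_{a+1}}\tau_ae(\mu)+\sum_{\mu\in I^{\beta+\alpha_i},\,\mu_a=\mu_{a+1}}\big((x_{a+1}-x_a)\mathcal P_{\mu_a}(x_a,x_{a+1})-(x_{a+1}-x_a)^2\tau_a\big)e(\mu)\in R(\beta+\alpha_i),$$ and $$\mathsf A_\nu=a_i^\Lambda(x_1)\prod_{1\le a\le n,\ \nu_a\ne i}\mathcal Q_{i,\nu_a}(x_1,x_{a+1})\prod_{1\le a\le n,\ \nu_a=i}\mathcal P_i(x_1,x_{a+1})\mathcal P_i(x_{a+1},x_1).$$ Then $$a^\Lambda(x_1)\tau_1\cdots\tau_n\,g_n\cdots g_1\,e(i,\nu)\equiv\mathsf A_\nu e(i,\nu)\mod R(\beta+\alpha_i)a^\Lambda(x_2)\xi(R(\beta))e(i,\nu).$$ Equivalently, with $K_1e(i,\nu)=R(\beta+\alpha_i)e(i,\nu)/R(\beta+\alpha_i)a^\Lambda(x_2)\xi(R(\beta))e(i,\nu)$ and $K_0e(\nu,i)=R(\beta+\alpha_i)e(\nu,i)/R(\beta+\alpha_i)a^\Lambda(x_1)R(\beta)e(\nu,i)$, the composite of $P$ (right multiplication by $a^\Lambda(x_1)\tau_1\cdots\tau_n$) from $K_1e(i,\nu)$ to $K_0e(\nu,i)$ and $Q$ (right multiplication by $g_n\cdots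 g_1$) from $K_0e(\nu,i)$ to $K_1e(i,\nu)$ equals right multiplication by $\mathsf A_\nu$ on $K_1e(i,\nu)$.
   Context: Let $I$ be a finite set and $\mathtt A=(a_{ij})_{i,j\in I}$ an integer matrix with $a_{ii}=2$ or $a_{ii}\in 2\mathbb Z_{\le 0}$, $a_{ij}\le 0$ for $i\neq j$, and $a_{ij}=0\iff a_{ji}=0$. Assume there are $d_i\in\mathbb Z_{>0}$ with $(d_ia_{ij})$ symmetric. Fix a free abelian group $\mathtt P$, linearly independent $\alpha_i\in\mathtt P$, and $h_i\in\mathrm{Hom}(\mathtt P,\mathbb Z)$ with $\langle h_i,\alpha_j\rangle=a_{ij}$, such that for each $i$ there is $\Lambda_i$ with $\langle h_j,\Lambda_i\rangle=\delta_{ij}$. Let $(\alpha_i|\alpha_j)=d_ia_{ij}$. $\mathtt P^+=\{\lambda:\langle h_i,\lambda\rangle\ge0\ \forall i\}$, $\mathtt Q^+=\sum_i\mathbb Z_{\ge0}\alpha_i$; for $\beta=\sum k_i\alpha_i$, $|\beta|=\sum k_i$, $I^\beta=\{\nu\in I^{|\beta|}:\sum_k\alpha_{\nu_k}=\beta\}$. Let $\mathbf k=\bigoplus_{n\ge0}\mathbf k_n$ be a graded commutative ring, $\mathcal Q_{i,j}(u,v)\in\mathbf k[u,v]$ with $\mathcal Q_{i,j}(u,v)=\mathcal Q_{j,i}(v,u)$, $\mathcal Q_{i,i}=0$, and for $i\ne j$, $\mathcal Q_{i,j}=\sum_{d_ip+d_jq\le-(\alpha_i|\alpha_j)}t^{p,q}_{i,j}u^pv^q$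 with $t^{-a_{ij},0}_{i,j}\in\mathbf k_0^\times$, $t^{p,q}_{i,j}\in\mathbf k_{-2((\alpha_i|\alpha_j)+d_ip+d_jq)}$, $t^{p,q}_{i,j}=t^{q,p}_{j,i}$; $\mathcal P_i(u,v)=\sum_{p+q\le1-a_{ii}/2}w_i^{p,q}u^pv^q$ with $w_i^{1-a_{ii}/2,0},w_i^{0,1-a_{ii}/2}\in\mathbf k_0^\times$, $w_i^{p,q}\in\mathbf k_{2d_i(1-p-q-a_{ii}/2)}$. $R(n)$ is the $\mathbf k$-algebra generated by $e(\nu)$ ($\nu\in I^n$), $x_k$, $\tau_\ell$ with relations: $e(\nu)e(\nu')=\delta_{\nu\nu'}e(\nu)$, $\sum e(\nu)=1$, $x_kx_l=x_lx_k$, $x_ke(\nu)=e(\nu)x_k$, $\tau_\ell e(\nu)=e(s_\ell\nu)\tau_\ell$, $\tau_k\tau_\ell=\tau_\ell\tau_k$ ($|k-\ell|>1$); $\tau_k^2e(\nu)=(\partial_k\mathcal P_{\nu_k}(x_k,x_{k+1}))\tau_ke(\nu)$ if $\nu_k=\nu_{k+1}$, else $\mathcal Q_{\nu_k,\nu_{k+1}}(x_k,x_{k+1})e(\nu)$; $(\tau_kx_\ell-x_{s_k(\ell)}\tau_k)e(\nu)$ is $-\mathcal P_{\nu_k}(x_k,x_{k+1})e(\nu)$ if $\ell=k,\nu_k=\nu_{k+1}$, is $\mathcal P_{\nu_k}(x_k,x_{k+1})e(\nu)$ if $\ell=k+1,\nu_k=\nu_{k+1}$, and $0$ otherwise; $(\tau_{k+1}\tau_k\tau_{k+1}-\tau_k\tau_{k+1}\tau_k)e(\nu)$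 is $\mathcal P_{\nu_k}(x_k,x_{k+2})\overline{\mathcal Q}_{\nu_k,\nu_{k+1}}(x_k,x_{k+1},x_{k+2})e(\nu)$ if $\nu_k=\nu_{k+2}\ne\nu_{k+1}$, is $\overline{\mathcal P}'_{\nu_k}(x_k,x_{k+1},x_{k+2})\tau_ke(\nu)+\overline{\mathcal P}''_{\nu_k}(x_k,x_{k+1},x_{k+2})\tau_{k+1}e(\nu)$ if $\nu_k=\nu_{k+1}=\nu_{k+2}$, and $0$ otherwise; where $\partial_kf=(s_kf-f)/(x_k-x_{k+1})$, $\overline{\mathcal Q}_{i,j}(u,v,w)=\frac{\mathcal Q_{i,j}(u,v)-\mathcal Q_{i,j}(w,v)}{u-w}$, $\overline{\mathcal P}'_i(u,v,w)=\frac{\mathcal P_i(v,u)\mathcal P_i(u,w)}{(u-v)(u-w)}+\frac{\mathcal P_i(u,w)\mathcal P_i(v,w)}{(u-w)(v-w)}-\frac{\mathcal P_i(u,v)\mathcal P_i(v,w)}{(u-v)(v-w)}$, $\overline{\mathcal P}''_i(u,v,w)=-\frac{\mathcal P_i(u,v)\mathcal P_i(u,w)}{(u-v)(u-w)}-\frac{\mathcal P_i(u,w)\mathcal P_i(w,v)}{(u-w)(v-w)}+\frac{\mathcal P_i(u,v)\mathcal P_i(v,w)}{(u-v)(v-w)}$. $R(\beta)=e(\beta)R(n)$, $e(\beta)=\sum_{\nu\in I^\beta}e(\nu)$; $R(\beta)\subset R(\beta+\alpha_i)$ via $e(\nu)\mapsto e(\nu,i)$, $x_k\mapsto x_k$,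 $\tau_\ell\mapsto\tau_\ell$; $\xi:R(n)\to R(n+1)$ is $x_k\mapsto x_{k+1}$, $\tau_\ell\mapsto\tau_{\ell+1}$, $e(\nu)\mapsto\sum_{j\in I}e(j,\nu)$. For $\Lambda\in\mathtt P^+$ fix monic $a_i^\Lambda(u)=\sum_{k=0}^{\langle h_i,\Lambda\rangle}c_{i;k}u^{\langle h_i,\Lambda\rangle-k}$, $c_{i;k}\in\mathbf k_{2kd_i}$, $c_{i;0}=1$, and in $R(\beta+\alpha_i)$ set $a^\Lambda(x_k)=\sum_\mu a^\Lambda_{\mu_k}(x_k)e(\mu)$. *)

theory Defs
  imports "HOL-Computational_Algebra.Polynomial"
begin

text \<open>k[u,v,w] is modelled as 'k poly poly poly: innermost variable u,
middle variable v, outermost variable w.\<close>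

definition U3 :: "'k::comm_ring_1 poly poly poly" where "U3 = [:[:[:0, 1:]:]:]"
definition V3 :: "'k::comm_ring_1 poly poly poly" where "V3 = [:[:0, 1:]:]"
definition W3 :: "'k::comm_ring_1 poly poly poly" where "W3 = [:0, 1:]"
definition const3 :: "'k::comm_ring_1 \<Rightarrow> 'k poly poly poly" where
  "const3 a = [:[:[:a:]:]:]"

definition poly2 :: "(nat \<Rightarrow> nat \<Rightarrow> 'k::comm_ring_1) \<Rightarrow> 'k poly poly poly \<Rightarrow> 'k poly poly poly \<Rightarrow> 'k poly poly poly" where
  "poly2 cf X Y = (\<Sum>pq\<in>{(p, q). cf p q \<noteq> 0}. const3 (cf (fst pq) (snd pq)) * X ^ fst pq * Y ^ snd pq)"

definition eval3 :: "('k::comm_ring_1 \<Rightarrow> 'a::ring_1) \<Rightarrow> 'k poly poly poly \<Rightarrow> 'a \<Rightarrow> 'a \<Rightarrow> 'a \<Rightarrow> 'a" where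
  "eval3 sc F a b c = (\<Sum>k\<le>degree F. \<Sum>j\<le>degree (coeff F k). \<Sum>i\<le>degree (coeff (coeff F k) j).
      sc (coeff (coeff (coeff F k) j) i) * a ^ i * b ^ j * c ^ k)"

text \<open>Divided differences (exact quotients in k[u,v,w]).\<close>
definition dP :: "('i \<Rightarrow> nat \<Rightarrow> nat \<Rightarrow> 'k::comm_ring_1) \<Rightarrow> 'i \<Rightarrow> 'k poly poly poly" where
  "dP w j = (THE G. (U3 - V3) * G = poly2 (w j) V3 U3 - poly2 (w j) U3 V3)"

definition Qbar :: "('i \<Rightarrow> 'i \<Rightarrow> nat \<Rightarrow> nat \<Rightarrow> 'k::comm_ring_1) \<Rightarrow> 'i \<Rightarrow> 'i \<Rightarrow> 'k poly poly poly" where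
  "Qbar t j l = (THE G. (U3 - W3) * G = poly2 (t j l) U3 V3 - poly2 (t j l) W3 V3)"

definition Pbar1 :: "('i \<Rightarrow> nat \<Rightarrow> nat \<Rightarrow> 'k::comm_ring_1) \<Rightarrow> 'i \<Rightarrow> 'k poly poly poly" where
  "Pbar1 w j = (THE G. (U3 - V3) * (U3 - W3) * (V3 - W3) * G =
      poly2 (w j) V3 U3 * poly2 (w j) U3 W3 * (V3 - W3)
    + poly2 (w j) U3 W3 * poly2 (w j) V3 W3 * (U3 - V3)
    - poly2 (w j) U3 V3 * poly2 (w j) V3 W3 * (U3 - W3))"

definition Pbar2 :: "('i \<Rightarrow> nat \<Rightarrow> nat \<Rightarrow> 'k::comm_ring_1) \<Rightarrow> 'i \<Rightarrow> 'k poly poly poly" where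
  "Pbar2 w j = (THE G. (U3 - V3) * (U3 - W3) * (V3 - W3) * G =
    - (poly2 (w j) U3 V3 * poly2 (w j) U3 W3 * (V3 - W3))
    - poly2 (w j) U3 W3 * poly2 (w j) W3 V3 * (U3 - V3)
    + poly2 (w j) U3 V3 * poly2 (w j) V3 W3 * (U3 - W3))"

definition Qev :: "('k::comm_ring_1 \<Rightarrow> 'a::ring_1) \<Rightarrow> ('i \<Rightarrow> 'i \<Rightarrow> nat \<Rightarrow> nat \<Rightarrow> 'k) \<Rightarrow> 'i \<Rightarrow> 'i \<Rightarrow> 'a \<Rightarrow> 'a \<Rightarrow> 'a" where
  "Qev sc t j l a b = eval3 sc (poly2 (t j l) U3 V3) a b 0"
definition Pev :: "('k::comm_ring_1 \<Rightarrow> 'a::ring_1) \<Rightarrow> ('i \<Rightarrow> nat \<Rightarrow> nat \<Rightarrow> 'k) \<Rightarrow> 'i \<Rightarrow> 'a \<Rightarrow> 'a \<Rightarrow> 'a" where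
  "Pev sc w j a b = eval3 sc (poly2 (w j) U3 V3) a b 0"

definition graded_ring :: "(int \<Rightarrow> 'k::comm_ring_1 set) \<Rightarrow> bool" where
  "graded_ring kgr \<longleftrightarrow>
     (\<forall>z<0. kgr z = {0}) \<and>
     (\<forall>z. 0 \<in> kgr z \<and> (\<forall>a\<in>kgr z. \<forall>b\<in>kgr z. a + b \<in> kgr z \<and> - a \<in> kgr z)) \<and>
     1 \<in> kgr 0 \<and>
     (\<forall>y z. \<forall>a\<in>kgr y. \<forall>b\<in>kgr z. a * b \<in> kgr (y + z)) \<and>
     (\<forall>a. \<exists>(f::nat \<Rightarrow> 'k) N. (\<forall>n. f n \<in> kgr (int n)) \<and> a = (\<Sum>n<N. f n)) \<and>
     (\<forall>(f::nat \<Rightarrow> 'k) N. (\<forall>n. f n \<in> kgr (int n)) \<and> (\<Sum>n<N. f n) = 0 \<longrightarrow> (\<forall>n<N. f n = 0))"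

definition unit0 :: "(int \<Rightarrow> 'k::comm_ring_1 set) \<Rightarrow> 'k \<Rightarrow> bool" where
  "unit0 kgr a \<longleftrightarrow> a \<in> kgr 0 \<and> (\<exists>b\<in>kgr 0. a * b = 1)"

definition cartan_datum :: "'i set \<Rightarrow> ('i \<Rightarrow> 'i \<Rightarrow> int) \<Rightarrow> ('i \<Rightarrow> int) \<Rightarrow> bool" where
  "cartan_datum I A d \<longleftrightarrow>
     (\<forall>j\<in>I. A j j = 2 \<or> (A j j \<le> 0 \<and> even (A j j))) \<and>
     (\<forall>j\<in>I. \<forall>l\<in>I. j \<noteq> l \<longrightarrow> A j l \<le> 0) \<and>
     (\<forall>j\<in>I. \<forall>l\<in>I. A j l = 0 \<longleftrightarrow> A l j = 0) \<and>
     (\<forall>j\<in>I. d j > 0) \<and>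
     (\<forall>j\<in>I. \<forall>l\<in>I. d j * A j l = d l * A l j)"

text \<open>The weight lattice P is the free abelian group of finitely supported
functions 'b => int (an arbitrary free abelian group).\<close>
definition finsupp :: "('b \<Rightarrow> int) \<Rightarrow> bool" where
  "finsupp f \<longleftrightarrow> finite {b. f b \<noteq> 0}"

definition realization :: "'i set \<Rightarrow> ('i \<Rightarrow> 'i \<Rightarrow> int) \<Rightarrow> ('i \<Rightarrow> 'b \<Rightarrow> int) \<Rightarrow> ('i \<Rightarrow> ('b \<Rightarrow> int) \<Rightarrow> int) \<Rightarrow> bool" where
  "realization I A alpha hh \<longleftrightarrow>
     (\<forall>j\<in>I. finsupp (alpha j)) \<and>
     (\<forall>j\<in>I. \<forall>l m. finsupp l \<longrightarrow> finsupp m \<longrightarrow> hh j (\<lambda>b. l b + m b) = hh j l + hh j m) \<and>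
     (\<forall>j\<in>I. \<forall>l\<in>I. hh j (alpha l) = A j l) \<and>
     (\<forall>cf::'i \<Rightarrow> int. (\<forall>b. (\<Sum>j\<in>I. cf j * alpha j b) = 0) \<longrightarrow> (\<forall>j\<in>I. cf j = 0)) \<and>
     (\<forall>j\<in>I. \<exists>L. finsupp L \<and> (\<forall>l\<in>I. hh l L = (if l = j then 1 else 0)))"

definition Pplus :: "'i set \<Rightarrow> ('i \<Rightarrow> ('b \<Rightarrow> int) \<Rightarrow> int) \<Rightarrow> ('b \<Rightarrow> int) set" where
  "Pplus I hh = {L. finsupp L \<and> (\<forall>j\<in>I. hh j L \<ge> 0)}"

text \<open>Elements of Q^+ are represented by their coefficient vectors (k_j)_{j in I}.\<close>
definition Qplus :: "'i set \<Rightarrow> ('i \<Rightarrow> nat) set" where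
  "Qplus I = {B. \<forall>j. j \<notin> I \<longrightarrow> B j = 0}"

definition Q_data :: "'i set \<Rightarrow> ('i \<Rightarrow> 'i \<Rightarrow> int) \<Rightarrow> ('i \<Rightarrow> int) \<Rightarrow> (int \<Rightarrow> 'k::comm_ring_1 set)
    \<Rightarrow> ('i \<Rightarrow> 'i \<Rightarrow> nat \<Rightarrow> nat \<Rightarrow> 'k) \<Rightarrow> bool" where
  "Q_data I A d kgr t \<longleftrightarrow>
    (\<forall>j\<in>I. \<forall>l\<in>I. (\<forall>p q. t j l p q = t l j q p) \<and>
       (j = l \<longrightarrow> (\<forall>p q. t j l p q = 0)) \<and>
       (j \<noteq> l \<longrightarrow>
          (\<forall>p q. t j l p q \<noteq> 0 \<longrightarrow> d j * int p + d l * int q \<le> - (d j * A j l)) \<and>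
          unit0 kgr (t j l (nat (- A j l)) 0) \<and>
          (\<forall>p q. t j l p q \<in> kgr (- 2 * (d j * A j l + d j * int p + d l * int q)))))"

definition P_data :: "'i set \<Rightarrow> ('i \<Rightarrow> 'i \<Rightarrow> int) \<Rightarrow> ('i \<Rightarrow> int) \<Rightarrow> (int \<Rightarrow> 'k::comm_ring_1 set)
    \<Rightarrow> ('i \<Rightarrow> nat \<Rightarrow> nat \<Rightarrow> 'k) \<Rightarrow> bool" where
  "P_data I A d kgr w \<longleftrightarrow>
    (\<forall>j\<in>I. (\<forall>p q. w j p q \<noteq> 0 \<longrightarrow> int p + int q \<le> 1 - A j j div 2) \<and>
       unit0 kgr (w j (nat (1 - A j j div 2)) 0) \<and>
       unit0 kgr (w j 0 (nat (1 - A j j div 2))) \<and>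
       (\<forall>p q. w j p q \<in> kgr (2 * d j * (1 - int p - int q - A j j div 2))))"

definition a_data :: "'i set \<Rightarrow> ('i \<Rightarrow> int) \<Rightarrow> (int \<Rightarrow> 'k::comm_ring_1 set) \<Rightarrow> ('i \<Rightarrow> ('b \<Rightarrow> int) \<Rightarrow> int)
    \<Rightarrow> ('b \<Rightarrow> int) \<Rightarrow> ('i \<Rightarrow> nat \<Rightarrow> 'k) \<Rightarrow> bool" where
  "a_data I d kgr hh L c \<longleftrightarrow>
    (\<forall>j\<in>I. c j 0 = 1 \<and> (\<forall>k\<le>nat (hh j L). c j k \<in> kgr (2 * int k * d j)))"

definition aev :: "('k::comm_ring_1 \<Rightarrow> 'a::ring_1) \<Rightarrow> ('i \<Rightarrow> nat \<Rightarrow> 'k) \<Rightarrow> ('i \<Rightarrow> ('b \<Rightarrow> int) \<Rightarrow> int)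
    \<Rightarrow> ('b \<Rightarrow> int) \<Rightarrow> 'i \<Rightarrow> 'a \<Rightarrow> 'a" where
  "aev sc c hh L j y = (\<Sum>k\<le>nat (hh j L). sc (c j k) * y ^ (nat (hh j L) - k))"

definition Iseq :: "'i set \<Rightarrow> nat \<Rightarrow> 'i list set" where
  "Iseq I m = {\<nu>. length \<nu> = m \<and> set \<nu> \<subseteq> I}"

definition Ibeta :: "'i set \<Rightarrow> ('i \<Rightarrow> nat) \<Rightarrow> 'i list set" where
  "Ibeta I B = {\<nu>. set \<nu> \<subseteq> I \<and> (\<forall>j\<in>I. count_list \<nu> j = B j)}"

definition ent :: "'i list \<Rightarrow> nat \<Rightarrow> 'i" where
  "ent \<nu> k = \<nu> ! (k - 1)"

definition sw :: "nat \<Rightarrow> 'i list \<Rightarrow> 'i list" where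
  "sw l \<nu> = \<nu>[l - 1 := \<nu> ! l, l := \<nu> ! (l - 1)]"

definition sidx :: "nat \<Rightarrow> nat \<Rightarrow> nat" where
  "sidx k l = (if l = k then k + 1 else if l = k + 1 then k else l)"

text \<open>qH_rels I t w sc m e x tau: the k-algebra 'a (structure map sc, central)
contains elements e(nu) (nu in I^m), x_1..x_m, tau_1..tau_{m-1} satisfying
the defining relations of R(m).\<close>
definition qH_rels :: "'i set \<Rightarrow> ('i \<Rightarrow> 'i \<Rightarrow> nat \<Rightarrow> nat \<Rightarrow> 'k::comm_ring_1) \<Rightarrow> ('i \<Rightarrow> nat \<Rightarrow> nat \<Rightarrow> 'k)
   \<Rightarrow> ('k \<Rightarrow> 'a::ring_1) \<Rightarrow> nat \<Rightarrow> ('i list \<Rightarrow> 'a) \<Rightarrow> (nat \<Rightarrow> 'a) \<Rightarrow> (nat \<Rightarrow> 'a) \<Rightarrow> bool" where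
  "qH_rels I t w sc m e x \<tau> \<longleftrightarrow>
    (\<forall>a b. sc (a + b) = sc a + sc b) \<and> (\<forall>a b. sc (a * b) = sc a * sc b) \<and> sc 1 = 1 \<and>
    (\<forall>a y. sc a * y = y * sc a) \<and>
    (\<forall>\<nu>\<in>Iseq I m. \<forall>\<nu>'\<in>Iseq I m. e \<nu> * e \<nu>' = (if \<nu> = \<nu>' then e \<nu> else 0)) \<and>
    (\<Sum>\<nu>\<in>Iseq I m. e \<nu>) = 1 \<and>
    (\<forall>k\<in>{1..m}. \<forall>l\<in>{1..m}. x k * x l = x l * x k) \<and>
    (\<forall>k\<in>{1..m}. \<forall>\<nu>\<in>Iseq I m. x k * e \<nu> = e \<nu> * x k) \<and>
    (\<forall>l\<in>{1..<m}. \<forall>\<nu>\<in>Iseq I m. \<tau> l * e \<nu> = e (sw l \<nu>) * \<tau> l) \<and>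
    (\<forall>k\<in>{1..<m}. \<forall>l\<in>{1..<m}. (k + 1 < l \<or> l + 1 < k) \<longrightarrow> \<tau> k * \<tau> l = \<tau> l * \<tau> k) \<and>
    (\<forall>k\<in>{1..<m}. \<forall>\<nu>\<in>Iseq I m. \<tau> k * \<tau> k * e \<nu> =
       (if ent \<nu> k = ent \<nu> (k + 1)
        then eval3 sc (dP w (ent \<nu> k)) (x k) (x (k + 1)) 0 * \<tau> k * e \<nu>
        else Qev sc t (ent \<nu> k) (ent \<nu> (k + 1)) (x k) (x (k + 1)) * e \<nu>)) \<and>
    (\<forall>k\<in>{1..<m}. \<forall>l\<in>{1..m}. \<forall>\<nu>\<in>Iseq I m. (\<tau> k * x l - x (sidx k l) * \<tau> k) * e \<nu> =
       (if l = k \<and> ent \<nu> k = ent \<nu> (k + 1) then - (Pev sc w (ent \<nu> k) (x k) (x (k + 1)) * e \<nu>)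
        else if l = k + 1 \<and> ent \<nu> k = ent \<nu> (k + 1) then Pev sc w (ent \<nu> k) (x k) (x (k + 1)) * e \<nu>
        else 0)) \<and>
    (\<forall>k. 1 \<le> k \<and> k + 2 \<le> m \<longrightarrow> (\<forall>\<nu>\<in>Iseq I m.
       (\<tau> (k + 1) * \<tau> k * \<tau> (k + 1) - \<tau> k * \<tau> (k + 1) * \<tau> k) * e \<nu> =
       (if ent \<nu> k = ent \<nu> (k + 2) \<and> ent \<nu> k \<noteq> ent \<nu> (k + 1)
        then eval3 sc (poly2 (w (ent \<nu> k)) U3 W3 * Qbar t (ent \<nu> k) (ent \<nu> (k + 1))) (x k) (x (k + 1)) (x (k + 2)) * e \<nu>
        else if ent \<nu> k = ent \<nu> (k + 1) \<and> ent \<nu> (k + 1) = ent \<nu> (k + 2)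
        then eval3 sc (Pbar1 w (ent \<nu> k)) (x k) (x (k + 1)) (x (k + 2)) * \<tau> k * e \<nu>
           + eval3 sc (Pbar2 w (ent \<nu> k)) (x k) (x (k + 1)) (x (k + 2)) * \<tau> (k + 1) * e \<nu>
        else 0)))"

inductive_set kalg :: "('k \<Rightarrow> 'a::ring_1) \<Rightarrow> 'a set \<Rightarrow> 'a set" for sc :: "'k \<Rightarrow> 'a" and G :: "'a set" where
  kalg_scalar: "sc a \<in> kalg sc G"
| kalg_gen: "g \<in> G \<Longrightarrow> g \<in> kalg sc G"
| kalg_add: "a \<in> kalg sc G \<Longrightarrow> b \<in> kalg sc G \<Longrightarrow> a + b \<in> kalg sc G"
| kalg_mult: "a \<in> kalg sc G \<Longrightarrow> b \<in> kalg sc G \<Longrightarrow> a * b \<in> kalg sc G"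

definition Rgen :: "'i set \<Rightarrow> ('k \<Rightarrow> 'a::ring_1) \<Rightarrow> nat \<Rightarrow> ('i list \<Rightarrow> 'a) \<Rightarrow> (nat \<Rightarrow> 'a) \<Rightarrow> (nat \<Rightarrow> 'a) \<Rightarrow> 'a set" where
  "Rgen I sc m e x \<tau> = kalg sc (e ` Iseq I m \<union> x ` {1..m} \<union> \<tau> ` {1..<m})"

definition Rblock :: "'i set \<Rightarrow> ('k \<Rightarrow> 'a::ring_1) \<Rightarrow> nat \<Rightarrow> ('i list \<Rightarrow> 'a) \<Rightarrow> (nat \<Rightarrow> 'a) \<Rightarrow> (nat \<Rightarrow> 'a) \<Rightarrow> ('i \<Rightarrow> nat) \<Rightarrow> 'a set" where
  "Rblock I sc m e x \<tau> B = {(\<Sum>\<mu>\<in>Ibeta I B. e \<mu>) * y | y. y \<in> Rgen I sc m e x \<tau>}"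

text \<open>xi(R(B)) inside R(n+1), where |B| = n: image of e(B) R(n) under
x_k -> x_{k+1}, tau_l -> tau_{l+1}, e(nu) -> sum_j e(j,nu).\<close>
definition xiRblock :: "'i set \<Rightarrow> ('k \<Rightarrow> 'a::ring_1) \<Rightarrow> nat \<Rightarrow> ('i list \<Rightarrow> 'a) \<Rightarrow> (nat \<Rightarrow> 'a) \<Rightarrow> (nat \<Rightarrow> 'a) \<Rightarrow> ('i \<Rightarrow> nat) \<Rightarrow> 'a set" where
  "xiRblock I sc n e x \<tau> B =
     {(\<Sum>\<nu>\<in>Ibeta I B. \<Sum>j\<in>I. e (j # \<nu>)) * y | y.
        y \<in> kalg sc ((\<lambda>\<nu>. \<Sum>j\<in>I. e (j # \<nu>)) ` Iseq I n \<union> (\<lambda>k. x (k + 1)) ` {1..n} \<union> (\<lambda>l. \<tau> (l + 1)) ` {1..<n})}"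

definition lsub :: "'a::ring_1 set \<Rightarrow> 'a \<Rightarrow> 'a set \<Rightarrow> 'a \<Rightarrow> 'a set" where
  "lsub M a S f = {(\<Sum>j<N. r j * a * s j * f) | (N::nat) r s. (\<forall>j<N. r j \<in> M \<and> s j \<in> S)}"

definition aLam :: "'i set \<Rightarrow> ('k::comm_ring_1 \<Rightarrow> 'a::ring_1) \<Rightarrow> ('i \<Rightarrow> nat \<Rightarrow> 'k) \<Rightarrow> ('i \<Rightarrow> ('b \<Rightarrow> int) \<Rightarrow> int)
    \<Rightarrow> ('b \<Rightarrow> int) \<Rightarrow> ('i list \<Rightarrow> 'a) \<Rightarrow> (nat \<Rightarrow> 'a) \<Rightarrow> ('i \<Rightarrow> nat) \<Rightarrow> nat \<Rightarrow> 'a" where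
  "aLam I sc c hh L e x B k = (\<Sum>\<mu>\<in>Ibeta I B. aev sc c hh L (ent \<mu> k) (x k) * e \<mu>)"

definition gel :: "'i set \<Rightarrow> ('k::comm_ring_1 \<Rightarrow> 'a::ring_1) \<Rightarrow> ('i \<Rightarrow> nat \<Rightarrow> nat \<Rightarrow> 'k)
    \<Rightarrow> ('i list \<Rightarrow> 'a) \<Rightarrow> (nat \<Rightarrow> 'a) \<Rightarrow> (nat \<Rightarrow> 'a) \<Rightarrow> ('i \<Rightarrow> nat) \<Rightarrow> nat \<Rightarrow> 'a" where
  "gel I sc w e x \<tau> B a =
     (\<Sum>\<mu>\<in>{\<mu>\<in>Ibeta I B. ent \<mu> a \<noteq> ent \<mu> (a + 1)}. \<tau> a * e \<mu>)
   + (\<Sum>\<mu>\<in>{\<mu>\<in>Ibeta I B. ent \<mu> a = ent \<mu> (a + 1)}.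
        ((x (a + 1) - x a) * Pev sc w (ent \<mu> a) (x a) (x (a + 1)) - (x (a + 1) - x a) ^ 2 * \<tau> a) * e \<mu>)"

definition Anu :: "('k::comm_ring_1 \<Rightarrow> 'a::ring_1) \<Rightarrow> ('i \<Rightarrow> 'i \<Rightarrow> nat \<Rightarrow> nat \<Rightarrow> 'k) \<Rightarrow> ('i \<Rightarrow> nat \<Rightarrow> nat \<Rightarrow> 'k)
    \<Rightarrow> ('i \<Rightarrow> nat \<Rightarrow> 'k) \<Rightarrow> ('i \<Rightarrow> ('b \<Rightarrow> int) \<Rightarrow> int) \<Rightarrow> ('b \<Rightarrow> int) \<Rightarrow> (nat \<Rightarrow> 'a) \<Rightarrow> 'i \<Rightarrow> 'i list \<Rightarrow> 'a" where
  "Anu sc t w c hh L x i \<nu> =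
     aev sc c hh L i (x 1)
     * prod_list (map (\<lambda>a. Qev sc t i (ent \<nu> a) (x 1) (x (a + 1)))
                     (filter (\<lambda>a. ent \<nu> a \<noteq> i) [1..<length \<nu> + 1]))
     * prod_list (map (\<lambda>a. Pev sc w i (x 1) (x (a + 1)) * Pev sc w i (x (a + 1)) (x 1))
                     (filter (\<lambda>a. ent \<nu> a = i) [1..<length \<nu> + 1]))"

end

theory Submission
  imports Defs
begin

text \<open>Replace \<open>g\<^sub>a\<close> by the intertwiner \<open>h\<^sub>a\<close>, which is \<open>\<tau>\<^sub>a\<close> when the labels \<open>\<mu>\<^sub>a, \<mu>\<^sub>a\<^sub>+\<^sub>1\<close> differ and
\<open>P(x\<^sub>a, x\<^sub>a\<^sub>+\<^sub>1) - (x\<^sub>a\<^sub>+\<^sub>1 - x\<^sub>a) \<tau>\<^sub>a\<close> when they agree; then \<open>g\<^sub>a\<close> is \<open>h\<^sub>a\<close> times \<open>1\<close> or \<open>x\<^sub>a - x\<^sub>a\<^sub>+\<^sub>1\<close>. The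
intertwiners satisfy \<open>h\<^sub>a x\<^sub>b = x\<^sub>c h\<^sub>a\<close> with \<open>c = s\<^sub>a(b)\<close> and \<open>\<tau>\<^sub>a h\<^sub>a\<^sub>+\<^sub>1 h\<^sub>a = h\<^sub>a\<^sub>+\<^sub>1 h\<^sub>a \<tau>\<^sub>a\<^sub>+\<^sub>1\<close>. Induct on the
number of crossings. If \<open>\<nu>\<^sub>a \<noteq> i\<close>, then \<open>\<tau>\<^sub>a g\<^sub>a\<close> is \<open>Q(x\<^sub>a, x\<^sub>a\<^sub>+\<^sub>1)\<close>, which moves past
\<open>g\<^sub>a\<^sub>-\<^sub>1 \<cdots> g\<^sub>1\<close> as \<open>Q(x\<^sub>1, x\<^sub>a\<^sub>+\<^sub>1)\<close>. If \<open>\<nu>\<^sub>a = i\<close>, then \<open>\<tau>\<^sub>a g\<^sub>a = P(x\<^sub>a, x\<^sub>a\<^sub>+\<^sub>1) P(x\<^sub>a\<^sub>+\<^sub>1, x\<^sub>a) + P(x\<^sub>a, x\<^sub>a\<^sub>+\<^sub>1) h\<^sub>a\<close>: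
the first summand is the expected factor and the second one contributes
\<open>a(x\<^sub>1) \<tau>\<^sub>1 \<cdots> \<tau>\<^sub>a\<^sub>-\<^sub>1 h\<^sub>a \<cdots> h\<^sub>1 p = h\<^sub>a \<cdots> h\<^sub>1 a(x\<^sub>2) \<tau>\<^sub>2 \<cdots> \<tau>\<^sub>a p\<close> with \<open>p\<close> a polynomial in the \<open>x\<^sub>b\<close>,
which is an element of the left module because \<open>x\<^sub>1\<close> commutes with \<open>\<xi>(R(\<beta>))\<close>.

Since the algebra is only assumed to satisfy the relations, nothing can be cancelled in it; all
divisions are carried out in \<open>k[u,v,w]\<close>, where the differences of the variables are not zero
divisors, and the resulting identities are transported by evaluation.\<close>

section \<open>Evaluation of polynomials at commuting elements of a noncommutative ring\<close>

definition ring_hom1 :: "('r::ring_1 \<Rightarrow> 'a::ring_1) \<Rightarrow> bool" where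
  "ring_hom1 h \<longleftrightarrow> (\<forall>a b. h (a + b) = h a + h b) \<and> (\<forall>a b. h (a * b) = h a * h b) \<and> h 1 = 1"

lemma ring_hom1D:
  assumes "ring_hom1 h"
  shows "h (a + b) = h a + h b" "h (a * b) = h a * h b" "h 1 = 1" "h 0 = 0"
    "h (- a) = - h a" "h (a - b) = h a - h b" "h (a ^ n) = h a ^ n"
    "h (sum f S) = (\<Sum>s\<in>S. h (f s))"
proof -
  show add: "h (a + b) = h a + h b" for a b using assms by (simp add: ring_hom1_def)
  show "h (a * b) = h a * h b" for a b using assms by (simp add: ring_hom1_def)
  note mult = this
  show one: "h 1 = 1" using assms by (simp add: ring_hom1_def)
  show zero: "h 0 = 0" using add[of 0 0] by simp
  show neg: "h (- a) = - h a" for a using add[of a "- a"] zero by (simp add: eq_neg_iff_add_eq_0 add.commute)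
  show "h (a - b) = h a - h b" using add[of a "- b"] neg by simp
  show "h (a ^ n) = h a ^ n" by (induction n) (simp_all add: mult one)
  show "h (sum f S) = (\<Sum>s\<in>S. h (f s))"
    by (induction S rule: infinite_finite_induct) (simp_all add: zero add)
qed

lemma power_intertwine:
  fixes z a a' :: "'a::monoid_mult"
  assumes "z * a = a' * z"
  shows "z * a ^ n = a' ^ n * z"
proof (induction n)
  case (Suc n)
  have "z * a ^ Suc n = a' * (z * a ^ n)" by (simp add: assms flip: mult.assoc)
  then show ?case by (simp add: Suc.IH mult.assoc)
qed simp

text \<open>Coefficients stand to the left of the powers of \<open>c\<close>, as in
  \<open>eval3\<close>, so that iterating \<open>ev1\<close> from the innermost variable outwards
  gives \<open>eval3\<close>.\<close>

definition ev1 :: "('r::comm_ring_1 \<Rightarrow> 'a::ring_1) \<Rightarrow> 'a \<Rightarrow> 'r poly \<Rightarrow> 'a" where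
  "ev1 h c p = (\<Sum>k\<le>degree p. h (coeff p k) * c ^ k)"

text \<open>A common bound lets polynomials of different degrees be summed over one index
  range.\<close>

lemma ev1_extend:
  assumes "ring_hom1 h" "degree p \<le> N"
  shows "ev1 h c p = (\<Sum>k\<le>N. h (coeff p k) * c ^ k)"
  unfolding ev1_def
  by (rule sum.mono_neutral_left)
     (use assms in \<open>auto simp: coeff_eq_0 ring_hom1D(4)\<close>)

lemma ev1_pCons:
  assumes "ring_hom1 h"
  shows "ev1 h c (pCons a p) = h a + ev1 h c p * c"
proof -
  have "ev1 h c (pCons a p) = (\<Sum>k\<le>Suc (degree p). h (coeff (pCons a p) k) * c ^ k)"
    by (rule ev1_extend[OF assms]) (simp add: degree_pCons_le)
  also have "\<dots> = h a + (\<Sum>k\<le>degree p. h (coeff p k) * c ^ Suc k)"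
    by (subst sum.atMost_Suc_shift) simp
  also have "\<dots> = h a + ev1 h c p * c"
    by (simp add: ev1_def sum_distrib_right mult.assoc power_commutes)
  finally show ?thesis .
qed

lemma ev1_commute:
  assumes "\<And>r. y * h r = h r * y" "y * c = c * y"
  shows "y * ev1 h c p = ev1 h c p * y"
  unfolding ev1_def sum_distrib_left sum_distrib_right
proof (rule sum.cong[OF refl])
  fix k
  have "y * (h (coeff p k) * c ^ k) = h (coeff p k) * (y * c ^ k)"
    by (metis assms(1) mult.assoc)
  then show "y * (h (coeff p k) * c ^ k) = h (coeff p k) * c ^ k * y"
    by (simp add: power_intertwine[OF assms(2)] mult.assoc)
qed

text \<open>In the \<open>pCons\<close> step the factor \<open>c\<close> has to be moved past
  \<open>ev1 h c q\<close>; this is where the commutation of \<open>c\<close> with the images of the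
  coefficients enters.\<close>

lemma ring_hom1_ev1:
  assumes h: "ring_hom1 h" and c: "\<And>r. c * h r = h r * c"
  shows "ring_hom1 (ev1 h c)"
proof -
  note H = ring_hom1D[OF h]
  have cc: "c * ev1 h c q = ev1 h c q * c" for q by (rule ev1_commute) (use c in auto)
  have one: "ev1 h c 1 = 1" by (simp add: ev1_def H)
  have zero: "ev1 h c 0 = 0" by (simp add: ev1_def H)
  have add: "ev1 h c (p + q) = ev1 h c p + ev1 h c q" for p q
  proof -
    define N where "N = max (degree p) (degree q)"
    have "degree (p + q) \<le> N" "degree p \<le> N" "degree q \<le> N"
      by (auto simp: N_def degree_add_le)
    then show ?thesis
      by (simp add: ev1_extend[OF h] H distrib_right sum.distrib)
  qed
  have smul: "ev1 h c (smult a q) = h a * ev1 h c q" for a q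
  proof -
    have "ev1 h c (smult a q) = (\<Sum>k\<le>degree q. h (coeff (smult a q) k) * c ^ k)"
      by (rule ev1_extend[OF h]) (simp add: degree_smult_le)
    then show ?thesis by (simp add: ev1_def H sum_distrib_left mult.assoc)
  qed
  have "ev1 h c (p * q) = ev1 h c p * ev1 h c q" for p q
  proof (induction p)
    case 0 then show ?case by (simp add: zero)
  next
    case (pCons a p)
    have "ev1 h c (pCons a p * q) = h a * ev1 h c q + ev1 h c p * (ev1 h c q * c)"
      by (simp add: add smul ev1_pCons[OF h] pCons.IH H mult.assoc)
    then show ?case by (simp add: ev1_pCons[OF h] cc distrib_right mult.assoc)
  qed
  then show ?thesis by (simp add: ring_hom1_def add one)
qed

lemma eval3_ev1: "eval3 sc F a b c = ev1 (ev1 (ev1 sc a) b) c F"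
  by (simp add: eval3_def ev1_def sum_distrib_right mult.assoc)

locale eval_point =
  fixes sc :: "'k::comm_ring_1 \<Rightarrow> 'a::ring_1" and a b c :: 'a
  assumes hom: "ring_hom1 sc"
    and sc_central: "\<And>r y. sc r * y = y * sc r"
    and comm: "a * b = b * a" "a * c = c * a" "b * c = c * b"
begin

lemma hom2: "ring_hom1 (ev1 sc a)"
  by (rule ring_hom1_ev1) (simp_all add: hom sc_central)
lemma hom3: "ring_hom1 (ev1 (ev1 sc a) b)"
  by (rule ring_hom1_ev1[OF hom2], rule ev1_commute) (simp_all add: sc_central comm)

lemma eval3_hom: "ring_hom1 (\<lambda>F. eval3 sc F a b c)"
  unfolding eval3_ev1
  by (rule ring_hom1_ev1[OF hom3], rule ev1_commute, rule ev1_commute) (simp_all add: sc_central comm)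

lemma eval3_commute:
  assumes "y * a = a * y" "y * b = b * y" "y * c = c * y"
  shows "y * eval3 sc F a b c = eval3 sc F a b c * y"
  unfolding eval3_ev1
  by (intro ev1_commute) (simp_all add: sc_central assms)

lemmas eval3_simps = ring_hom1D[OF eval3_hom]

lemma eval3_const3 [simp]: "eval3 sc (const3 r) a b c = sc r"
  by (simp add: eval3_def const3_def)
lemma eval3_U3 [simp]: "eval3 sc U3 a b c = a"
  using ring_hom1D(3,4)[OF hom] by (simp add: eval3_ev1 ev1_def U3_def)
lemma eval3_V3 [simp]: "eval3 sc V3 a b c = b"
  using ring_hom1D(3,4)[OF hom] by (simp add: eval3_ev1 ev1_def V3_def)
lemma eval3_W3 [simp]: "eval3 sc W3 a b c = c"
  using ring_hom1D(3,4)[OF hom] by (simp add: eval3_ev1 ev1_def W3_def)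

text \<open>Both sides are the same sum of monomials because evaluation is a homomorphism. This
  identifies the value of a polynomial with renamed variables with its value at another triple of
  the \<open>x\<^sub>b\<close>.\<close>

lemma eval3_comp:
  "eval3 sc (eval3 const3 F X Y Z) a b c = eval3 sc F (eval3 sc X a b c) (eval3 sc Y a b c) (eval3 sc Z a b c)"
proof -
  have "eval3 sc (const3 r * X ^ k * Y ^ l * Z ^ m) a b c
      = sc r * eval3 sc X a b c ^ k * eval3 sc Y a b c ^ l * eval3 sc Z a b c ^ m" for r k l m
    by (simp only: eval3_simps(2,7) eval3_const3)
  then show ?thesis
    unfolding eval3_def[of const3] eval3_def[of sc F] eval3_simps(8) by simp
qed

end

lemma const3_hom: "ring_hom1 const3"
  by (simp add: ring_hom1_def const3_def one_pCons)

text \<open>The polynomial ring is itself an admissible target, so substituting polynomials for the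
  variables is an instance of \<open>eval3\<close>.\<close>

lemma eval_point_const3: "eval_point const3 X Y Z"
  by unfold_locales (simp_all add: const3_hom mult.commute)

text \<open>For coefficients with infinite support both this sum and \<open>poly2\<close> are \<open>0\<close>, which is why no
finiteness assumption appears below.\<close>

definition pe :: "('k::comm_ring_1 \<Rightarrow> 'a::ring_1) \<Rightarrow> (nat \<Rightarrow> nat \<Rightarrow> 'k) \<Rightarrow> 'a \<Rightarrow> 'a \<Rightarrow> 'a" where
  "pe sc cf a b = (\<Sum>pq\<in>{(p, q). cf p q \<noteq> 0}. sc (cf (fst pq) (snd pq)) * a ^ fst pq * b ^ snd pq)"

lemma poly2_pe: "poly2 = pe const3"
  by (intro ext) (simp add: poly2_def pe_def)

lemma pe_hom:
  assumes "ring_hom1 h" "\<And>r. h (s r) = s' r"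
  shows "h (pe s cf X Y) = pe s' cf (h X) (h Y)"
  by (simp add: pe_def ring_hom1D[OF assms(1)] assms(2))

lemma (in eval_point) eval3_poly2:
  "eval3 sc (poly2 cf X Y) a b c = pe sc cf (eval3 sc X a b c) (eval3 sc Y a b c)"
  unfolding poly2_pe by (rule pe_hom[OF eval3_hom]) simp

text \<open>\<open>z\<close> passes each monomial one power at a time. This is how intertwiners are
  moved past values of \<open>P\<close> and \<open>Q\<close>.\<close>

lemma pe_intertwine:
  assumes "\<And>r. sc r * z = z * sc r" "z * a = a' * z" "z * b = b' * z"
  shows "z * pe sc cf a b = pe sc cf a' b' * z"
  unfolding pe_def sum_distrib_left sum_distrib_right
proof (rule sum.cong[OF refl])
  fix pq :: "nat \<times> nat"
  let ?r = "sc (cf (fst pq) (snd pq))"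
  have "z * (?r * a ^ fst pq * b ^ snd pq) = ?r * (z * a ^ fst pq) * b ^ snd pq"
    by (metis assms(1) mult.assoc)
  also have "\<dots> = ?r * a' ^ fst pq * (z * b ^ snd pq)"
    by (simp add: power_intertwine[OF assms(2)] mult.assoc)
  finally show "z * (?r * a ^ fst pq * b ^ snd pq) = ?r * a' ^ fst pq * b' ^ snd pq * z"
    by (simp add: power_intertwine[OF assms(3)] mult.assoc)
qed

text \<open>With the symmetry of the coefficients \<open>t\<close> this becomes
  \<open>Q\<^sub>i\<^sub>j(u,v) = Q\<^sub>j\<^sub>i(v,u)\<close> for values in the algebra.\<close>

lemma pe_swap:
  assumes "a * b = b * a"
  shows "pe sc cf a b = pe sc (\<lambda>p q. cf q p) b a"
proof -
  have "a ^ p * b ^ q = b ^ q * a ^ p" for p q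
    using power_intertwine[of b "a ^ p" "a ^ p" q] power_intertwine[of b a a p] assms
    by (metis power_commuting_commutes)
  then show ?thesis
    unfolding pe_def
    by (intro sum.reindex_bij_witness[where i = prod.swap and j = prod.swap]) (auto simp: mult.assoc)
qed

lemma diff_dvd_power_diff: "a - b dvd a ^ n - (b::'a::comm_ring_1) ^ n"
proof (cases n)
  case (Suc k)
  show ?thesis unfolding Suc by (simp only: power_diff_sumr2 dvd_triv_left)
qed simp

lemma pe_diff_dvd:
  fixes a b c :: "'a::comm_ring_1"
  shows "a - b dvd pe s cf b c - pe s cf a c" "a - b dvd pe s cf c b - pe s cf c a"
proof -
  have pw: "a - b dvd b ^ n - a ^ n" for n
    using diff_dvd_power_diff[of b a n] unfolding minus_dvd_iff[of "b - a", symmetric] by simp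
  have *: "k * b ^ n * l - k * a ^ n * l = (b ^ n - a ^ n) * (k * l)" for k l n
    by (simp add: algebra_simps)
  have **: "k * l * b ^ n - k * l * a ^ n = (b ^ n - a ^ n) * (k * l)" for k l n
    by (simp add: algebra_simps)
  show "a - b dvd pe s cf b c - pe s cf a c" "a - b dvd pe s cf c b - pe s cf c a"
    unfolding pe_def sum_subtractf[symmetric] * **
    by (intro dvd_sum dvd_mult2 pw)+
qed

section \<open>Divided differences in three variables\<close>

text \<open>The ring \<open>k\<close> may have zero divisors, so cancellation is available only for
  particular elements.\<close>

definition nzd :: "'a::comm_ring_1 \<Rightarrow> bool" where
  "nzd a \<longleftrightarrow> (\<forall>b. a * b = 0 \<longrightarrow> b = 0)"

lemma nzd_cancel: "nzd a \<Longrightarrow> a * b = a * c \<Longrightarrow> b = c"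
  unfolding nzd_def right_minus_eq[of b c, symmetric] right_minus_eq[of "a * b", symmetric]
  by (simp only: right_diff_distrib)

lemma nzd_mult: "nzd a \<Longrightarrow> nzd b \<Longrightarrow> nzd (a * b)"
  unfolding nzd_def mult.assoc by blast

lemma nzd_uminus: "nzd (- a) \<longleftrightarrow> nzd a"
  unfolding nzd_def mult_minus_left neg_equal_0_iff_equal ..

text \<open>The factor is monic, so the coefficient in degree \<open>degree b + 1\<close> of the
  product is the leading coefficient of \<open>b\<close>, whatever the coefficient ring.\<close>

lemma nzd_monic_linear: "nzd [:- a, 1:]"
  unfolding nzd_def
proof (intro allI impI)
  fix b assume 0: "[:- a, 1:] * b = 0"
  show "b = 0"
  proof (rule ccontr)
    assume "b \<noteq> 0"
    have "coeff ([:- a, 1:] * b) (Suc (degree b)) = lead_coeff b"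
      by (simp add: coeff_eq_0)
    with 0 \<open>b \<noteq> 0\<close> show False by simp
  qed
qed

lemma nzd_const:
  assumes "nzd a" shows "nzd [:a:]"
  unfolding nzd_def
proof (intro allI impI)
  fix b assume "[:a:] * b = 0"
  then have "a * coeff b k = 0" for k by (metis coeff_0 coeff_smult mult.right_neutral mult_pCons_left mult_zero_left pCons_0_0 add.right_neutral)
  then have "coeff b k = 0" for k using assms unfolding nzd_def by blast
  then show "b = 0" by (simp add: poly_eq_iff)
qed

text \<open>Up to sign each difference is a monic linear polynomial in the outer of its two
  variables, viewed as a constant in \<open>W3\<close> in the first case.\<close>

lemma nzd3: "nzd (U3 - V3)" "nzd (U3 - W3)" "nzd (V3 - W3)"
proof -
  have *: "U3 - V3 = - [:[:- [:0, 1:], 1:]:]" "U3 - W3 = - [:- [:[:0,1:]:], 1:]" "V3 - W3 = - [:- [:0,1:], 1:]"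
    by (simp_all add: U3_def V3_def W3_def)
  show "nzd (U3 - V3)" "nzd (U3 - W3)" "nzd (V3 - W3)"
    unfolding * nzd_uminus by (intro nzd_const nzd_monic_linear)+
qed

text \<open>Divisibility gives existence and cancellability gives uniqueness, so the
  \<open>THE\<close> in the definitions of the divided differences denotes the exact
  quotient.\<close>

lemma the_quotient:
  assumes "nzd a" "a dvd b"
  shows "a * (THE G. a * G = b) = b"
proof -
  obtain G where "b = a * G" using assms(2) by (elim dvdE)
  then have "\<exists>!G. a * G = b" using nzd_cancel[OF assms(1)] by auto
  then show ?thesis by (rule theI')
qed

lemma pe_flip_dvd:
  fixes a b :: "'a::comm_ring_1"
  shows "a - b dvd pe s cf b a - pe s cf a b"
proof -
  \<comment> \<open>The diagonal value \<open>pe s cf a a\<close> is inserted so that each bracket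
    changes a single argument.\<close>
  have "pe s cf b a - pe s cf a b = (pe s cf b a - pe s cf a a) - (pe s cf a b - pe s cf a a)" by simp
  moreover have "a - b dvd pe s cf b a - pe s cf a a" by (rule pe_diff_dvd)
  moreover have "a - b dvd pe s cf a b - pe s cf a a" by (rule pe_diff_dvd)
  ultimately show ?thesis by (simp only: dvd_diff)
qed

lemma dP: "(U3 - V3) * dP w j = poly2 (w j) V3 U3 - poly2 (w j) U3 V3"
  unfolding dP_def by (rule the_quotient) (simp_all add: nzd3 poly2_pe pe_flip_dvd)

lemma Qbar: "(U3 - W3) * Qbar t j l = poly2 (t j l) U3 V3 - poly2 (t j l) W3 V3"
proof -
  have "U3 - W3 dvd poly2 (t j l) U3 V3 - poly2 (t j l) W3 V3"
    using pe_diff_dvd(1)[of U3 W3 const3 "t j l" V3] unfolding poly2_pe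
    by (metis dvd_minus_iff minus_diff_eq)
  then show ?thesis unfolding Qbar_def by (rule the_quotient[OF nzd3(2)])
qed

text \<open>The factor theorem is applied twice: \<open>b\<close> remains a root after the factor of
  \<open>a\<close> is split off, because \<open>a - b\<close> can be cancelled.\<close>

lemma two_roots_dvd:
  assumes "poly F a = 0" "poly F b = 0" "nzd (a - b)"
  shows "[:- a, 1:] * [:- b, 1:] dvd F"
proof -
  obtain G where G: "F = [:- a, 1:] * G" using assms(1) by (auto simp: poly_eq_0_iff_dvd elim: dvdE)
  have "(b - a) * poly G b = 0" using assms(2) by (simp add: G algebra_simps)
  then have "(a - b) * poly G b = 0" by (metis minus_diff_eq minus_mult_left minus_zero)
  then have "poly G b = 0" using assms(3) unfolding nzd_def by blast
  then show ?thesis unfolding G poly_eq_0_iff_dvd by (rule mult_dvd_mono[OF dvd_refl])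
qed

lemma poly_eval_hom: "ring_hom1 (\<lambda>F. poly F r)"
  by (simp add: ring_hom1_def)

lemma poly_poly2: "poly (poly2 cf X Y) r = pe (\<lambda>k. [:[:k:]:]) cf (poly X r) (poly Y r)"
  unfolding poly2_pe by (rule pe_hom[OF poly_eval_hom]) (simp add: const3_def)

text \<open>Divided differences are controlled only after multiplication by \<open>u - v\<close>, so
  the vanishing at the two roots is required in that scaled form.\<close>

lemma two_roots_dvd_scaled: "[:- u, 1:] * [:- v, 1:] dvd F"
  if "nzd (u - v)" "(u - v) * poly F u = 0" "(u - v) * poly F v = 0"
  by (rule two_roots_dvd) (use that in \<open>unfold nzd_def, blast+\<close>)

text \<open>As a polynomial in the outermost variable this has the roots \<open>U3\<close> and
  \<open>V3\<close>, so divisibility by it can be tested by setting \<open>W3\<close> equal to each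
  of them.\<close>

lemma W3_minus: "(W3 - U3) * (W3 - V3) = [:- [:[:0, 1:]:], 1:] * [:- [:0, 1:], 1:]"
  by (simp add: U3_def V3_def W3_def)

lemma W3_minus_flip: "(W3 - U3) * (W3 - V3) = (U3 - W3) * (V3 - W3)"
  by (simp add: algebra_simps)

section \<open>Exact divisibility behind \<open>Pbar1\<close> and \<open>Pbar2\<close>\<close>

context
  fixes w :: "'i \<Rightarrow> nat \<Rightarrow> nat \<Rightarrow> 'k::comm_ring_1" and j :: 'i and G1 E12 E23 D :: "'k poly poly poly"
  assumes G1: "(U3 - V3) * G1 = poly2 (w j) V3 W3 - poly2 (w j) U3 W3"
    and E12: "(U3 - V3) * E12 = poly2 (w j) V3 U3 - poly2 (w j) U3 V3"
    and E23: "(V3 - W3) * E23 = poly2 (w j) W3 V3 - poly2 (w j) V3 W3"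
    and D: "D = (W3 - U3) * G1 - poly2 (w j) U3 W3"
begin

text \<open>\<open>D\<close> is the divided difference of
  \<open>F = (W3 - V3) * poly2 (w j) U3 W3\<close> under the exchange of \<open>U3\<close> and
  \<open>V3\<close>, written without a division.\<close>

lemma D_eq: "(U3 - V3) * D = (W3 - U3) * poly2 (w j) V3 W3 - (W3 - V3) * poly2 (w j) U3 W3"
proof -
  have "(U3 - V3) * D = (W3 - U3) * ((U3 - V3) * G1) - (U3 - V3) * poly2 (w j) U3 W3"
    unfolding D by (simp add: algebra_simps)
  then show ?thesis unfolding G1 by (simp add: algebra_simps)
qed

text \<open>The outermost variable is set to \<open>r\<close>. The choices \<open>r = u\<close> and
  \<open>r = v\<close> will test the two roots; the auxiliary quotients enter only through their
  products with \<open>u - v\<close> or \<open>v - r\<close>.\<close>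

lemma eval_W3:
  fixes r :: "'k poly poly"
  defines "f \<equiv> pe (\<lambda>k. [:[:k:]:]) (w j)"
  defines "u \<equiv> [:[:0, 1:]:]" and "v \<equiv> [:0, 1:]"
  shows "nzd (u - v :: 'k poly poly)"
    "poly U3 r = u" "poly V3 r = v" "poly W3 r = r"
    "(u - v) * poly D r = (r - u) * f v r - (r - v) * f u r"
    "(u - v) * poly E12 r = f v u - f u v"
    "(v - r) * poly E23 r = f r v - f v r"
    "poly (poly2 (w j) X Y) r = f (poly X r) (poly Y r)"
proof -
  have *: "[:[:0, 1:]:] - [:0, 1:] = - [:- [:0, 1:], 1::'k poly:]" by simp
  show "nzd (u - v)" unfolding u_def v_def * nzd_uminus by (rule nzd_monic_linear)
  show pU: "poly U3 r = u" and pV: "poly V3 r = v" and pW: "poly W3 r = r"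
    by (simp_all add: U3_def V3_def W3_def u_def v_def)
  show pp: "poly (poly2 (w j) X Y) r = f (poly X r) (poly Y r)" for X Y by (simp add: poly_poly2 f_def)
  show "(u - v) * poly D r = (r - u) * f v r - (r - v) * f u r"
    using arg_cong[OF D_eq, of "\<lambda>F. poly F r"] by (simp add: pU pV pW pp)
  show "(u - v) * poly E12 r = f v u - f u v"
    using arg_cong[OF E12, of "\<lambda>F. poly F r"] by (simp add: pU pV pW pp)
  show "(v - r) * poly E23 r = f r v - f v r"
    using arg_cong[OF E23, of "\<lambda>F. poly F r"] by (simp add: pU pV pW pp)
qed

text \<open>The right-hand side is the numerator of \<open>Pbar1\<close> divided by
  \<open>U3 - V3\<close>. Its value times \<open>u - v\<close> cancels termwise at
  \<open>W3 = U3\<close> and at \<open>W3 = V3\<close>.\<close>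

lemma Pbar1_quotient_dvd:
  "(W3 - U3) * (W3 - V3) dvd poly2 (w j) U3 W3 * poly2 (w j) V3 W3
     - (W3 - V3) * poly2 (w j) U3 W3 * E12 + poly2 (w j) U3 V3 * D" (is "_ dvd ?X")
proof -
  define u v :: "'k poly poly" where "u = [:[:0, 1:]:]" and "v = [:0, 1:]"
  define f where "f = pe (\<lambda>k::'k. [:[:k:]:]) (w j)"
  note R = eval_W3[folded u_def v_def f_def]
  have X: "(u - v) * poly ?X r = (u - v) * f u r * f v r - (r - v) * f u r * (f v u - f u v)
             + f u v * ((r - u) * f v r - (r - v) * f u r)" for r
    unfolding R(5)[symmetric] R(6)[of r, symmetric] by (simp add: R(2-4,8) algebra_simps)
  show ?thesis unfolding W3_minus u_def[symmetric] v_def[symmetric]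
    by (rule two_roots_dvd_scaled[OF R(1)]) (unfold X, simp_all add: algebra_simps)
qed

lemma Pbar2_quotient_dvd:
  "(W3 - U3) * (W3 - V3) dvd poly2 (w j) U3 W3 * (W3 - V3) * E23
     - poly2 (w j) U3 W3 * poly2 (w j) V3 W3 - poly2 (w j) U3 V3 * D" (is "_ dvd ?X")
proof -
  define u v :: "'k poly poly" where "u = [:[:0, 1:]:]" and "v = [:0, 1:]"
  define f where "f = pe (\<lambda>k::'k. [:[:k:]:]) (w j)"
  note R = eval_W3[folded u_def v_def f_def]
  have X: "(u - v) * poly ?X r = - (u - v) * f u r * ((v - r) * poly E23 r) - (u - v) * f u r * f v r
             - f u v * ((r - u) * f v r - (r - v) * f u r)" for r
    unfolding R(5)[symmetric] by (simp add: R(2-4,8) algebra_simps)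
  show ?thesis unfolding W3_minus u_def[symmetric] v_def[symmetric]
    by (rule two_roots_dvd_scaled[OF R(1)]) (unfold X R(7), simp_all add: algebra_simps)
qed

text \<open>Multiplying by \<open>U3 - V3\<close> turns \<open>E12\<close> and \<open>D\<close> into
  plain differences and yields the numerator in the definition. The factor
  \<open>(W3 - U3) * (W3 - V3)\<close> is kept on the left because it is the coefficient of the
  braid words when two adjacent intertwiners are multiplied out.\<close>

lemma Pbar1_eq:
  "(W3 - U3) * (W3 - V3) * Pbar1 w j = poly2 (w j) U3 W3 * poly2 (w j) V3 W3
     - (W3 - V3) * poly2 (w j) U3 W3 * E12 + poly2 (w j) U3 V3 * D" (is "_ = ?X")
proof -
  let ?N = "poly2 (w j) V3 U3 * poly2 (w j) U3 W3 * (V3 - W3)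
    + poly2 (w j) U3 W3 * poly2 (w j) V3 W3 * (U3 - V3)
    - poly2 (w j) U3 V3 * poly2 (w j) V3 W3 * (U3 - W3)"
  have "(U3 - V3) * ?X = (U3 - V3) * poly2 (w j) U3 W3 * poly2 (w j) V3 W3
     - (W3 - V3) * poly2 (w j) U3 W3 * ((U3 - V3) * E12) + poly2 (w j) U3 V3 * ((U3 - V3) * D)"
    by (simp add: algebra_simps)
  then have N: "(U3 - V3) * ?X = ?N"
    unfolding E12 D_eq by (simp add: algebra_simps)
  have d: "(U3 - V3) * ((W3 - U3) * (W3 - V3)) = (U3 - V3) * (U3 - W3) * (V3 - W3)"
    by (simp add: algebra_simps)
  have "(U3 - V3) * (U3 - W3) * (V3 - W3) dvd ?N"
    unfolding N[symmetric] d[symmetric] by (intro mult_dvd_mono dvd_refl Pbar1_quotient_dvd)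
  then have "(U3 - V3) * (U3 - W3) * (V3 - W3) * Pbar1 w j = ?N"
    unfolding Pbar1_def by (intro the_quotient nzd_mult nzd3)
  then show ?thesis unfolding N[symmetric] W3_minus_flip mult.assoc[of "U3 - V3"]
    by (rule nzd_cancel[OF nzd3(1)])
qed

lemma Pbar2_eq:
  "(W3 - U3) * (W3 - V3) * Pbar2 w j = poly2 (w j) U3 W3 * (W3 - V3) * E23
     - poly2 (w j) U3 W3 * poly2 (w j) V3 W3 - poly2 (w j) U3 V3 * D" (is "_ = ?X")
proof -
  let ?N = "- (poly2 (w j) U3 V3 * poly2 (w j) U3 W3 * (V3 - W3))
    - poly2 (w j) U3 W3 * poly2 (w j) W3 V3 * (U3 - V3)
    + poly2 (w j) U3 V3 * poly2 (w j) V3 W3 * (U3 - W3)"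
  have "(U3 - V3) * ?X = - (U3 - V3) * poly2 (w j) U3 W3 * ((V3 - W3) * E23)
     - (U3 - V3) * poly2 (w j) U3 W3 * poly2 (w j) V3 W3 - poly2 (w j) U3 V3 * ((U3 - V3) * D)"
    by (simp add: algebra_simps)
  then have N: "(U3 - V3) * ?X = ?N"
    unfolding E23 D_eq by (simp add: algebra_simps)
  have d: "(U3 - V3) * ((W3 - U3) * (W3 - V3)) = (U3 - V3) * (U3 - W3) * (V3 - W3)"
    by (simp add: algebra_simps)
  have "(U3 - V3) * (U3 - W3) * (V3 - W3) dvd ?N"
    unfolding N[symmetric] d[symmetric] by (intro mult_dvd_mono dvd_refl Pbar2_quotient_dvd)
  then have "(U3 - V3) * (U3 - W3) * (V3 - W3) * Pbar2 w j = ?N"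
    unfolding Pbar2_def by (intro the_quotient nzd_mult nzd3)
  then show ?thesis unfolding N[symmetric] W3_minus_flip mult.assoc[of "U3 - V3"]
    by (rule nzd_cancel[OF nzd3(1)])
qed

end

text \<open>Setting \<open>W3\<close> to \<open>0\<close> gives another quotient for the same
  numerator, and the quotient is unique. Hence \<open>dP\<close> may be evaluated with any third
  coordinate.\<close>

lemma dP_subst12: "eval3 const3 (dP w j) U3 V3 0 = dP w j"
proof -
  interpret eval_point const3 U3 V3 0 by (rule eval_point_const3)
  have "(U3 - V3) * eval3 const3 (dP w j) U3 V3 0 = poly2 (w j) V3 U3 - poly2 (w j) U3 V3"
    using arg_cong[OF dP[of w j], of "\<lambda>F. eval3 const3 F U3 V3 0"]
    by (simp add: eval3_simps eval3_poly2[unfolded poly2_pe] poly2_pe)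
  then show ?thesis unfolding dP[symmetric] by (rule nzd_cancel[OF nzd3(1)])
qed

lemma dP_subst23:
  "(V3 - W3) * eval3 const3 (dP w j) V3 W3 0 = poly2 (w j) W3 V3 - poly2 (w j) V3 W3"
proof -
  interpret eval_point const3 V3 W3 0 by (rule eval_point_const3)
  show ?thesis
    using arg_cong[OF dP[of w j], of "\<lambda>F. eval3 const3 F V3 W3 0"]
    by (simp add: eval3_simps eval3_poly2[unfolded poly2_pe] poly2_pe)
qed

section \<open>Crossings of equally labelled strands\<close>

text \<open>The relations of \<open>R(n)\<close> hold only after multiplication by an idempotent; \<open>E\<close> plays that role.\<close>

locale crossing = eval_point sc a b c
  for sc :: "'k::comm_ring_1 \<Rightarrow> 'a::ring_1" and a b c +
  fixes s E :: 'a and K :: "'k poly poly poly"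
  assumes E_comm: "E * a = a * E" "E * b = b * E" "E * c = c * E" "E * s = s * E"
    and sa: "s * a * E = (b * s - eval3 sc K a b c) * E"
    and sb: "s * b * E = (a * s + eval3 sc K a b c) * E"
    and s_c: "s * c * E = c * s * E"
begin

abbreviation ev :: "'k poly poly poly \<Rightarrow> 'a" where "ev F \<equiv> eval3 sc F a b c"

lemma E_ev: "E * ev F = ev F * E"
  by (intro eval3_commute E_comm)

text \<open>A graph form of \<open>F' = s\<^sub>1 F\<close>, closed under the ring operations. The quotient \<open>G\<close> is unique,
so it can be identified afterwards by a computation in the polynomial ring.\<close>

definition swaps :: "'k poly poly poly \<Rightarrow> 'k poly poly poly \<Rightarrow> bool" where
  "swaps F F' \<longleftrightarrow> (\<exists>G. (U3 - V3) * G = F' - F \<and> s * ev F * E = (ev F' * s + ev (K * G)) * E)"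

lemma swaps_intertwine:
  assumes "swaps F F'" "(U3 - V3) * G = F' - F"
  shows "s * ev F * E = (ev F' * s + ev (K * G)) * E"
proof -
  obtain H where H: "(U3 - V3) * H = F' - F" "s * ev F * E = (ev F' * s + ev (K * H)) * E"
    using assms(1) by (auto simp: swaps_def)
  moreover have "G = H" by (rule nzd_cancel[OF nzd3(1)]) (simp add: H assms(2))
  ultimately show ?thesis by simp
qed

lemma swaps_UVW [simp]: "swaps U3 V3" "swaps V3 U3" "swaps W3 W3" and swaps_const3 [simp]: "swaps (const3 r) (const3 r)"
proof -
  \<comment> \<open>The witnesses \<open>-1\<close>, \<open>1\<close> and \<open>0\<close> are the
    quotients of \<open>V3 - U3\<close>, \<open>U3 - V3\<close> and \<open>0\<close> by
    \<open>U3 - V3\<close>; their signs match the correction terms in \<open>sa\<close> and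
    \<open>sb\<close>.\<close>
  show "swaps U3 V3" unfolding swaps_def
    by (rule exI[of _ "-1"]) (simp add: sa eval3_simps)
  show "swaps V3 U3" unfolding swaps_def
    by (rule exI[of _ "1"]) (simp add: sb eval3_simps)
  show "swaps W3 W3" unfolding swaps_def
    by (rule exI[of _ "0"]) (simp add: s_c eval3_simps)
  show "swaps (const3 r) (const3 r)" unfolding swaps_def
    by (rule exI[of _ "0"]) (simp add: sc_central eval3_simps)
qed

lemma swaps_add: assumes "swaps F F'" "swaps G G'" shows "swaps (F + G) (F' + G')"
proof -
  obtain H J where "(U3 - V3) * H = F' - F" "s * ev F * E = (ev F' * s + ev (K * H)) * E"
    "(U3 - V3) * J = G' - G" "s * ev G * E = (ev G' * s + ev (K * J)) * E"
    using assms by (auto simp: swaps_def)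
  then show ?thesis unfolding swaps_def
    by (intro exI[of _ "H + J"]) (simp add: eval3_simps distrib_left distrib_right)
qed

lemma swaps_mult: assumes "swaps F F'" "swaps G G'" shows "swaps (F * G) (F' * G')"
proof -
  obtain H J where H: "(U3 - V3) * H = F' - F" "s * ev F * E = (ev F' * s + ev (K * H)) * E"
    and J: "(U3 - V3) * J = G' - G" "s * ev G * E = (ev G' * s + ev (K * J)) * E"
    using assms by (auto simp: swaps_def)
  \<comment> \<open>Twisted Leibniz rule: moving \<open>s\<close> past \<open>F\<close> first and
    past \<open>G\<close> afterwards produces the quotient \<open>F' * J + H * G\<close>.\<close>
  have "(U3 - V3) * (F' * J + H * G) = F' * ((U3 - V3) * J) + ((U3 - V3) * H) * G"
    by (simp add: algebra_simps)
  also have "\<dots> = F' * G' - F * G" unfolding H J by (simp add: algebra_simps)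
  finally have 1: "(U3 - V3) * (F' * J + H * G) = F' * G' - F * G" .
  have "s * ev (F * G) * E = (s * ev F * E) * ev G"
    by (simp add: eval3_simps mult.assoc E_ev)
  also have "\<dots> = ev F' * (s * ev G * E) + ev (K * H * G) * E"
    unfolding H by (simp add: eval3_simps mult.assoc E_ev distrib_right distrib_left)
  also have "\<dots> = (ev (F' * G') * s + ev (K * (F' * J + H * G))) * E"
  proof -
    have "K * (F' * J + H * G) = F' * (K * J) + K * H * G" by (simp add: algebra_simps)
    then show ?thesis unfolding J
      by (simp only: eval3_simps(1,2)) (simp add: distrib_left distrib_right mult.assoc)
  qed
  finally show ?thesis unfolding swaps_def using 1 by blast
qed

lemma swaps_uminus: assumes "swaps F F'" shows "swaps (- F) (- F')"
proof -
  have "- 1 = const3 (- 1 :: 'k)" by (simp add: ring_hom1D[OF const3_hom])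
  then have "swaps (- 1) (- 1)" by simp
  from swaps_mult[OF this assms] show ?thesis by simp
qed

lemma swaps_diff: "swaps F F' \<Longrightarrow> swaps G G' \<Longrightarrow> swaps (F - G) (F' - G')"
  using swaps_add[of F F' "- G" "- G'"] swaps_uminus by simp

lemma swaps_power: "swaps F F' \<Longrightarrow> swaps (F ^ n) (F' ^ n)"
proof (induction n)
  case 0 then show ?case using swaps_const3[of 1] by (simp add: ring_hom1D[OF const3_hom])
qed (simp add: swaps_mult)

lemma swaps_poly2:
  assumes "swaps X X'" "swaps Y Y'" shows "swaps (poly2 cf X Y) (poly2 cf X' Y')"
proof -
  have 0: "swaps 0 0" using swaps_const3[of 0] by (simp add: ring_hom1D[OF const3_hom])
  have sum: "(\<And>i. swaps (f i) (f' i)) \<Longrightarrow> swaps (sum f S) (sum f' S)" for f f' and S :: "(nat \<times> nat) set"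
    by (induction S rule: infinite_finite_induct) (simp_all add: 0 swaps_add)
  show ?thesis unfolding poly2_def by (intro sum swaps_mult swaps_power swaps_const3 assms)
qed

lemmas swaps_intros = swaps_UVW swaps_add swaps_mult swaps_uminus swaps_diff swaps_power swaps_poly2

end

text \<open>This is \<open>\<tau>\<^sub>a g\<^sub>a\<close> for equal labels. The square of
  \<open>V3 - U3\<close> is symmetric, so \<open>s\<close> passes it without correction, and one
  factor \<open>U3 - V3\<close> turns the \<open>dP\<close> from \<open>s * s\<close> into a
  difference of values of \<open>P\<close>.\<close>

lemma (in crossing) crossing_square:
  assumes K: "K = poly2 (w j) U3 V3"
    and ss: "s * s * E = ev (dP w j) * s * E"
  shows "s * (ev ((V3 - U3) * K) - ev ((V3 - U3)\<^sup>2) * s) * E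
       = ev K * (ev (poly2 (w j) V3 U3) + (ev K - ev (V3 - U3) * s)) * E"
proof -
  let ?K' = "poly2 (w j) V3 U3"
  have VU: "swaps (V3 - U3) (U3 - V3)" by (intro swaps_intros)
  have KK: "swaps K ?K'" using swaps_poly2[OF swaps_UVW(1,2), of "w j"] K by simp
  have "s * ev ((V3 - U3) * K) * E = (ev ((U3 - V3) * ?K') * s + ev (K * (?K' + K))) * E"
    by (rule swaps_intertwine[OF swaps_mult[OF VU KK]]) (simp add: algebra_simps)
  moreover have "s * ev ((V3 - U3)\<^sup>2) * E = (ev ((U3 - V3)\<^sup>2) * s + ev (K * 0)) * E"
    by (rule swaps_intertwine[OF swaps_power[OF VU]]) (simp add: power2_eq_square algebra_simps)
  moreover have "s * ev ((V3 - U3)\<^sup>2) * s * E = (s * ev ((V3 - U3)\<^sup>2) * E) * s"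
    by (simp add: mult.assoc E_comm(4))
  ultimately have *: "s * ev ((V3 - U3) * K) * E = (ev ((U3 - V3) * ?K') * s + ev (K * (?K' + K))) * E"
    and **: "s * ev ((V3 - U3)\<^sup>2) * s * E = ev ((U3 - V3)\<^sup>2) * (s * s * E)"
    by (simp_all add: mult.assoc E_comm(4) ring_hom1D(4)[OF eval3_hom])
  note **
  also have "\<dots> = ev ((U3 - V3) * ((U3 - V3) * dP w j)) * s * E"
    unfolding ss by (simp add: eval3_simps power2_eq_square mult.assoc)
  also have "\<dots> = ev ((U3 - V3) * (?K' - K)) * s * E" by (simp only: dP K)
  finally have "s * (ev ((V3 - U3) * K) - ev ((V3 - U3)\<^sup>2) * s) * E
     = (ev ((U3 - V3) * ?K' - (U3 - V3) * (?K' - K)) * s + ev (K * (?K' + K))) * E"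
    using * by (simp add: eval3_simps(6) right_diff_distrib left_diff_distrib distrib_right flip: mult.assoc)
  \<comment> \<open>The values of \<open>P\<close> with exchanged arguments cancel; what remains is
    the \<open>s\<close> part of \<open>K\<close> times the intertwiner.\<close>
  also have "(U3 - V3) * ?K' - (U3 - V3) * (?K' - K) = - (K * (V3 - U3))"
    by (simp add: algebra_simps)
  finally show ?thesis
    by (simp only: eval3_simps(1,2,5)) (simp add: algebra_simps)
qed

text \<open>Expand \<open>h2 * h1\<close> in the words \<open>1\<close>, \<open>t\<close>,
  \<open>s\<close>, \<open>t * s\<close> with polynomial coefficients. In the difference of the two
  sides the terms in \<open>s * t\<close> cancel, the squares reduce by \<open>dP\<close>, and the
  braid words occur with the common coefficient \<open>DD\<close>. The remaining coefficients of
  \<open>s\<close> and \<open>t\<close> vanish by the equations for \<open>Pbar1\<close> and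
  \<open>Pbar2\<close>.\<close>

lemma (in crossing) crossing_braid:
  fixes t :: 'a and w :: "'i \<Rightarrow> nat \<Rightarrow> nat \<Rightarrow> 'k" and j :: 'i
  defines "h1 \<equiv> ev K - ev (V3 - U3) * s" and "h2 \<equiv> ev (poly2 (w j) V3 W3) - ev (W3 - V3) * t"
  assumes K: "K = poly2 (w j) U3 V3"
    and tE: "E * t = t * E"
    and ss: "s * s * E = ev (dP w j) * s * E"
    and tt: "t * t * E = ev (eval3 const3 (dP w j) V3 W3 0) * t * E"
    and sts: "(t * s * t - s * t * s) * E = (ev (Pbar1 w j) * s + ev (Pbar2 w j) * t) * E"
    and h2K: "h2 * ev K * E = ev (poly2 (w j) U3 W3) * h2 * E"
    and h2VU: "h2 * ev (V3 - U3) * E = ev (W3 - U3) * h2 * E"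
  shows "s * h2 * h1 * E = h2 * h1 * t * E"
proof -
  let ?P13 = "poly2 (w j) U3 W3" and ?P23 = "poly2 (w j) V3 W3"
  have "U3 - V3 dvd poly2 (w j) V3 W3 - poly2 (w j) U3 W3"
    unfolding poly2_pe by (rule pe_diff_dvd)
  then obtain G1 where "poly2 (w j) V3 W3 - poly2 (w j) U3 W3 = (U3 - V3) * G1"
    by (rule dvdE)
  then have G1: "(U3 - V3) * G1 = poly2 (w j) V3 W3 - poly2 (w j) U3 W3" by simp
  define D where "D = (W3 - U3) * G1 - poly2 (w j) U3 W3"
  define E23 where "E23 = eval3 const3 (dP w j) V3 W3 0"
  define A B C DD :: "'k poly poly poly" where "A = ?P13 * ?P23" and "B = ?P13 * (W3 - V3)" and "C = (W3 - U3) * ?P23"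
    and "DD = (W3 - U3) * (W3 - V3)"
  note PD = G1 dP[of w j] dP_subst23[of w j] D_def
  note De = D_eq[where w = w and j = j, OF PD]
  have Eq1: "DD * Pbar1 w j = A - B * dP w j + K * D"
    unfolding DD_def A_def B_def K Pbar1_eq[where w = w and j = j, OF PD] by (simp add: algebra_simps)
  have Eq2: "DD * Pbar2 w j = B * E23 - A - K * D"
    unfolding DD_def A_def B_def K Pbar2_eq[where w = w and j = j, OF PD] E23_def by (simp add: algebra_simps)
  have Es: "E * s = s * E" by (rule E_comm)
  have "h2 * h1 * E = h2 * ev K * E - (h2 * ev (V3 - U3) * E) * s"
    unfolding h1_def by (simp add: right_diff_distrib left_diff_distrib mult.assoc Es)
  also have "\<dots> = (ev ?P13 * h2 - ev (W3 - U3) * h2 * s) * E"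
    unfolding h2K h2VU by (simp add: left_diff_distrib mult.assoc Es)
  also have "ev ?P13 * h2 - ev (W3 - U3) * h2 * s = ev A - ev B * t - ev C * s + ev DD * t * s"
    unfolding h2_def A_def B_def C_def DD_def
    by (simp only: eval3_simps(2)) (simp add: algebra_simps)
  finally have h21: "h2 * h1 * E = (ev A - ev B * t - ev C * s + ev DD * t * s) * E" .
  have P: "swaps ?P13 ?P23" "swaps ?P23 ?P13" by (intro swaps_intros)+
  have WU: "swaps (W3 - U3) (W3 - V3)" "swaps (W3 - V3) (W3 - U3)" by (intro swaps_intros)+
  \<comment> \<open>\<open>A\<close>, like \<open>DD\<close> below, is symmetric in
    \<open>U3\<close> and \<open>V3\<close>, so its quotient is \<open>0\<close> and no correction
    term arises.\<close>
  have sA: "s * ev A * E = ev A * s * E"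
    using swaps_intertwine[OF swaps_mult[OF P], of 0] by (simp add: A_def eval3_simps mult.commute)
  have BC: "swaps B C" "swaps C B"
    using swaps_mult[OF WU(2) P(1)] swaps_mult[OF WU(1) P(2)] by (simp_all add: B_def C_def mult.commute)
  \<comment> \<open>The exchange interchanges \<open>B\<close> and \<open>C\<close>, with quotients
    \<open>D\<close> and \<open>- D\<close>.\<close>
  have "(U3 - V3) * D = C - B" "(U3 - V3) * - D = B - C"
    unfolding B_def C_def mult_minus_right De by (simp_all add: algebra_simps)
  note sB = swaps_intertwine[OF BC(1) this(1)] and sC = swaps_intertwine[OF BC(2) this(2)]
  have sDD: "s * ev DD * E = ev DD * s * E"
    using swaps_intertwine[OF swaps_mult[OF WU], of 0] by (simp add: DD_def eval3_simps mult.commute)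
  have "s * h2 * h1 * E = s * (h2 * h1 * E)" by (simp add: mult.assoc)
  also have "\<dots> = (s * ev A * E) - (s * ev B * E) * t - (s * ev C * E) * s + (s * ev DD * E) * t * s"
    unfolding h21 by (simp add: right_diff_distrib left_diff_distrib distrib_left distrib_right mult.assoc Es tE)
  also have "\<dots> = ev A * s * E - (ev C * s + ev (K * D)) * t * E - (ev B * s - ev (K * D)) * s * E + ev DD * s * t * s * E"
    unfolding sA sB sC sDD by (simp add: eval3_simps mult.assoc Es tE)
  finally have L: "s * h2 * h1 * E = ev A * s * E - (ev C * s + ev (K * D)) * t * E - (ev B * s - ev (K * D)) * s * E + ev DD * s * t * s * E" .
  have "h2 * h1 * t * E = (h2 * h1 * E) * t" by (simp add: mult.assoc tE)
  then have R: "h2 * h1 * t * E = ev A * t * E - ev B * (t * t * E) - ev C * s * t * E + ev DD * t * s * t * E"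
    unfolding h21 by (simp add: right_diff_distrib left_diff_distrib distrib_left distrib_right mult.assoc tE)
  have "s * h2 * h1 * E - h2 * h1 * t * E
     = ev A * s * E + ev (K * D) * s * E - ev B * (s * s * E) - ev (K * D) * t * E - ev A * t * E + ev B * (t * t * E)
       - ev DD * ((t * s * t - s * t * s) * E)"
    unfolding L R by (simp add: algebra_simps)
  also have "\<dots> = ev (A - B * dP w j + K * D - DD * Pbar1 w j) * s * E + ev (B * E23 - A - K * D - DD * Pbar2 w j) * t * E"
    unfolding ss tt sts E23_def[symmetric] by (simp only: eval3_simps(1,2,6)) (simp add: algebra_simps)
  also have "\<dots> = 0" unfolding Eq1 Eq2 by (simp add: eval3_simps)
  finally show ?thesis by simp
qed

section \<open>Permuting label sequences\<close>

lemma length_sw [simp]: "length (sw l \<nu>) = length \<nu>"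
  by (simp add: sw_def)

lemma mset_sw:
  assumes "1 \<le> l" "l < length \<nu>"
  shows "mset (sw l \<nu>) = mset \<nu>"
  unfolding sw_def using assms by (intro mset_swap) auto

lemma ent_sw:
  assumes "1 \<le> l" "l < length \<nu>" "1 \<le> k" "k \<le> length \<nu>"
  shows "ent (sw l \<nu>) k = ent \<nu> (sidx l k)"
  using assms by (auto simp: ent_def sw_def sidx_def nth_list_update)

lemma sw_same:
  assumes "1 \<le> l" "l < length \<nu>" "ent \<nu> l = ent \<nu> (l + 1)"
  shows "sw l \<nu> = \<nu>"
  using assms by (intro nth_equalityI) (auto simp: ent_def sw_def nth_list_update)

lemma sw_in_Iseq: "1 \<le> l \<Longrightarrow> l < m \<Longrightarrow> \<nu> \<in> Iseq I m \<Longrightarrow> sw l \<nu> \<in> Iseq I m"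
  using mset_sw[of l \<nu>] by (auto simp: Iseq_def dest: mset_eq_setD)

lemma sw_in_Ibeta_iff:
  assumes "1 \<le> l" "l < length \<nu>"
  shows "sw l \<nu> \<in> Ibeta I B \<longleftrightarrow> \<nu> \<in> Ibeta I B"
  using mset_sw[OF assms] by (auto simp: Ibeta_def dest: mset_eq_setD simp flip: count_mset)

lemma sw_Cons: "1 \<le> l \<Longrightarrow> sw (Suc l) (j # \<nu>) = j # sw l \<nu>"
  by (cases l) (simp_all add: sw_def)

lemma length_Ibeta:
  assumes "finite I" "\<nu> \<in> Ibeta I B" shows "length \<nu> = sum B I"
proof -
  have "length \<nu> = (\<Sum>j\<in>I. count_list \<nu> j)"
    using assms sum_count_set[of \<nu> I] by (simp add: Ibeta_def)
  also have "\<dots> = sum B I" using assms by (intro sum.cong) (auto simp: Ibeta_def)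
  finally show ?thesis .
qed

lemma finite_Iseq: "finite I \<Longrightarrow> finite (Iseq I m)"
  using finite_lists_length_eq[of I m] by (simp add: Iseq_def conj_commute)

section \<open>Subalgebras and left submodules\<close>

text \<open>Negation is not among the closure rules of \<open>kalg\<close>; the scalar
  \<open>-1\<close> supplies it.\<close>

lemma kalg_uminus:
  assumes "ring_hom1 sc" "y \<in> kalg sc G" shows "- y \<in> kalg sc G"
proof -
  have "sc (- 1) * y \<in> kalg sc G" by (intro kalg.intros assms)
  then show ?thesis using assms(1) by (simp add: ring_hom1D)
qed

lemma kalg_diff:
  assumes "ring_hom1 sc" "y \<in> kalg sc G" "z \<in> kalg sc G" shows "y - z \<in> kalg sc G"
  using kalg_add[OF assms(2) kalg_uminus[OF assms(1,3)]] by simp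

lemma kalg_one: "ring_hom1 sc \<Longrightarrow> 1 \<in> kalg sc G"
  using kalg_scalar[of sc 1 G] by (simp add: ring_hom1D)

lemma kalg_zero: "ring_hom1 sc \<Longrightarrow> 0 \<in> kalg sc G"
  using kalg_scalar[of sc 0 G] by (simp add: ring_hom1D)

lemma kalg_power: "ring_hom1 sc \<Longrightarrow> y \<in> kalg sc G \<Longrightarrow> y ^ n \<in> kalg sc G"
  by (induction n) (auto intro: kalg_one kalg_mult)

lemma kalg_sum: "ring_hom1 sc \<Longrightarrow> (\<And>s. s \<in> S \<Longrightarrow> f s \<in> kalg sc G) \<Longrightarrow> sum f S \<in> kalg sc G"
  by (induction S rule: infinite_finite_induct) (auto intro: kalg_zero kalg_add)

lemma kalg_prod_list: "ring_hom1 sc \<Longrightarrow> (\<And>y. y \<in> set ys \<Longrightarrow> y \<in> kalg sc G) \<Longrightarrow> prod_list ys \<in> kalg sc G"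
  by (induction ys) (auto intro: kalg_one kalg_mult)

lemma kalg_pe: "ring_hom1 sc \<Longrightarrow> y \<in> kalg sc G \<Longrightarrow> z \<in> kalg sc G \<Longrightarrow> pe sc cf y z \<in> kalg sc G"
  unfolding pe_def by (intro kalg_sum kalg_mult kalg_power kalg_scalar)

lemma kalg_commute:
  assumes "y \<in> kalg sc G" "\<And>r. sc r * z = z * sc r" "\<And>g. g \<in> G \<Longrightarrow> g * z = z * g"
  shows "y * z = z * y"
  using assms(1)
proof induction
  case (kalg_add a b) then show ?case by (simp add: distrib_left distrib_right)
next
  case (kalg_mult a b) then show ?case by (metis mult.assoc)
qed (use assms in auto)

lemma lsub_zero: "0 \<in> lsub M a S f"
  unfolding lsub_def by (rule CollectI, rule exI[of _ 0]) auto

lemma lsub_add: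
  assumes "y \<in> lsub M a S f" "z \<in> lsub M a S f"
  shows "y + z \<in> lsub M a S f"
proof -
  obtain N1 r1 s1
    where y: "y = (\<Sum>j<(N1::nat). r1 j * a * s1 j * f)" "\<forall>j<N1. r1 j \<in> M \<and> s1 j \<in> S"
    using assms(1) unfolding lsub_def by blast
  obtain N2 r2 s2
    where z: "z = (\<Sum>j<(N2::nat). r2 j * a * s2 j * f)" "\<forall>j<N2. r2 j \<in> M \<and> s2 j \<in> S"
    using assms(2) unfolding lsub_def by blast
  \<comment> \<open>The two families are concatenated, the second one shifted by
    \<open>N1\<close>.\<close>
  define r s where "r = (\<lambda>j. if j < N1 then r1 j else r2 (j - N1))"
    and "s = (\<lambda>j. if j < N1 then s1 j else s2 (j - N1))"
  have "(\<Sum>j<N1 + N2. r j * a * s j * f) = (\<Sum>j<N1. r j * a * s j * f) + (\<Sum>j<N2. r (N1 + j) * a * s (N1 + j) * f)"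
    by (induction N2) (simp_all add: add.assoc)
  then have "y + z = (\<Sum>j<N1 + N2. r j * a * s j * f)"
    unfolding y z by (simp add: r_def s_def)
  moreover have "\<forall>j<N1 + N2. r j \<in> M \<and> s j \<in> S"
    using y z by (auto simp: r_def s_def)
  ultimately show ?thesis unfolding lsub_def by blast
qed

lemma lsub_single: "r \<in> M \<Longrightarrow> s \<in> S \<Longrightarrow> r * a * s * f \<in> lsub M a S f"
  unfolding lsub_def by (rule CollectI, rule exI[of _ 1], rule exI[of _ "\<lambda>_. r"], rule exI[of _ "\<lambda>_. s"]) simp

lemma lsub_right:
  assumes "y \<in> lsub M a S f"
    and "\<And>r s. r \<in> M \<Longrightarrow> s \<in> S \<Longrightarrow> r * a * s * f * z \<in> lsub M a S f"
  shows "y * z \<in> lsub M a S f"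
proof -
  obtain N :: nat and r s where y: "y = (\<Sum>j<N. r j * a * s j * f)" "\<forall>j<N. r j \<in> M \<and> s j \<in> S"
    using assms(1) unfolding lsub_def by blast
  have "(\<Sum>j<N. r j * a * s j * f) * z \<in> lsub M a S f"
    using y(2) by (induction N) (simp_all add: lsub_zero distrib_right lsub_add assms(2))
  then show ?thesis by (simp add: y)
qed

lemma aev_intertwine:
  assumes "\<And>r. sc r * z = z * sc r" "z * y = y' * z"
  shows "z * aev sc c hh L j y = aev sc c hh L j y' * z"
  unfolding aev_def sum_distrib_left sum_distrib_right
proof (rule sum.cong[OF refl])
  fix k
  let ?n = "nat (hh j L) - k"
  have "z * (sc (c j k) * y ^ ?n) = sc (c j k) * (z * y ^ ?n)" by (metis assms(1) mult.assoc)
  then show "z * (sc (c j k) * y ^ ?n) = sc (c j k) * y' ^ ?n * z"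
    by (simp add: power_intertwine[OF assms(2)] mult.assoc)
qed

section \<open>Intertwiners\<close>

locale quiver_hecke =
  fixes I :: "'i set" and t :: "'i \<Rightarrow> 'i \<Rightarrow> nat \<Rightarrow> nat \<Rightarrow> 'k::comm_ring_1"
    and w :: "'i \<Rightarrow> nat \<Rightarrow> nat \<Rightarrow> 'k" and sc :: "'k \<Rightarrow> 'a::ring_1" and m :: nat
    and e :: "'i list \<Rightarrow> 'a" and x :: "nat \<Rightarrow> 'a" and \<tau> :: "nat \<Rightarrow> 'a"
  assumes finite_I: "finite I"
    and t_sym: "\<And>j l p q. j \<in> I \<Longrightarrow> l \<in> I \<Longrightarrow> t j l p q = t l j q p"
    and rels: "qH_rels I t w sc m e x \<tau>"
begin

lemma sc_hom: "ring_hom1 sc"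
  using rels unfolding qH_rels_def ring_hom1_def by (elim conjE) blast

lemma sc_central: "sc r * y = y * sc r"
  using rels unfolding qH_rels_def by (elim conjE) blast

lemma e_e: "\<mu> \<in> Iseq I m \<Longrightarrow> \<nu> \<in> Iseq I m \<Longrightarrow> e \<mu> * e \<nu> = (if \<mu> = \<nu> then e \<mu> else 0)"
  using rels unfolding qH_rels_def by (elim conjE) blast

lemma sum_e: "(\<Sum>\<nu>\<in>Iseq I m. e \<nu>) = 1"
  using rels unfolding qH_rels_def by (elim conjE) blast

lemma x_x: "k \<in> {1..m} \<Longrightarrow> l \<in> {1..m} \<Longrightarrow> x k * x l = x l * x k"
  using rels unfolding qH_rels_def by (elim conjE) blast

lemma x_e: "k \<in> {1..m} \<Longrightarrow> \<nu> \<in> Iseq I m \<Longrightarrow> x k * e \<nu> = e \<nu> * x k"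
  using rels unfolding qH_rels_def by (elim conjE) blast

lemma tau_e: "l \<in> {1..<m} \<Longrightarrow> \<nu> \<in> Iseq I m \<Longrightarrow> \<tau> l * e \<nu> = e (sw l \<nu>) * \<tau> l"
  using rels unfolding qH_rels_def by (elim conjE) blast

lemma tau_tau_far: "k \<in> {1..<m} \<Longrightarrow> l \<in> {1..<m} \<Longrightarrow> k + 1 < l \<or> l + 1 < k \<Longrightarrow> \<tau> k * \<tau> l = \<tau> l * \<tau> k"
  using rels unfolding qH_rels_def by (elim conjE) blast

lemma eval_point_x: "k \<in> {1..m} \<Longrightarrow> l \<in> {1..m} \<Longrightarrow> n \<in> {1..m} \<Longrightarrow> eval_point sc (x k) (x l) (x n)"
  by unfold_locales (simp_all add: sc_hom sc_central x_x)

lemma eval_point_x0: "k \<in> {1..m} \<Longrightarrow> l \<in> {1..m} \<Longrightarrow> eval_point sc (x k) (x l) 0"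
  by unfold_locales (simp_all add: sc_hom sc_central x_x)

lemma Pev_pe: "k \<in> {1..m} \<Longrightarrow> l \<in> {1..m} \<Longrightarrow> Pev sc w j (x k) (x l) = pe sc (w j) (x k) (x l)"
  using eval_point.eval3_poly2[OF eval_point_x0, of k l]
  by (simp add: Pev_def eval_point.eval3_U3[OF eval_point_x0] eval_point.eval3_V3[OF eval_point_x0])

lemma Qev_pe: "k \<in> {1..m} \<Longrightarrow> l \<in> {1..m} \<Longrightarrow> Qev sc t i j (x k) (x l) = pe sc (t i j) (x k) (x l)"
  using eval_point.eval3_poly2[OF eval_point_x0, of k l]
  by (simp add: Qev_def eval_point.eval3_U3[OF eval_point_x0] eval_point.eval3_V3[OF eval_point_x0])

lemma Qev_flip:
  "i \<in> I \<Longrightarrow> j \<in> I \<Longrightarrow> k \<in> {1..m} \<Longrightarrow> l \<in> {1..m} \<Longrightarrow> Qev sc t i j (x k) (x l) = Qev sc t j i (x l) (x k)"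
  using pe_swap[of "x k" "x l" sc "t i j"] t_sym[of i j] by (simp add: Qev_pe x_x)

text \<open>The idempotents add up to \<open>1\<close>, so an identity can be checked on one label
  sequence at a time.\<close>

lemma eq_by_e:
  assumes "\<And>\<mu>. \<mu> \<in> Iseq I m \<Longrightarrow> X * e \<mu> = Y * e \<mu>"
  shows "X = Y"
proof -
  have "X * (\<Sum>\<mu>\<in>Iseq I m. e \<mu>) = Y * (\<Sum>\<mu>\<in>Iseq I m. e \<mu>)"
    unfolding sum_distrib_left by (rule sum.cong) (simp_all add: assms)
  then show ?thesis by (simp add: sum_e)
qed

lemma sum_times_e:
  assumes "S \<subseteq> Iseq I m" "\<mu> \<in> Iseq I m"
  shows "(\<Sum>\<nu>\<in>S. F \<nu> * e \<nu>) * e \<mu> = (if \<mu> \<in> S then F \<mu> * e \<mu> else 0)"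
proof -
  have "finite S" using assms(1) finite_Iseq[OF finite_I] by (rule finite_subset)
  have "(\<Sum>\<nu>\<in>S. F \<nu> * e \<nu>) * e \<mu> = (\<Sum>\<nu>\<in>S. if \<nu> = \<mu> then F \<mu> * e \<mu> else 0)"
    unfolding sum_distrib_right
    by (rule sum.cong) (use assms in \<open>auto simp: mult.assoc e_e subset_iff\<close>)
  then show ?thesis using \<open>finite S\<close> by simp
qed

lemma tau_square:
  "k \<in> {1..<m} \<Longrightarrow> \<nu> \<in> Iseq I m \<Longrightarrow> \<tau> k * \<tau> k * e \<nu> =
     (if ent \<nu> k = ent \<nu> (k + 1)
      then eval3 sc (dP w (ent \<nu> k)) (x k) (x (k + 1)) 0 * \<tau> k * e \<nu>
      else Qev sc t (ent \<nu> k) (ent \<nu> (k + 1)) (x k) (x (k + 1)) * e \<nu>)"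
  using rels unfolding qH_rels_def by (elim conjE) blast

lemmas tau_x_rel = rels[unfolded qH_rels_def, THEN conjunct2, THEN conjunct2, THEN conjunct2, THEN conjunct2, THEN conjunct2, THEN conjunct2, THEN conjunct2, THEN conjunct2, THEN conjunct2, THEN conjunct2, THEN conjunct2, THEN conjunct1, rule_format]

lemmas tau_braid_rel = rels[unfolded qH_rels_def, THEN conjunct2, THEN conjunct2, THEN conjunct2, THEN conjunct2, THEN conjunct2, THEN conjunct2, THEN conjunct2, THEN conjunct2, THEN conjunct2, THEN conjunct2, THEN conjunct2, THEN conjunct2, rule_format]

lemma tau_x_e:
  assumes "k \<in> {1..<m}" "l \<in> {1..m}" "\<nu> \<in> Iseq I m"
  shows "\<tau> k * x l * e \<nu> = (x (sidx k l) * \<tau> k +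
     (if ent \<nu> k = ent \<nu> (k + 1) then
        if l = k then - Pev sc w (ent \<nu> k) (x k) (x (k + 1))
        else if l = k + 1 then Pev sc w (ent \<nu> k) (x k) (x (k + 1)) else 0 else 0)) * e \<nu>"
proof -
  have "(\<tau> k * x l - x (sidx k l) * \<tau> k) * e \<nu> =
       (if l = k \<and> ent \<nu> k = ent \<nu> (k + 1) then - (Pev sc w (ent \<nu> k) (x k) (x (k + 1)) * e \<nu>)
        else if l = k + 1 \<and> ent \<nu> k = ent \<nu> (k + 1) then Pev sc w (ent \<nu> k) (x k) (x (k + 1)) * e \<nu>
        else 0)"
    using assms by (rule tau_x_rel)
  then show ?thesis by (auto simp: left_diff_distrib diff_eq_eq distrib_right add.commute split: if_splits)
qed

lemma tau_x_far:
  assumes "k \<in> {1..<m}" "l \<in> {1..m}" "l \<noteq> k" "l \<noteq> k + 1"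
  shows "\<tau> k * x l = x l * \<tau> k"
  by (rule eq_by_e) (use assms in \<open>simp add: tau_x_e sidx_def\<close>)

lemma tau_braid:
  assumes "1 \<le> k" "k + 2 \<le> m" "\<nu> \<in> Iseq I m"
  shows "(\<tau> (k + 1) * \<tau> k * \<tau> (k + 1) - \<tau> k * \<tau> (k + 1) * \<tau> k) * e \<nu> =
       (if ent \<nu> k = ent \<nu> (k + 2) \<and> ent \<nu> k \<noteq> ent \<nu> (k + 1)
        then eval3 sc (poly2 (w (ent \<nu> k)) U3 W3 * Qbar t (ent \<nu> k) (ent \<nu> (k + 1))) (x k) (x (k + 1)) (x (k + 2)) * e \<nu>
        else if ent \<nu> k = ent \<nu> (k + 1) \<and> ent \<nu> (k + 1) = ent \<nu> (k + 2)
        then eval3 sc (Pbar1 w (ent \<nu> k)) (x k) (x (k + 1)) (x (k + 2)) * \<tau> k * e \<nu>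
           + eval3 sc (Pbar2 w (ent \<nu> k)) (x k) (x (k + 1)) (x (k + 2)) * \<tau> (k + 1) * e \<nu>
        else 0)"
  using assms by (intro tau_braid_rel conjI)

definition hx :: "nat \<Rightarrow> 'i list \<Rightarrow> 'a" where
  "hx a \<mu> = (if ent \<mu> a \<noteq> ent \<mu> (a + 1) then \<tau> a
     else Pev sc w (ent \<mu> a) (x a) (x (a + 1)) - (x (a + 1) - x a) * \<tau> a)"

text \<open>The sum runs over all label sequences rather than over one block, so that the relations
  for \<open>h\<close> need no block idempotent.\<close>

definition h :: "nat \<Rightarrow> 'a" where
  "h a = (\<Sum>\<mu>\<in>Iseq I m. hx a \<mu> * e \<mu>)"

lemma h_e: "\<mu> \<in> Iseq I m \<Longrightarrow> h a * e \<mu> = hx a \<mu> * e \<mu>"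
  unfolding h_def by (subst sum_times_e) auto

lemma Pev_commute:
  assumes "k \<in> {1..m}" "l \<in> {1..m}" "y * x k = x k * y" "y * x l = x l * y"
  shows "y * Pev sc w j (x k) (x l) = Pev sc w j (x k) (x l) * y"
  unfolding Pev_pe[OF assms(1,2)] by (rule pe_intertwine) (simp_all add: sc_central assms)

lemma hx_e:
  assumes a: "a \<in> {1..<m}" and \<mu>: "\<mu> \<in> Iseq I m"
  shows "hx a \<mu> * e \<mu> = e (sw a \<mu>) * hx a \<mu>"
proof (cases "ent \<mu> a = ent \<mu> (a + 1)")
  case True
  have "sw a \<mu> = \<mu>" using True a \<mu> by (intro sw_same) (auto simp: Iseq_def)
  then have t: "\<tau> a * e \<mu> = e \<mu> * \<tau> a" using tau_e[OF a \<mu>] by simp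
  have "x a * e \<mu> = e \<mu> * x a" "x (a + 1) * e \<mu> = e \<mu> * x (a + 1)" using a \<mu> by (auto intro!: x_e)
  moreover have "Pev sc w j (x a) (x (a + 1)) * e \<mu> = e \<mu> * Pev sc w j (x a) (x (a + 1))" for j
    by (rule Pev_commute[symmetric]) (use a calculation in auto)
  ultimately show ?thesis unfolding \<open>sw a \<mu> = \<mu>\<close> hx_def using True t
    by (simp add: left_diff_distrib right_diff_distrib mult.assoc) (simp add: t flip: mult.assoc)
qed (simp add: hx_def tau_e[OF a \<mu>])

text \<open>The idempotent reached is made visible while \<open>h a * e \<mu>\<close> is kept, so
  that the next factor can be replaced by its local form at \<open>sw a \<mu>\<close>.\<close>

lemma h_e_left:
  assumes "a \<in> {1..<m}" "\<mu> \<in> Iseq I m"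
  shows "h a * e \<mu> = e (sw a \<mu>) * (h a * e \<mu>)"
proof -
  have "h a * e \<mu> = hx a \<mu> * e \<mu> * e \<mu>"
    using assms(2) by (simp add: mult.assoc e_e h_e)
  also have "\<dots> = e (sw a \<mu>) * hx a \<mu> * e \<mu>" by (simp only: hx_e[OF assms])
  finally show ?thesis using assms(2) by (simp add: mult.assoc h_e)
qed

lemma tau_e_left:
  assumes "a \<in> {1..<m}" "\<mu> \<in> Iseq I m"
  shows "\<tau> a * e \<mu> = e (sw a \<mu>) * (\<tau> a * e \<mu>)"
proof -
  have "\<tau> a * e \<mu> = \<tau> a * e \<mu> * e \<mu>" using assms(2) by (simp add: mult.assoc e_e)
  also have "\<dots> = e (sw a \<mu>) * \<tau> a * e \<mu>" by (simp only: tau_e[OF assms])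
  finally show ?thesis by (simp add: mult.assoc)
qed

text \<open>For equal labels, moving \<open>x\<^sub>a\<close> past \<open>\<tau>\<^sub>a\<close>
  leaves an extra value \<open>p\<close> of \<open>P\<close>; multiplied by
  \<open>x\<^sub>a\<^sub>+\<^sub>1 - x\<^sub>a\<close> it turns \<open>p x\<^sub>a\<close> into
  \<open>p x\<^sub>a\<^sub>+\<^sub>1\<close>. The case of \<open>x\<^sub>a\<^sub>+\<^sub>1\<close>
  is the same with opposite sign.\<close>

lemma h_x:
  assumes a: "a \<in> {1..<m}" and b: "b \<in> {1..m}"
  shows "h a * x b = x (sidx a b) * h a"
proof (rule eq_by_e)
  fix \<mu> assume \<mu>: "\<mu> \<in> Iseq I m"
  have s: "sidx a b \<in> {1..m}" using a b by (auto simp: sidx_def)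
  have L: "h a * x b * e \<mu> = hx a \<mu> * x b * e \<mu>"
    by (simp add: mult.assoc x_e[OF b \<mu>]) (simp add: h_e \<mu> flip: mult.assoc)
  have R: "x (sidx a b) * h a * e \<mu> = x (sidx a b) * hx a \<mu> * e \<mu>"
    by (simp add: mult.assoc h_e \<mu>)
  show "h a * x b * e \<mu> = x (sidx a b) * h a * e \<mu>"
  proof (cases "ent \<mu> a = ent \<mu> (a + 1)")
    case False
    then show ?thesis unfolding L R by (simp add: hx_def tau_x_e[OF a b \<mu>])
  next
    case True
    define p where "p = Pev sc w (ent \<mu> a) (x a) (x (a + 1))"
    have pc: "x l * p = p * x l" if "l \<in> {1..m}" for l
      unfolding p_def by (rule Pev_commute) (use a that in \<open>auto intro!: x_x\<close>)
    have pc2: "x l * (p * y) = p * (x l * y)" if "l \<in> {1..m}" for l y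
      by (simp add: pc[OF that] flip: mult.assoc)
    have A: "a \<in> {1..m}" "a + 1 \<in> {1..m}" using a by auto
    have tx: "\<tau> a * x b * e \<mu> = (x (sidx a b) * \<tau> a + (if b = a then - p else if b = a + 1 then p else 0)) * e \<mu>"
      using tau_x_e[OF a b \<mu>] True by (simp add: p_def)
    have hx: "hx a \<mu> = p - (x (a + 1) - x a) * \<tau> a"
      using True by (simp add: hx_def p_def)
    have "hx a \<mu> * x b * e \<mu> = x b * p * e \<mu> - (x (a + 1) - x a) * (\<tau> a * x b * e \<mu>)"
      by (simp add: hx left_diff_distrib mult.assoc[symmetric] pc[OF b])
    also have "\<dots> = x (sidx a b) * hx a \<mu> * e \<mu>"
    proof -
      have c: "x (a + 1) * (x (sidx a b) * y) = x (sidx a b) * (x (a + 1) * y)"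
        "x a * (x (sidx a b) * y) = x (sidx a b) * (x a * y)" for y
        using x_x[OF A(1) s] x_x[OF A(2) s] by (simp_all flip: mult.assoc)
      consider "b = a" | "b = a + 1" | "b \<noteq> a" "b \<noteq> a + 1" by blast
      then show ?thesis
      proof cases
        case 1
        with c True show ?thesis unfolding tx
          by (simp add: hx sidx_def algebra_simps pc2[OF A(1)] pc2[OF A(2)])
      next
        case 2
        with c True show ?thesis unfolding tx
          by (simp add: hx sidx_def algebra_simps pc2[OF A(1)] pc2[OF A(2)])
      next
        case 3
        with c True show ?thesis unfolding tx
          by (simp add: hx sidx_def algebra_simps pc2[OF b])
      qed
    qed
    finally show ?thesis unfolding L R .
  qed
qed

lemma ent_sw':
  assumes "l \<in> {1..<m}" "\<mu> \<in> Iseq I m" "k \<in> {1..m}"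
  shows "ent (sw l \<mu>) k = ent \<mu> (sidx l k)"
  using assms by (intro ent_sw) (auto simp: Iseq_def)

lemma sw_Iseq: "l \<in> {1..<m} \<Longrightarrow> \<mu> \<in> Iseq I m \<Longrightarrow> sw l \<mu> \<in> Iseq I m"
  by (auto intro: sw_in_Iseq)

text \<open>A crossing at \<open>a\<close> does not change the labels at \<open>b\<close> and
  \<open>b + 1\<close>, so the same local form of \<open>h b\<close> applies on both sides.\<close>

lemma tau_h_far:
  assumes a: "a \<in> {1..<m}" and b: "b \<in> {1..<m}" and far: "a + 1 < b \<or> b + 1 < a"
  shows "\<tau> a * h b = h b * \<tau> a"
proof (rule eq_by_e)
  fix \<mu> assume \<mu>: "\<mu> \<in> Iseq I m"
  have tt: "\<tau> a * \<tau> b = \<tau> b * \<tau> a" using assms by (intro tau_tau_far)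
  have tx: "\<tau> a * x b = x b * \<tau> a" "\<tau> a * x (b + 1) = x (b + 1) * \<tau> a"
    by (rule tau_x_far; use assms in auto)+
  have "\<tau> a * Pev sc w j (x b) (x (b + 1)) = Pev sc w j (x b) (x (b + 1)) * \<tau> a" for j
    by (rule Pev_commute) (use b tx in auto)
  moreover have "\<tau> a * ((x (b + 1) - x b) * \<tau> b) = (x (b + 1) - x b) * \<tau> b * \<tau> a"
  proof -
    have "\<tau> a * (x (b + 1) - x b) = (x (b + 1) - x b) * \<tau> a"
      by (simp only: right_diff_distrib left_diff_distrib tx)
    then show ?thesis by (metis mult.assoc tt)
  qed
  ultimately have "\<tau> a * hx b \<mu> = hx b \<mu> * \<tau> a"
    unfolding hx_def using tt by (simp add: right_diff_distrib left_diff_distrib)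
  moreover have "sidx a b = b" "sidx a (b + 1) = b + 1" using far by (auto simp: sidx_def)
  then have "hx b (sw a \<mu>) = hx b \<mu>"
    using a b by (simp add: hx_def ent_sw' \<mu>)
  moreover have "h b * \<tau> a * e \<mu> = hx b (sw a \<mu>) * \<tau> a * e \<mu>"
    by (simp add: mult.assoc tau_e[OF a \<mu>]) (simp add: h_e sw_Iseq[OF a \<mu>] flip: mult.assoc)
  moreover have "\<tau> a * h b * e \<mu> = \<tau> a * hx b \<mu> * e \<mu>"
    by (simp add: mult.assoc h_e \<mu>)
  ultimately show "\<tau> a * h b * e \<mu> = h b * \<tau> a * e \<mu>" by simp
qed

lemma h_Pev:
  assumes "a \<in> {1..<m}" "k \<in> {1..m}" "l \<in> {1..m}"
  shows "h a * Pev sc w j (x k) (x l) = Pev sc w j (x (sidx a k)) (x (sidx a l)) * h a"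
proof -
  have "sidx a k \<in> {1..m}" "sidx a l \<in> {1..m}" using assms by (auto simp: sidx_def)
  then show ?thesis
    using assms by (simp only: Pev_pe) (intro pe_intertwine sc_central h_x)
qed

text \<open>The third coordinate is \<open>0\<close> for identities in two variables, as in the
  square relation, and another strand's variable for the braid relation.\<close>

lemma crossing_same:
  assumes a: "a \<in> {1..<m}" and \<mu>: "\<mu> \<in> Iseq I m" and eq: "ent \<mu> a = ent \<mu> (a + 1)"
    and c: "c = 0 \<or> (\<exists>l\<in>{1..m}. c = x l \<and> l \<noteq> a \<and> l \<noteq> a + 1)"
  shows "crossing sc (x a) (x (a + 1)) c (\<tau> a) (e \<mu>) (poly2 (w (ent \<mu> a)) U3 V3)"
proof -
  have A: "a \<in> {1..m}" "a + 1 \<in> {1..m}" using a by auto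
  interpret eval_point sc "x a" "x (a + 1)" c
    using c eval_point_x0[OF A] eval_point_x[OF A] by auto
  have sw: "sw a \<mu> = \<mu>" using eq a \<mu> by (intro sw_same) (auto simp: Iseq_def)
  have K: "eval3 sc (poly2 (w (ent \<mu> a)) U3 V3) (x a) (x (a + 1)) c = Pev sc w (ent \<mu> a) (x a) (x (a + 1))"
    by (simp only: eval3_poly2 eval3_U3 eval3_V3 Pev_pe[OF A])
  show ?thesis
  proof unfold_locales
    show "e \<mu> * x a = x a * e \<mu>" "e \<mu> * x (a + 1) = x (a + 1) * e \<mu>"
      by (simp_all only: x_e[OF A(1) \<mu>] x_e[OF A(2) \<mu>])
    show "e \<mu> * c = c * e \<mu>" using c x_e[OF _ \<mu>] by auto
    show "e \<mu> * \<tau> a = \<tau> a * e \<mu>" using tau_e[OF a \<mu>] sw by simp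
    show "\<tau> a * x a * e \<mu> = (x (a + 1) * \<tau> a - eval3 sc (poly2 (w (ent \<mu> a)) U3 V3) (x a) (x (a + 1)) c) * e \<mu>"
      unfolding K using tau_x_e[OF a A(1) \<mu>] eq by (simp add: sidx_def)
    show "\<tau> a * x (a + 1) * e \<mu> = (x a * \<tau> a + eval3 sc (poly2 (w (ent \<mu> a)) U3 V3) (x a) (x (a + 1)) c) * e \<mu>"
      unfolding K using tau_x_e[OF a A(2) \<mu>] eq by (simp add: sidx_def)
    have "\<tau> a * c = c * \<tau> a" using c tau_x_far[OF a] by auto
    then show "\<tau> a * c * e \<mu> = c * \<tau> a * e \<mu>" by simp
  qed
qed

lemma tau_g_same:
  assumes a: "a \<in> {1..<m}" and \<mu>: "\<mu> \<in> Iseq I m" and eq: "ent \<mu> a = ent \<mu> (a + 1)"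
  defines "p \<equiv> Pev sc w (ent \<mu> a) (x a) (x (a + 1))" and "p' \<equiv> Pev sc w (ent \<mu> a) (x (a + 1)) (x a)"
  shows "\<tau> a * ((x (a + 1) - x a) * p - (x (a + 1) - x a) ^ 2 * \<tau> a) * e \<mu> = (p * p' + p * h a) * e \<mu>"
proof -
  have A: "a \<in> {1..m}" "a + 1 \<in> {1..m}" using a by auto
  interpret crossing sc "x a" "x (a + 1)" 0 "\<tau> a" "e \<mu>" "poly2 (w (ent \<mu> a)) U3 V3"
    by (rule crossing_same) (use assms in auto)
  have p: "ev (poly2 (w (ent \<mu> a)) U3 V3) = p" "ev (poly2 (w (ent \<mu> a)) V3 U3) = p'"
    unfolding p_def p'_def by (simp_all only: eval3_poly2 eval3_U3 eval3_V3 Pev_pe[OF A] Pev_pe[OF A(2,1)])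
  have h: "h a * e \<mu> = (p - (x (a + 1) - x a) * \<tau> a) * e \<mu>"
    using eq by (simp add: h_e[OF \<mu>] hx_def p_def)
  have "\<tau> a * \<tau> a * e \<mu> = ev (dP w (ent \<mu> a)) * \<tau> a * e \<mu>"
    using tau_square[OF a \<mu>] eq by simp
  from crossing_square[OF refl this] show ?thesis
    unfolding eval3_simps(2,6,7) p eval3_U3 eval3_V3 distrib_right[of "p * p'" "p * h a"]
    by (simp add: mult.assoc h distrib_right distrib_left)
qed

text \<open>\<open>z\<close> is known to intertwine only in front of \<open>e \<mu>\<close>; the
  product \<open>z * e \<mu>\<close> intertwines without restriction, and the idempotent is moved
  back afterwards.\<close>

lemma intertwine_e:
  assumes "\<mu> \<in> Iseq I m" "k \<in> {1..m}" "l \<in> {1..m}"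
    and "z * x k * e \<mu> = a' * z * e \<mu>" "z * x l * e \<mu> = b' * z * e \<mu>"
  shows "z * pe sc cf (x k) (x l) * e \<mu> = pe sc cf a' b' * z * e \<mu>"
proof -
  have "e \<mu> * pe sc cf (x k) (x l) = pe sc cf (x k) (x l) * e \<mu>"
    using assms(1-3) by (intro pe_intertwine) (simp_all add: sc_central x_e)
  moreover have "(z * e \<mu>) * pe sc cf (x k) (x l) = pe sc cf a' b' * (z * e \<mu>)"
    using assms by (intro pe_intertwine) (simp_all add: sc_central mult.assoc flip: x_e)
  ultimately show ?thesis by (simp add: mult.assoc)
qed

lemma tau_diff_intertwine:
  assumes "a \<in> {1..<m}" "\<mu> \<in> Iseq I m" "ent \<mu> a \<noteq> ent \<mu> (a + 1)" "k \<in> {1..m}"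
  shows "\<tau> a * x k * e \<mu> = x (sidx a k) * \<tau> a * e \<mu>"
  using assms tau_x_e[of a k \<mu>] by simp

section \<open>Moving a crossing through two adjacent intertwiners, by label pattern\<close>

context
  fixes a :: nat and \<mu> :: "'i list"
  assumes a: "1 \<le> a" "a + 2 \<le> m" and \<mu>: "\<mu> \<in> Iseq I m"
begin

abbreviation (input) "\<sigma> \<equiv> \<tau> a"
abbreviation (input) "\<rho> \<equiv> \<tau> (a + 1)"
abbreviation (input) "X \<equiv> x a"
abbreviation (input) "Y \<equiv> x (a + 1)"
abbreviation (input) "Z \<equiv> x (a + 2)"

lemma index: "a \<in> {1..<m}" "a + 1 \<in> {1..<m}" "a \<in> {1..m}" "a + 1 \<in> {1..m}" "a + 2 \<in> {1..m}"
  using a by auto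

lemmas sw_index = sw_Iseq[OF index(1) \<mu>] sw_Iseq[OF index(2) \<mu>]

lemma ent_sw_index:
  "ent (sw a \<mu>) a = ent \<mu> (a + 1)" "ent (sw a \<mu>) (a + 1) = ent \<mu> a" "ent (sw a \<mu>) (a + 2) = ent \<mu> (a + 2)"
  "ent (sw (a + 1) \<mu>) a = ent \<mu> a" "ent (sw (a + 1) \<mu>) (a + 1) = ent \<mu> (a + 2)"
  "ent (sw (a + 1) \<mu>) (a + 2) = ent \<mu> (a + 1)"
  using index \<mu> ent_sw'[of a \<mu>] ent_sw'[of "a + 1" \<mu>] by (simp_all add: sidx_def)

text \<open>Inserting idempotents shows which labels each factor meets: \<open>h a\<close> meets
  \<open>\<mu>\<close>, and \<open>h (a + 1)\<close> meets \<open>sw a \<mu>\<close>.\<close>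

lemma hx_expand_left: "\<sigma> * h (a + 1) * h a * e \<mu> = \<sigma> * hx (a + 1) (sw a \<mu>) * hx a \<mu> * e \<mu>"
proof -
  have "\<sigma> * h (a + 1) * h a * e \<mu> = \<sigma> * (h (a + 1) * e (sw a \<mu>)) * (h a * e \<mu>)"
    using h_e_left[OF index(1) \<mu>] by (simp add: mult.assoc)
  also have "\<dots> = \<sigma> * hx (a + 1) (sw a \<mu>) * (e (sw a \<mu>) * (h a * e \<mu>))"
    by (simp only: h_e sw_index mult.assoc)
  finally show ?thesis using h_e_left[OF index(1) \<mu>] by (simp add: h_e \<mu> mult.assoc)
qed

lemma hx_expand_right:
  "h (a + 1) * h a * \<rho> * e \<mu> = hx (a + 1) (sw a (sw (a + 1) \<mu>)) * hx a (sw (a + 1) \<mu>) * \<rho> * e \<mu>"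
proof -
  let ?\<nu> = "sw (a + 1) \<mu>"
  have "h (a + 1) * h a * \<rho> * e \<mu> = h (a + 1) * (h a * e ?\<nu>) * (\<rho> * e \<mu>)"
    using tau_e_left[OF index(2) \<mu>] by (simp add: mult.assoc)
  also have "\<dots> = (h (a + 1) * e (sw a ?\<nu>)) * (h a * e ?\<nu>) * (\<rho> * e \<mu>)"
    using h_e_left[OF index(1) sw_index(2)] by (simp add: mult.assoc)
  also have "\<dots> = hx (a + 1) (sw a ?\<nu>) * (e (sw a ?\<nu>) * (h a * e ?\<nu>)) * (\<rho> * e \<mu>)"
    by (simp only: h_e sw_Iseq[OF index(1) sw_index(2)] mult.assoc)
  also have "\<dots> = hx (a + 1) (sw a ?\<nu>) * hx a ?\<nu> * (e ?\<nu> * (\<rho> * e \<mu>))"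
    by (simp only: h_e_left[OF index(1) sw_index(2), symmetric]) (simp only: h_e sw_index mult.assoc)
  finally show ?thesis using tau_e_left[OF index(2) \<mu>] by (simp add: mult.assoc)
qed

lemma ent_sw_sw: "ent (sw a (sw (a + 1) \<mu>)) (a + 1) = ent \<mu> a" "ent (sw a (sw (a + 1) \<mu>)) (a + 2) = ent \<mu> (a + 1)"
proof -
  have "sidx a (a + 1) = a" "sidx a (a + 2) = a + 2" by (simp_all add: sidx_def)
  then show "ent (sw a (sw (a + 1) \<mu>)) (a + 1) = ent \<mu> a"
    "ent (sw a (sw (a + 1) \<mu>)) (a + 2) = ent \<mu> (a + 1)"
    by (simp_all only: ent_sw'[OF index(1) sw_index(2)] index ent_sw_index)
qed

text \<open>Both crossings fix \<open>\<mu>\<close>, so everything takes place at one idempotent and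
  \<open>crossing_braid\<close> applies at \<open>X, Y, Z\<close>.\<close>

lemma braid_all_same:
  assumes eq: "ent \<mu> a = ent \<mu> (a + 1)" "ent \<mu> a = ent \<mu> (a + 2)"
  shows "\<sigma> * h (a + 1) * h a * e \<mu> = h (a + 1) * h a * \<rho> * e \<mu>"
proof -
  define j where "j = ent \<mu> a"
  have j: "ent \<mu> a = j" "ent \<mu> (a + 1) = j" "ent \<mu> (a + 2) = j" using eq by (auto simp: j_def)
  interpret crossing sc X Y Z \<sigma> "e \<mu>" "poly2 (w j) U3 V3"
    by (rule crossing_same[OF index(1) \<mu> eq(1), unfolded j]) (use index in auto)
  interpret YZ: crossing sc Y "x (a + 1 + 1)" 0 \<rho> "e \<mu>" "poly2 (w j) U3 V3"
    by (rule crossing_same[OF index(2) \<mu> _, unfolded j]) (use j in simp_all)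
  have sw: "sw a \<mu> = \<mu>" "sw (a + 1) \<mu> = \<mu>"
    using j a \<mu> by (auto intro!: sw_same simp: Iseq_def numeral_2_eq_2)
  have p: "ev (poly2 (w j) U3 V3) = Pev sc w j X Y" "ev (poly2 (w j) V3 W3) = Pev sc w j Y Z"
    "ev (poly2 (w j) U3 W3) = Pev sc w j X Z"
    using index by (simp_all only: eval3_poly2 eval3_U3 eval3_V3 eval3_W3 Pev_pe)
  define h1 h2 where "h1 = ev (poly2 (w j) U3 V3) - ev (V3 - U3) * \<sigma>"
    and "h2 = ev (poly2 (w j) V3 W3) - ev (W3 - V3) * \<rho>"
  have "hx a \<mu> = Pev sc w j X Y - (Y - X) * \<sigma>" "hx (a + 1) \<mu> = Pev sc w j Y Z - (Z - Y) * \<rho>"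
    using j by (simp_all add: hx_def numeral_2_eq_2)
  then have h: "h1 = hx a \<mu>" "h2 = hx (a + 1) \<mu>"
    by (simp_all only: h1_def h2_def p eval3_simps(6) eval3_U3 eval3_V3 eval3_W3)
  have "\<sigma> * h2 * h1 * e \<mu> = h2 * h1 * \<rho> * e \<mu>"
    unfolding h1_def h2_def
  proof (rule crossing_braid[where w = w and j = j])
    show "poly2 (w j) U3 V3 = poly2 (w j) U3 V3" ..
    show "e \<mu> * \<rho> = \<rho> * e \<mu>" by (rule YZ.E_comm)
    show "\<sigma> * \<sigma> * e \<mu> = ev (dP w j) * \<sigma> * e \<mu>"
    proof -
      \<comment> \<open>The square relation evaluates \<open>dP\<close> with third coordinate
        \<open>0\<close>, while \<open>ev\<close> uses \<open>Z\<close>; the difference is invisible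
        since \<open>dP\<close> does not involve \<open>W3\<close>.\<close>
      have "ev (dP w j) = eval3 sc (dP w j) X Y 0"
        using eval3_comp[of "dP w j" U3 V3 0]
        by (simp only: dP_subst12 eval3_simps(4) eval3_U3 eval3_V3)
      then show ?thesis using tau_square[OF index(1) \<mu>] j by simp
    qed
    show "\<rho> * \<rho> * e \<mu> = ev (eval3 const3 (dP w j) V3 W3 0) * \<rho> * e \<mu>"
    proof -
      have "ev (eval3 const3 (dP w j) V3 W3 0) = eval3 sc (dP w j) Y Z 0"
        by (simp only: eval3_comp eval3_simps(4) eval3_V3 eval3_W3)
      then show ?thesis using tau_square[OF index(2) \<mu>] j by (simp add: numeral_2_eq_2)
    qed
    show "(\<rho> * \<sigma> * \<rho> - \<sigma> * \<rho> * \<sigma>) * e \<mu> = (ev (Pbar1 w j) * \<sigma> + ev (Pbar2 w j) * \<rho>) * e \<mu>"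
      using tau_braid[OF a \<mu>] j by (simp add: distrib_right)
    have "hx (a + 1) \<mu> * x k * e \<mu> = x (sidx (a + 1) k) * hx (a + 1) \<mu> * e \<mu>" if "k \<in> {1..m}" for k
    proof -
      have "hx (a + 1) \<mu> * x k * e \<mu> = h (a + 1) * x k * e \<mu>"
        using that by (simp only: mult.assoc x_e \<mu>) (simp only: h_e[OF \<mu>] flip: mult.assoc)
      then show ?thesis by (simp only: h_x[OF index(2) that]) (simp only: mult.assoc h_e \<mu>)
    qed
    then have h2x: "hx (a + 1) \<mu> * X * e \<mu> = X * hx (a + 1) \<mu> * e \<mu>"
       "hx (a + 1) \<mu> * Y * e \<mu> = Z * hx (a + 1) \<mu> * e \<mu>"
      using index by (simp_all add: sidx_def)
    show "(ev (poly2 (w j) V3 W3) - ev (W3 - V3) * \<rho>) * ev (poly2 (w j) U3 V3) * e \<mu>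
        = ev (poly2 (w j) U3 W3) * (ev (poly2 (w j) V3 W3) - ev (W3 - V3) * \<rho>) * e \<mu>"
      using intertwine_e[OF \<mu> index(3,4) h2x] unfolding h2_def[symmetric] unfolding h(2) p(1,3)
      by (simp only: Pev_pe index)
    show "(ev (poly2 (w j) V3 W3) - ev (W3 - V3) * \<rho>) * ev (V3 - U3) * e \<mu>
        = ev (W3 - U3) * (ev (poly2 (w j) V3 W3) - ev (W3 - V3) * \<rho>) * e \<mu>"
      using h2x unfolding h2_def[symmetric] h(2)
      by (simp only: eval3_simps(6) eval3_U3 eval3_V3 eval3_W3 right_diff_distrib left_diff_distrib)
  qed
  then show ?thesis unfolding hx_expand_left hx_expand_right sw h .
qed

text \<open>Labels \<open>j, j, l\<close> with \<open>l \<noteq> j\<close>: the word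
  \<open>\<sigma> * \<rho>\<close> consists of crossings of different labels and carries
  \<open>X, Y\<close> to \<open>Y, Z\<close>, hence transports both parts of \<open>h a\<close>. The
  braid relation has no correction term for this pattern.\<close>

lemma braid_first_same:
  assumes eq: "ent \<mu> a = ent \<mu> (a + 1)" and ne: "ent \<mu> a \<noteq> ent \<mu> (a + 2)"
  shows "\<sigma> * h (a + 1) * h a * e \<mu> = h (a + 1) * h a * \<rho> * e \<mu>"
proof -
  define j where "j = ent \<mu> a"
  let ?\<nu> = "sw (a + 1) \<mu>"
  have sw: "sw a \<mu> = \<mu>" using eq a \<mu> by (auto intro!: sw_same simp: Iseq_def)
  have hx: "hx a \<mu> = Pev sc w j X Y - (Y - X) * \<sigma>" "hx (a + 1) \<mu> = \<rho>" 
    "hx a ?\<nu> = \<sigma>" "hx (a + 1) (sw a ?\<nu>) = Pev sc w j Y Z - (Z - Y) * \<rho>"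
    using eq ne ent_sw_index ent_sw_sw by (simp_all add: hx_def j_def numeral_2_eq_2)
  have \<rho>x: "\<rho> * x k * e \<mu> = x (sidx (a + 1) k) * \<rho> * e \<mu>" if "k \<in> {1..m}" for k
    by (rule tau_diff_intertwine) (use that index \<mu> eq ne in \<open>auto simp: numeral_2_eq_2\<close>)
  have \<sigma>x: "\<sigma> * x k * e ?\<nu> = x (sidx a k) * \<sigma> * e ?\<nu>" if "k \<in> {1..m}" for k
    by (rule tau_diff_intertwine) (use that index \<mu> sw_index eq ne ent_sw_index in auto)
  have st: "(\<sigma> * \<rho>) * x k * e \<mu> = x (sidx a (sidx (a + 1) k)) * (\<sigma> * \<rho>) * e \<mu>" if "k \<in> {1..m}" for k
  proof -
    have k: "sidx (a + 1) k \<in> {1..m}" using that a by (auto simp: sidx_def)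
    have "(\<sigma> * \<rho>) * x k * e \<mu> = \<sigma> * x (sidx (a + 1) k) * e ?\<nu> * (\<rho> * e \<mu>)"
      using \<rho>x[OF that] tau_e_left[OF index(2) \<mu>] by (simp add: mult.assoc)
    then show ?thesis unfolding \<sigma>x[OF k] using tau_e_left[OF index(2) \<mu>] by (simp add: mult.assoc)
  qed
  have st': "\<sigma> * \<rho> * X * e \<mu> = Y * (\<sigma> * \<rho>) * e \<mu>" "\<sigma> * \<rho> * Y * e \<mu> = Z * (\<sigma> * \<rho>) * e \<mu>"
    using st[OF index(3)] st[OF index(4)] by (simp_all add: sidx_def)
  have P: "\<sigma> * \<rho> * Pev sc w j X Y * e \<mu> = Pev sc w j Y Z * (\<sigma> * \<rho>) * e \<mu>"
    using intertwine_e[OF \<mu> index(3,4) st'] by (simp only: Pev_pe index)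
  have \<sigma>e: "e \<mu> * \<sigma> = \<sigma> * e \<mu>" using tau_e[OF index(1) \<mu>] sw by simp
  have "\<sigma> * \<rho> * (Y - X) * \<sigma> * e \<mu> = (\<sigma> * \<rho> * (Y - X) * e \<mu>) * \<sigma>"
    by (simp add: mult.assoc \<sigma>e)
  also have "\<dots> = (Z - Y) * (\<sigma> * \<rho> * \<sigma>) * e \<mu>"
    using st' by (simp add: right_diff_distrib left_diff_distrib mult.assoc) (simp add: \<sigma>e mult.assoc flip: mult.assoc)
  also have "\<dots> = (Z - Y) * (\<rho> * \<sigma> * \<rho>) * e \<mu>"
    using tau_braid[OF a \<mu>] eq ne by (simp add: left_diff_distrib mult.assoc)
  finally show ?thesis
    unfolding hx_expand_left hx_expand_right sw hx using P
    by (simp add: right_diff_distrib left_diff_distrib mult.assoc)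
qed

text \<open>Labels \<open>i, j, i\<close>: the two sides give \<open>P(X,Z) Q(X,Y)\<close> and
  \<open>P(X,Z) Q(Z,Y)\<close>, each minus \<open>Z - X\<close> times a braid word. The difference
  of the \<open>Q\<close> values is \<open>X - Z\<close> times \<open>Qbar\<close>, which cancels
  the correction in the braid relation.\<close>

lemma braid_outer_same:
  assumes eq: "ent \<mu> a = ent \<mu> (a + 2)" and ne: "ent \<mu> a \<noteq> ent \<mu> (a + 1)"
  shows "\<sigma> * h (a + 1) * h a * e \<mu> = h (a + 1) * h a * \<rho> * e \<mu>"
proof -
  define i j where "i = ent \<mu> a" and "j = ent \<mu> (a + 1)"
  let ?\<nu> = "sw (a + 1) \<mu>" and ?\<mu> = "sw a \<mu>"
  have ij: "i \<in> I" "j \<in> I" using index \<mu> by (auto simp: i_def j_def ent_def Iseq_def)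
  have hx: "hx a \<mu> = \<sigma>" "hx (a + 1) ?\<mu> = Pev sc w i Y Z - (Z - Y) * \<rho>"
    "hx a ?\<nu> = Pev sc w i X Y - (Y - X) * \<sigma>" "hx (a + 1) (sw a ?\<nu>) = \<rho>"
    using eq ne ent_sw_index ent_sw_sw by (simp_all add: hx_def i_def numeral_2_eq_2)
  have \<rho>x: "\<rho> * x k * e ?\<nu> = x (sidx (a + 1) k) * \<rho> * e ?\<nu>" if "k \<in> {1..m}" for k
    by (rule tau_diff_intertwine) (use that index sw_index eq ne ent_sw_index in \<open>auto simp: numeral_2_eq_2\<close>)
  have \<sigma>x: "\<sigma> * x k * e ?\<mu> = x (sidx a k) * \<sigma> * e ?\<mu>" if "k \<in> {1..m}" for k
    by (rule tau_diff_intertwine) (use that index sw_index eq ne ent_sw_index in auto)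
  have s': "\<sigma> * Y * e ?\<mu> = X * \<sigma> * e ?\<mu>" "\<sigma> * Z * e ?\<mu> = Z * \<sigma> * e ?\<mu>"
    using \<sigma>x[OF index(4)] \<sigma>x[OF index(5)] by (simp_all add: sidx_def)
  have t': "\<rho> * X * e ?\<nu> = X * \<rho> * e ?\<nu>" "\<rho> * Y * e ?\<nu> = Z * \<rho> * e ?\<nu>"
    using \<rho>x[OF index(3)] \<rho>x[OF index(4)] by (simp_all add: sidx_def)
  have sP: "\<sigma> * Pev sc w i Y Z * e ?\<mu> = Pev sc w i X Z * \<sigma> * e ?\<mu>"
    using intertwine_e[OF sw_index(1) index(4,5) s'] by (simp only: Pev_pe index)
  have tP: "\<rho> * Pev sc w i X Y * e ?\<nu> = Pev sc w i X Z * \<rho> * e ?\<nu>"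
    using intertwine_e[OF sw_index(2) index(3,4) t'] by (simp only: Pev_pe index)
  note se = tau_e_left[OF index(1) \<mu>] and te = tau_e_left[OF index(2) \<mu>]
  \<comment> \<open>After the crossing \<open>\<sigma>\<close> the last two labels are both
    \<open>i\<close>, so \<open>\<rho>\<close> fixes the sequence.\<close>
  have \<rho>e: "\<rho> * e ?\<mu> = e ?\<mu> * \<rho>"
    using tau_e[OF index(2) sw_index(1)] sw_same[of "a + 1" ?\<mu>] sw_index index ent_sw_index eq
    by (simp add: Iseq_def numeral_2_eq_2)
  have \<sigma>e: "\<sigma> * e ?\<nu> = e ?\<nu> * \<sigma>"
    using tau_e[OF index(1) sw_index(2)] sw_same[of "a" ?\<nu>] sw_index index ent_sw_index eq
    by (simp add: Iseq_def)
  have L: "\<sigma> * (Pev sc w i Y Z - (Z - Y) * \<rho>) * \<sigma> * e \<mu>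
      = Pev sc w i X Z * (\<sigma> * \<sigma> * e \<mu>) - (Z - X) * \<sigma> * \<rho> * \<sigma> * e \<mu>"
  proof -
    have "\<sigma> * (Pev sc w i Y Z - (Z - Y) * \<rho>) * \<sigma> * e \<mu>
      = (\<sigma> * Pev sc w i Y Z * e ?\<mu>) * (\<sigma> * e \<mu>) - (\<sigma> * (Z - Y) * e ?\<mu>) * \<rho> * (\<sigma> * e \<mu>)"
      using se \<rho>e by (simp add: right_diff_distrib left_diff_distrib mult.assoc)
         (metis mult.assoc)
    also have "\<sigma> * (Z - Y) * e ?\<mu> = (Z - X) * \<sigma> * e ?\<mu>"
      by (simp only: right_diff_distrib left_diff_distrib s')
    finally show ?thesis unfolding sP using se \<rho>e by (simp add: mult.assoc) (metis mult.assoc)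
  qed
  have R: "\<rho> * (Pev sc w i X Y - (Y - X) * \<sigma>) * \<rho> * e \<mu>
      = Pev sc w i X Z * (\<rho> * \<rho> * e \<mu>) - (Z - X) * \<rho> * \<sigma> * \<rho> * e \<mu>"
  proof -
    have "\<rho> * (Pev sc w i X Y - (Y - X) * \<sigma>) * \<rho> * e \<mu>
      = (\<rho> * Pev sc w i X Y * e ?\<nu>) * (\<rho> * e \<mu>) - (\<rho> * (Y - X) * e ?\<nu>) * \<sigma> * (\<rho> * e \<mu>)"
      using te \<sigma>e by (simp add: right_diff_distrib left_diff_distrib mult.assoc)
         (metis mult.assoc)
    also have "\<rho> * (Y - X) * e ?\<nu> = (Z - X) * \<rho> * e ?\<nu>"
      by (simp only: right_diff_distrib left_diff_distrib t')
    finally show ?thesis unfolding tP using te \<sigma>e by (simp add: mult.assoc) (metis mult.assoc)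
  qed
  interpret eval_point sc X Y Z using index by (intro eval_point_x)
  have ss: "\<sigma> * \<sigma> * e \<mu> = Qev sc t i j X Y * e \<mu>"
    using tau_square[OF index(1) \<mu>] ne by (simp add: i_def j_def)
  \<comment> \<open>Here the labels are met in the order \<open>j, i\<close>; the symmetry of
    \<open>Q\<close> rewrites \<open>Q\<^sub>j\<^sub>i(Y,Z)\<close> as
    \<open>Q\<^sub>i\<^sub>j(Z,Y)\<close>.\<close>
  have tt: "\<rho> * \<rho> * e \<mu> = Qev sc t i j Z Y * e \<mu>"
    using tau_square[OF index(2) \<mu>] ne eq Qev_flip[OF ij(2,1) index(4,5)]
    by (simp add: i_def j_def numeral_2_eq_2)
  have tst: "(\<rho> * \<sigma> * \<rho> - \<sigma> * \<rho> * \<sigma>) * e \<mu> = Pev sc w i X Z * eval3 sc (Qbar t i j) X Y Z * e \<mu>"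
  proof -
    have "(\<rho> * \<sigma> * \<rho> - \<sigma> * \<rho> * \<sigma>) * e \<mu> = eval3 sc (poly2 (w i) U3 W3 * Qbar t i j) X Y Z * e \<mu>"
      using tau_braid[OF a \<mu>] ne eq by (simp add: i_def j_def)
    then show ?thesis by (simp only: eval3_simps(2) eval3_poly2 eval3_U3 eval3_W3 Pev_pe index)
  qed
  have Q: "(X - Z) * eval3 sc (Qbar t i j) X Y Z = Qev sc t i j X Y - Qev sc t i j Z Y"
    using arg_cong[OF Qbar[of t i j], of "\<lambda>F. eval3 sc F X Y Z"]
    by (simp only: eval3_simps(2,6) eval3_poly2 eval3_U3 eval3_V3 eval3_W3 Qev_pe index)
  have c: "(X - Z) * Pev sc w i X Z = Pev sc w i X Z * (X - Z)"
    by (rule Pev_commute) (use index in \<open>auto simp: left_diff_distrib right_diff_distrib x_x\<close>)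
  have "\<sigma> * h (a + 1) * h a * e \<mu> - h (a + 1) * h a * \<rho> * e \<mu>
    = Pev sc w i X Z * (Qev sc t i j X Y - Qev sc t i j Z Y) * e \<mu>
      + (Z - X) * ((\<rho> * \<sigma> * \<rho> - \<sigma> * \<rho> * \<sigma>) * e \<mu>)"
    unfolding hx_expand_left hx_expand_right hx L R ss tt
    by (simp add: right_diff_distrib left_diff_distrib mult.assoc)
  also have "(Z - X) * ((\<rho> * \<sigma> * \<rho> - \<sigma> * \<rho> * \<sigma>) * e \<mu>)
    = - ((X - Z) * Pev sc w i X Z) * eval3 sc (Qbar t i j) X Y Z * e \<mu>"
    unfolding tst by (simp add: left_diff_distrib mult.assoc)
  also have "\<dots> = - (Pev sc w i X Z * (Qev sc t i j X Y - Qev sc t i j Z Y) * e \<mu>)"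
    unfolding c Q[symmetric] by (simp add: mult.assoc)
  finally show ?thesis by simp
qed

text \<open>Each intertwiner exchanges the label \<open>ent \<mu> a\<close> with one of the other
  two, which differ from it. Thus all factors are crossings and the braid relation has no correction
  term.\<close>

lemma braid_different:
  assumes "ent \<mu> a \<noteq> ent \<mu> (a + 1)" and ne: "ent \<mu> a \<noteq> ent \<mu> (a + 2)"
  shows "\<sigma> * h (a + 1) * h a * e \<mu> = h (a + 1) * h a * \<rho> * e \<mu>"
proof -
  have hx: "hx a \<mu> = \<sigma>" "hx (a + 1) (sw a \<mu>) = \<rho>" 
    "hx a (sw (a + 1) \<mu>) = \<sigma>" "hx (a + 1) (sw a (sw (a + 1) \<mu>)) = \<rho>"
    using assms ent_sw_index ent_sw_sw by (simp_all add: hx_def numeral_2_eq_2)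
  show ?thesis unfolding hx_expand_left hx_expand_right hx
    using tau_braid[OF a \<mu>] assms by (simp add: left_diff_distrib)
qed

end

lemma tau_h_h:
  assumes "1 \<le> a" "a + 2 \<le> m"
  shows "\<tau> a * h (a + 1) * h a = h (a + 1) * h a * \<tau> (a + 1)"
proof (rule eq_by_e)
  fix \<mu> assume \<mu>: "\<mu> \<in> Iseq I m"
  consider "ent \<mu> a = ent \<mu> (a + 1)" "ent \<mu> a = ent \<mu> (a + 2)"
    | "ent \<mu> a = ent \<mu> (a + 1)" "ent \<mu> a \<noteq> ent \<mu> (a + 2)"
    | "ent \<mu> a = ent \<mu> (a + 2)" "ent \<mu> a \<noteq> ent \<mu> (a + 1)"
    | "ent \<mu> a \<noteq> ent \<mu> (a + 1)" "ent \<mu> a \<noteq> ent \<mu> (a + 2)" by blast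
  then show "\<tau> a * h (a + 1) * h a * e \<mu> = h (a + 1) * h a * \<tau> (a + 1) * e \<mu>"
  proof cases
    case 1 then show ?thesis by (rule braid_all_same[OF assms \<mu>])
  next
    case 2 then show ?thesis by (rule braid_first_same[OF assms \<mu>])
  next
    case 3 then show ?thesis by (rule braid_outer_same[OF assms \<mu>])
  next
    case 4 then show ?thesis by (rule braid_different[OF assms \<mu>])
  qed
qed

section \<open>The polynomial subalgebra, and generation of the intertwiners\<close>

abbreviation Xalg :: "'a set" where "Xalg \<equiv> kalg sc (x ` {1..m})"

lemma x_Xalg: "b \<in> {1..m} \<Longrightarrow> x b \<in> Xalg"
  by (rule kalg_gen) simp

lemma Xalg_commute: "f \<in> Xalg \<Longrightarrow> (\<And>b. b \<in> {1..m} \<Longrightarrow> x b * z = z * x b) \<Longrightarrow> f * z = z * f"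
  by (rule kalg_commute[where sc = sc and G = "x ` {1..m}"]) (auto simp: sc_central)

lemma Xalg_Xalg: "f \<in> Xalg \<Longrightarrow> g \<in> Xalg \<Longrightarrow> f * g = g * f"
  by (rule Xalg_commute, assumption, rule Xalg_commute[symmetric], assumption, rule x_x)

lemma Xalg_e: "f \<in> Xalg \<Longrightarrow> \<mu> \<in> Iseq I m \<Longrightarrow> f * e \<mu> = e \<mu> * f"
  by (rule Xalg_commute) (simp_all add: x_e)

lemma Pev_Xalg: "k \<in> {1..m} \<Longrightarrow> l \<in> {1..m} \<Longrightarrow> Pev sc w j (x k) (x l) \<in> Xalg"
  by (simp only: Pev_pe) (intro kalg_pe sc_hom x_Xalg)

lemma Qev_Xalg: "k \<in> {1..m} \<Longrightarrow> l \<in> {1..m} \<Longrightarrow> Qev sc t i j (x k) (x l) \<in> Xalg"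
  by (simp only: Qev_pe) (intro kalg_pe sc_hom x_Xalg)

lemma aev_Xalg: "k \<in> {1..m} \<Longrightarrow> aev sc c hh L j (x k) \<in> Xalg"
  unfolding aev_def by (intro kalg_sum kalg_mult kalg_power kalg_scalar sc_hom x_Xalg)

lemma Rgen_gens:
  "b \<in> {1..m} \<Longrightarrow> x b \<in> Rgen I sc m e x \<tau>" "a \<in> {1..<m} \<Longrightarrow> \<tau> a \<in> Rgen I sc m e x \<tau>"
  "\<mu> \<in> Iseq I m \<Longrightarrow> e \<mu> \<in> Rgen I sc m e x \<tau>"
  unfolding Rgen_def by (auto intro!: kalg_gen)

lemma h_Rgen: "a \<in> {1..<m} \<Longrightarrow> h a \<in> Rgen I sc m e x \<tau>"
proof -
  assume a: "a \<in> {1..<m}"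
  then have A: "a \<in> {1..m}" "a + 1 \<in> {1..m}" by auto
  note g = Rgen_gens[unfolded Rgen_def]
  show ?thesis unfolding h_def hx_def Rgen_def
  proof (rule kalg_sum[OF sc_hom], rule kalg_mult)
    fix \<mu> assume \<mu>: "\<mu> \<in> Iseq I m"
    show "e \<mu> \<in> kalg sc (e ` Iseq I m \<union> x ` {1..m} \<union> \<tau> ` {1..<m})" by (rule g(3)[OF \<mu>])
    show "(if ent \<mu> a \<noteq> ent \<mu> (a + 1) then \<tau> a
          else Pev sc w (ent \<mu> a) (x a) (x (a + 1)) - (x (a + 1) - x a) * \<tau> a)
         \<in> kalg sc (e ` Iseq I m \<union> x ` {1..m} \<union> \<tau> ` {1..<m})"
      using a A by (simp only: Pev_pe split: if_splits)
        (intro impI conjI kalg_mult kalg_diff kalg_pe sc_hom g)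
  qed
qed

section \<open>Moving one strand across all the others\<close>

definition T :: "nat \<Rightarrow> 'a" where "T k = prod_list (map \<tau> [1..<k + 1])"
text \<open>Starting at index \<open>2\<close> places the word in the image of the shift
  \<open>\<xi>\<close>; \<open>T' 1\<close> is the empty word.\<close>

definition T' :: "nat \<Rightarrow> 'a" where "T' k = prod_list (map \<tau> [2..<k + 1])"
definition H :: "nat \<Rightarrow> 'a" where "H k = prod_list (map h (rev [1..<k + 1]))"

lemma T_simps [simp]: "T 0 = 1" "T (Suc k) = T k * \<tau> (Suc k)"
  by (simp_all add: T_def)
lemma T'_simps [simp]: "T' (Suc 0) = 1" "T' (Suc (Suc k)) = T' (Suc k) * \<tau> (Suc (Suc k))"
  by (simp_all add: T'_def)
lemma H_simps [simp]: "H 0 = 1" "H (Suc k) = h (Suc k) * H k"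
  by (simp_all add: H_def)

text \<open>The rightmost factor \<open>h 1\<close> acts first, so \<open>H k\<close> carries the
  strand at position \<open>1\<close> to position \<open>k + 1\<close> and leaves the later
  positions alone.\<close>

lemma H_x_aux:
  "k < m \<Longrightarrow> x (Suc k) * H k = H k * x 1 \<and> (\<forall>b. Suc k < b \<and> b \<le> m \<longrightarrow> x b * H k = H k * x b)"
proof (induction k)
  case (Suc k)
  have k: "Suc k \<in> {1..<m}" "Suc k \<in> {1..m}" using Suc.prems by auto
  have "x (Suc (Suc k)) * h (Suc k) = h (Suc k) * x (Suc k)"
    using h_x[OF k] by (simp add: sidx_def)
  then have "x (Suc (Suc k)) * H (Suc k) = h (Suc k) * (x (Suc k) * H k)"
    by (simp add: mult.assoc[symmetric])
  moreover have "x b * H (Suc k) = H (Suc k) * x b" if "Suc (Suc k) < b" "b \<le> m" for b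
  proof -
    have "x b * h (Suc k) = h (Suc k) * x b"
      using h_x[OF k(1), of b] that by (simp add: sidx_def)
    then have "x b * H (Suc k) = h (Suc k) * (x b * H k)"
      by (simp add: mult.assoc[symmetric])
    then show ?thesis using Suc that by (simp add: mult.assoc)
  qed
  ultimately show ?case using Suc by (simp add: mult.assoc)
qed simp

lemma H_x:
  assumes "k < m"
  shows "x (Suc k) * H k = H k * x 1" "Suc k < b \<Longrightarrow> b \<le> m \<Longrightarrow> x b * H k = H k * x b"
  using H_x_aux[OF assms] by auto

lemma pe_H:
  assumes "Suc k < m"
  shows "pe sc cf (x (Suc k)) (x (Suc (Suc k))) * H k = H k * pe sc cf (x 1) (x (Suc (Suc k)))"
    "pe sc cf (x (Suc (Suc k))) (x (Suc k)) * H k = H k * pe sc cf (x (Suc (Suc k))) (x 1)"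
  by (rule pe_intertwine[symmetric]; use assms H_x[of k] in \<open>simp add: sc_central\<close>)+

lemma tau_H_far: "k < a \<Longrightarrow> Suc k < a \<Longrightarrow> a < m \<Longrightarrow> \<tau> a * H k = H k * \<tau> a"
proof (induction k)
  case (Suc k)
  have "\<tau> a * h (Suc k) = h (Suc k) * \<tau> a" using Suc.prems by (intro tau_h_far) auto
  then have "\<tau> a * H (Suc k) = h (Suc k) * (\<tau> a * H k)" by (simp add: mult.assoc[symmetric])
  then show ?case using Suc by (simp add: mult.assoc)
qed simp

text \<open>Going through \<open>H k\<close> from the left, \<open>\<tau> a\<close> commutes with
  the factors of index above \<open>a + 1\<close>, becomes \<open>\<tau> (a + 1)\<close> at
  \<open>h (a + 1) * h a\<close>, and then commutes with the rest.\<close>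

lemma tau_H: "1 \<le> a \<Longrightarrow> a < k \<Longrightarrow> k < m \<Longrightarrow> \<tau> a * H k = H k * \<tau> (Suc a)"
proof (induction k)
  case (Suc k)
  show ?case
  proof (cases "a = k")
    case True
    then obtain l where a: "a = Suc l" using Suc.prems by (cases a) auto
    have "\<tau> a * H (Suc k) = (\<tau> a * h (a + 1) * h a) * H l"
      unfolding True[symmetric] a by (simp add: mult.assoc)
    also have "\<dots> = h (a + 1) * h a * (\<tau> (a + 1) * H l)"
      using tau_h_h[of a] Suc.prems True by (simp add: mult.assoc)
    also have "\<dots> = H (Suc k) * \<tau> (Suc a)"
      using tau_H_far[of l "a + 1"] Suc.prems unfolding True[symmetric] a by (simp add: mult.assoc)
    finally show ?thesis .
  next
    case False
    have "\<tau> a * h (Suc k) = h (Suc k) * \<tau> a" using Suc.prems False by (intro tau_h_far) auto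
    then have "\<tau> a * H (Suc k) = h (Suc k) * (\<tau> a * H k)" by (simp add: mult.assoc[symmetric])
    then show ?thesis using Suc False by (simp add: mult.assoc)
  qed
qed simp

lemma T_H: "a < k \<Longrightarrow> k < m \<Longrightarrow> T a * H k = H k * T' (Suc a)"
proof (induction a)
  case (Suc a)
  have "T (Suc a) * H k = T a * H k * \<tau> (Suc (Suc a))"
    using tau_H[of "Suc a" k] Suc.prems by (simp add: mult.assoc)
  then show ?case using Suc by (simp add: mult.assoc)
qed simp

lemma aLam_e:
  assumes "Ibeta I B \<subseteq> Iseq I m" "\<mu> \<in> Iseq I m"
  shows "aLam I sc c hh L e x B k * e \<mu> = (if \<mu> \<in> Ibeta I B then aev sc c hh L (ent \<mu> k) (x k) * e \<mu> else 0)"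
  unfolding aLam_def using assms by (rule sum_times_e)

text \<open>Labels and variables are permuted together: the label of \<open>\<mu>\<close> at
  \<open>k\<close> is that of \<open>sw a \<mu>\<close> at \<open>sidx a k\<close>, so the same
  polynomial is evaluated on both sides.\<close>

lemma h_aLam:
  assumes B: "Ibeta I B \<subseteq> Iseq I m" and a: "a \<in> {1..<m}" and k: "k \<in> {1..m}"
  shows "h a * aLam I sc c hh L e x B k = aLam I sc c hh L e x B (sidx a k) * h a"
proof (rule eq_by_e)
  fix \<mu> assume \<mu>: "\<mu> \<in> Iseq I m"
  have s: "sidx a k \<in> {1..m}" "sidx a (sidx a k) = k" using a k by (auto simp: sidx_def)
  have sw: "sw a \<mu> \<in> Ibeta I B \<longleftrightarrow> \<mu> \<in> Ibeta I B"
    using a \<mu> by (intro sw_in_Ibeta_iff) (auto simp: Iseq_def)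
  let ?A = "\<lambda>l. aev sc c hh L (ent \<mu> k) (x l)"
  have "aLam I sc c hh L e x B (sidx a k) * h a * e \<mu>
      = aLam I sc c hh L e x B (sidx a k) * e (sw a \<mu>) * (h a * e \<mu>)"
    using h_e_left[OF a \<mu>] by (simp add: mult.assoc)
  also have "\<dots> = (if \<mu> \<in> Ibeta I B then ?A (sidx a k) * (e (sw a \<mu>) * (h a * e \<mu>)) else 0)"
    using ent_sw'[OF a \<mu> s(1)] by (simp add: aLam_e[OF B sw_Iseq[OF a \<mu>]] sw s(2) mult.assoc)
  also have "\<dots> = (if \<mu> \<in> Ibeta I B then ?A (sidx a k) * h a * e \<mu> else 0)"
    using h_e_left[OF a \<mu>] by (simp add: mult.assoc)
  also have "?A (sidx a k) * h a = h a * ?A k"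
    by (rule aev_intertwine[symmetric]) (simp_all only: sc_central h_x[OF a k])
  finally show "h a * aLam I sc c hh L e x B k * e \<mu> = aLam I sc c hh L e x B (sidx a k) * h a * e \<mu>"
    by (simp add: mult.assoc aLam_e[OF B \<mu>])
qed

text \<open>Only \<open>h 1\<close> moves the strand at position \<open>1\<close>; the other factors
  of \<open>H\<close> leave it alone. At least one factor must therefore be present.\<close>

lemma aLam_H:
  assumes B: "Ibeta I B \<subseteq> Iseq I m"
  shows "Suc k < m \<Longrightarrow> aLam I sc c hh L e x B 1 * H (Suc k) = H (Suc k) * aLam I sc c hh L e x B 2"
proof (induction k)
  case 0
  then show ?case using h_aLam[OF B, of 1 2 c hh L] by (simp add: sidx_def numeral_2_eq_2)
next
  case (Suc k)
  have "aLam I sc c hh L e x B 1 * h (Suc (Suc k)) = h (Suc (Suc k)) * aLam I sc c hh L e x B 1"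
    using h_aLam[OF B, of "Suc (Suc k)" 1 c hh L] Suc.prems by (simp add: sidx_def)
  then have "aLam I sc c hh L e x B 1 * H (Suc (Suc k)) = h (Suc (Suc k)) * (aLam I sc c hh L e x B 1 * H (Suc k))"
    by (simp add: mult.assoc[symmetric])
  then show ?case using Suc by (simp add: mult.assoc)
qed

lemma aLam_Xcommute:
  assumes B: "Ibeta I B \<subseteq> Iseq I m" and "k \<in> {1..m}" "b \<in> {1..m}"
  shows "x b * aLam I sc c hh L e x B k = aLam I sc c hh L e x B k * x b"
  unfolding aLam_def sum_distrib_left sum_distrib_right
proof (rule sum.cong[OF refl])
  fix \<mu> assume "\<mu> \<in> Ibeta I B"
  then have "\<mu> \<in> Iseq I m" using B by auto
  moreover have "x b * aev sc c hh L (ent \<mu> k) (x k) = aev sc c hh L (ent \<mu> k) (x k) * x b"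
    by (rule aev_intertwine) (simp_all only: sc_central x_x[OF assms(3,2)])
  ultimately show "x b * (aev sc c hh L (ent \<mu> k) (x k) * e \<mu>) = aev sc c hh L (ent \<mu> k) (x k) * e \<mu> * x b"
    by (simp only: mult.assoc x_e[OF assms(3), symmetric]) (simp only: mult.assoc[symmetric])
qed

text \<open>Used to put the left coefficient of the error term into the block
  \<open>R(\<beta> + \<alpha>\<^sub>i)\<close>.\<close>

lemma block_idem_aLam:
  assumes B: "Ibeta I B \<subseteq> Iseq I m" and k: "k \<in> {1..m}"
  shows "(\<Sum>\<mu>\<in>Ibeta I B. e \<mu>) * aLam I sc c hh L e x B k = aLam I sc c hh L e x B k"
proof (rule eq_by_e)
  fix \<mu> assume \<mu>: "\<mu> \<in> Iseq I m"
  let ?E = "\<Sum>\<mu>\<in>Ibeta I B. e \<mu>"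
  have "aev sc c hh L (ent \<mu> k) (x k) * ?E = ?E * aev sc c hh L (ent \<mu> k) (x k)"
    unfolding sum_distrib_left sum_distrib_right
    by (intro sum.cong[OF refl] Xalg_e aev_Xalg k subsetD[OF B])
  moreover have "?E * e \<mu> = (if \<mu> \<in> Ibeta I B then e \<mu> else 0)"
    using sum_times_e[OF B \<mu>, of "\<lambda>_. 1"] by simp
  ultimately show "?E * aLam I sc c hh L e x B k * e \<mu> = aLam I sc c hh L e x B k * e \<mu>"
    by (simp add: mult.assoc aLam_e[OF B \<mu>]) (metis mult.assoc)
qed

lemma gel_e:
  assumes B: "Ibeta I B \<subseteq> Iseq I m" and \<mu>: "\<mu> \<in> Ibeta I B"
  shows "gel I sc w e x \<tau> B a * e \<mu> = (if ent \<mu> a = ent \<mu> (a + 1)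
     then (x (a + 1) - x a) * Pev sc w (ent \<mu> a) (x a) (x (a + 1)) - (x (a + 1) - x a) ^ 2 * \<tau> a
     else \<tau> a) * e \<mu>"
proof -
  have "\<mu> \<in> Iseq I m" using assms by auto
  then show ?thesis unfolding gel_def distrib_right
    using B \<mu> by (subst (1 2) sum_times_e) auto
qed

text \<open>A factor \<open>x\<^sub>a\<^sub>+\<^sub>1 - x\<^sub>a\<close> splits off on the left of
  \<open>g\<^sub>a\<close> for equal labels; moved past \<open>h\<^sub>a\<close> it becomes
  \<open>x\<^sub>a - x\<^sub>a\<^sub>+\<^sub>1\<close>.\<close>

lemma gel_h:
  assumes B: "Ibeta I B \<subseteq> Iseq I m" and \<mu>: "\<mu> \<in> Ibeta I B" and a: "a \<in> {1..<m}"
  shows "gel I sc w e x \<tau> B a * e \<mu> = h a * (if ent \<mu> a = ent \<mu> (a + 1) then x a - x (a + 1) else 1) * e \<mu>"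
proof -
  have \<mu>': "\<mu> \<in> Iseq I m" using B \<mu> by auto
  have A: "a \<in> {1..m}" "a + 1 \<in> {1..m}" using a by auto
  define D where "D = x (a + 1) - x a"
  have "h a * (x a - x (a + 1)) = D * h a"
    using h_x[OF a A(1)] h_x[OF a A(2)] by (simp add: D_def sidx_def right_diff_distrib left_diff_distrib)
  then have *: "h a * (x a - x (a + 1)) * e \<mu> = D * hx a \<mu> * e \<mu>"
    by (simp only: mult.assoc h_e[OF \<mu>'])
  show ?thesis
  proof (cases "ent \<mu> a = ent \<mu> (a + 1)")
    case True
    then have "hx a \<mu> = Pev sc w (ent \<mu> a) (x a) (x (a + 1)) - D * \<tau> a"
      by (simp add: hx_def D_def)
    then have "D * hx a \<mu> = D * Pev sc w (ent \<mu> a) (x a) (x (a + 1)) - D ^ 2 * \<tau> a"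
      by (simp add: right_diff_distrib power2_eq_square mult.assoc)
    then show ?thesis using * True unfolding gel_e[OF B \<mu>] D_def[symmetric] by (simp only: if_True refl)
  next
    case False
    then show ?thesis unfolding gel_e[OF B \<mu>] by (simp add: h_e[OF \<mu>'] hx_def)
  qed
qed

definition G :: "('i \<Rightarrow> nat) \<Rightarrow> nat \<Rightarrow> 'a" where
  "G B k = prod_list (map (gel I sc w e x \<tau> B) (rev [1..<k + 1]))"

lemma G_simps [simp]: "G B 0 = 1" "G B (Suc k) = gel I sc w e x \<tau> B (Suc k) * G B k"
  by (simp_all add: G_def)

lemma H_Rgen: "k < m \<Longrightarrow> H k \<in> Rgen I sc m e x \<tau>"
proof (induction k)
  case 0 then show ?case by (simp add: Rgen_def kalg_one sc_hom)
next
  case (Suc k) then show ?case using h_Rgen[of "Suc k"] by (simp add: Rgen_def kalg_mult)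
qed

section \<open>The left module and the induction on the number of crossings\<close>

context
  fixes hh :: "'i \<Rightarrow> ('b \<Rightarrow> int) \<Rightarrow> int" and L :: "'b \<Rightarrow> int" and c :: "'i \<Rightarrow> nat \<Rightarrow> 'k"
    and i :: 'i and n :: nat and \<beta> B :: "'i \<Rightarrow> nat" and \<nu> :: "'i list"
  assumes m: "m = Suc n"
    and i: "i \<in> I" and \<nu>: "\<nu> \<in> Ibeta I \<beta>"
    and \<beta>: "Ibeta I \<beta> \<subseteq> Iseq I n"
    and B: "Ibeta I B \<subseteq> Iseq I m"
    and i\<nu>_B: "i # \<nu> \<in> Ibeta I B"
begin

abbreviation (input) "aL \<equiv> aLam I sc c hh L e x B"
abbreviation (input) "f \<equiv> e (i # \<nu>)"
abbreviation (input) "J \<equiv> lsub (Rblock I sc m e x \<tau> B) (aL 2) (xiRblock I sc n e x \<tau> \<beta>) f"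
abbreviation (input) "XiG \<equiv> (\<lambda>\<nu>. \<Sum>j\<in>I. e (j # \<nu>)) ` Iseq I n \<union> (\<lambda>k. x (k + 1)) ` {1..n} \<union> (\<lambda>l. \<tau> (l + 1)) ` {1..<n}"

lemma length_\<nu>: "length \<nu> = n"
  using \<nu> \<beta> by (auto simp: Iseq_def)

lemma Cons_Iseq: "\<mu> \<in> Iseq I n \<Longrightarrow> j \<in> I \<Longrightarrow> j # \<mu> \<in> Iseq I m"
  by (simp add: Iseq_def m)

lemma i\<nu>_Iseq: "i # \<nu> \<in> Iseq I m"
  using i\<nu>_B B by auto

text \<open>For \<open>b > 1\<close> the variable is a generator of the image of
  \<open>\<xi>\<close> and is absorbed there. The variable \<open>x 1\<close> commutes with that
  image and with \<open>aL 2\<close>, and is absorbed by the left coefficient.\<close>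

lemma J_x:
  assumes n: "n \<noteq> 0" and y: "y \<in> J" and b: "b \<in> {1..m}"
  shows "y * x b \<in> J"
  using y
proof (rule lsub_right)
  fix r s assume r: "r \<in> Rblock I sc m e x \<tau> B" and s: "s \<in> xiRblock I sc n e x \<tau> \<beta>"
  have fx: "f * x b = x b * f" using x_e[OF b i\<nu>_Iseq] by simp
  obtain z where z: "s = (\<Sum>\<nu>\<in>Ibeta I \<beta>. \<Sum>j\<in>I. e (j # \<nu>)) * z" "z \<in> kalg sc XiG"
    using s by (auto simp: xiRblock_def)
  obtain q where q: "r = (\<Sum>\<mu>\<in>Ibeta I B. e \<mu>) * q" "q \<in> Rgen I sc m e x \<tau>"
    using r by (auto simp: Rblock_def)
  show "r * aL 2 * s * f * x b \<in> J"
  proof (cases "b = 1")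
    case False
    have "b - 1 \<in> {1..n}" "x b = x (b - 1 + 1)" using b False m by auto
    then have "x b \<in> kalg sc XiG" by (intro kalg_gen) blast
    then have "s * x b \<in> xiRblock I sc n e x \<tau> \<beta>"
      using z by (auto simp: xiRblock_def mult.assoc intro: kalg_mult)
    from lsub_single[OF r this] show ?thesis by (simp add: mult.assoc fx)
  next
    case True
    have xe: "(\<Sum>j\<in>I. e (j # \<mu>)) * x b = x b * (\<Sum>j\<in>I. e (j # \<mu>))" if "\<mu> \<in> Iseq I n" for \<mu>
      unfolding sum_distrib_left sum_distrib_right
      by (intro sum.cong[OF refl] x_e[OF b, symmetric] Cons_Iseq that)
    have "z * x b = x b * z" using z(2)
    proof (rule kalg_commute)
      show "sc r * x b = x b * sc r" for r by (rule sc_central)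
      fix y assume "y \<in> XiG"
      then consider \<mu> where "\<mu> \<in> Iseq I n" "y = (\<Sum>j\<in>I. e (j # \<mu>))"
        | k where "k \<in> {1..n}" "y = x (k + 1)" | k where "k \<in> {1..<n}" "y = \<tau> (k + 1)" by auto
      then show "y * x b = x b * y"
      proof cases
        case 1 then show ?thesis using xe by simp
      next
        case 2 then show ?thesis using b m by (simp add: x_x)
      next
        case 3 then show ?thesis using True b m tau_x_far[of "k + 1" b] by simp
      qed
    qed
    moreover have "(\<Sum>\<nu>\<in>Ibeta I \<beta>. \<Sum>j\<in>I. e (j # \<nu>)) * x b = x b * (\<Sum>\<nu>\<in>Ibeta I \<beta>. \<Sum>j\<in>I. e (j # \<nu>))"
      unfolding sum_distrib_left[of "x b" _ "Ibeta I \<beta>"] sum_distrib_right[of _ "Ibeta I \<beta>"]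
      by (intro sum.cong[OF refl] xe subsetD[OF \<beta>])
    ultimately have sx: "s * x b = x b * s" unfolding z by (simp add: mult.assoc) (simp flip: mult.assoc)
    \<comment> \<open>Position \<open>2\<close> exists because \<open>n \<noteq> 0\<close>.\<close>
    have ax: "x b * aL 2 = aL 2 * x b" using b m n by (intro aLam_Xcommute[OF B]) auto
    have "r * aL 2 * s * f * x b = r * aL 2 * (s * x b) * f" by (simp add: mult.assoc fx)
    also have "\<dots> = r * (aL 2 * x b) * s * f" by (simp add: sx mult.assoc)
    also have "\<dots> = (r * x b) * aL 2 * s * f" by (simp add: ax[symmetric] mult.assoc)
    finally have "r * aL 2 * s * f * x b = (r * x b) * aL 2 * s * f" .
    moreover have "r * x b \<in> Rblock I sc m e x \<tau> B"
      using q Rgen_gens(1)[OF b] by (auto simp: Rblock_def Rgen_def mult.assoc intro: kalg_mult)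
    ultimately show ?thesis using lsub_single[OF _ s] by simp
  qed
qed

lemma J_Xalg:
  assumes n: "n \<noteq> 0" and y: "y \<in> J" and p: "p \<in> Xalg"
  shows "y * p \<in> J"
  using p y
proof (induction arbitrary: y)
  case (kalg_scalar a)
  show ?case using kalg_scalar
  proof (rule lsub_right)
    fix r s assume r: "r \<in> Rblock I sc m e x \<tau> B" and s: "s \<in> xiRblock I sc n e x \<tau> \<beta>"
    obtain z where z: "s = (\<Sum>\<nu>\<in>Ibeta I \<beta>. \<Sum>j\<in>I. e (j # \<nu>)) * z" "z \<in> kalg sc XiG"
      using s by (auto simp: xiRblock_def)
    have "z * sc a \<in> kalg sc XiG" by (intro kalg.kalg_mult z kalg.kalg_scalar)
    then have "s * sc a \<in> xiRblock I sc n e x \<tau> \<beta>"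
      unfolding xiRblock_def z(1) mult.assoc by blast
    from lsub_single[OF r this, of "aL 2" f] show "r * aL 2 * s * f * sc a \<in> J"
      by (simp add: mult.assoc sc_central)
  qed
next
  case (kalg_gen q)
  then show ?case using J_x[OF n] by auto
next
  case (kalg_add q1 q2)
  then show ?case by (simp add: distrib_left lsub_add)
next
  case (kalg_mult q1 q2)
  then show ?case by (simp flip: mult.assoc)
qed

text \<open>The word avoids \<open>\<tau>\<^sub>1\<close>, so the label \<open>i\<close> stays in
  front and only the labels of \<open>\<mu>\<close> are permuted.\<close>

lemma T'_e:
  "k < n \<Longrightarrow> \<mu> \<in> Ibeta I \<beta> \<Longrightarrow>
    \<exists>\<mu>'\<in>Ibeta I \<beta>. T' (Suc k) * e (i # \<mu>) = e (i # \<mu>') * (T' (Suc k) * e (i # \<mu>))"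
proof (induction k arbitrary: \<mu>)
  case 0
  then have "i # \<mu> \<in> Iseq I m" using \<beta> i by (auto intro: Cons_Iseq)
  then show ?case using 0 by (intro bexI[of _ \<mu>]) (simp_all add: e_e)
next
  case (Suc k)
  let ?t = "\<tau> (Suc (Suc k))" and ?\<mu> = "sw (Suc k) \<mu>"
  have len: "length \<mu> = n" and \<mu>: "i # \<mu> \<in> Iseq I m"
    using Suc.prems(2) \<beta> i by (auto intro: Cons_Iseq simp: Iseq_def m)
  have "?\<mu> \<in> Ibeta I \<beta>" using Suc.prems len by (subst sw_in_Ibeta_iff) auto
  then obtain \<mu>' where \<mu>': "\<mu>' \<in> Ibeta I \<beta>" "T' (Suc k) * e (i # ?\<mu>) = e (i # \<mu>') * (T' (Suc k) * e (i # ?\<mu>))"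
    using Suc.IH[of ?\<mu>] Suc.prems(1) by auto
  have t: "?t * e (i # \<mu>) = e (i # ?\<mu>) * (?t * e (i # \<mu>))"
    using tau_e_left[of "Suc (Suc k)" "i # \<mu>"] \<mu> Suc.prems(1) m by (simp add: sw_Cons)
  have "T' (Suc (Suc k)) * e (i # \<mu>) = (T' (Suc k) * e (i # ?\<mu>)) * (?t * e (i # \<mu>))"
    using t by (simp add: mult.assoc)
  also have "\<dots> = e (i # \<mu>') * (T' (Suc k) * (e (i # ?\<mu>) * (?t * e (i # \<mu>))))"
    by (subst \<mu>'(2)) (simp add: mult.assoc)
  also have "\<dots> = e (i # \<mu>') * (T' (Suc (Suc k)) * e (i # \<mu>))"
    unfolding t[symmetric] by (simp add: mult.assoc)
  finally show ?case using \<mu>'(1) by blast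
qed

lemma T'_kalg: "k < n \<Longrightarrow> T' (Suc k) \<in> kalg sc XiG"
proof (induction k)
  case 0 then show ?case by (simp add: kalg_one sc_hom)
next
  case (Suc k)
  have "\<tau> (Suc k + 1) \<in> kalg sc XiG" using Suc.prems by (intro kalg_gen UnI2 imageI) auto
  then show ?case using Suc by (simp add: kalg_mult)
qed

lemma xi_idem_e:
  assumes "\<mu> \<in> Ibeta I \<beta>"
  shows "(\<Sum>\<nu>\<in>Ibeta I \<beta>. \<Sum>j\<in>I. e (j # \<nu>)) * e (i # \<mu>) = e (i # \<mu>)"
proof -
  have fin: "finite (Ibeta I \<beta>)" using \<beta> finite_Iseq[OF finite_I] by (rule finite_subset)
  have "(\<Sum>\<kappa>\<in>Ibeta I \<beta>. \<Sum>j\<in>I. e (j # \<kappa>)) * e (i # \<mu>)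
      = (\<Sum>\<kappa>\<in>Ibeta I \<beta>. \<Sum>j\<in>I. if j = i then if \<kappa> = \<mu> then e (i # \<mu>) else 0 else 0)"
    unfolding sum_distrib_right
    by (intro sum.cong[OF refl]) (use assms \<beta> i in \<open>auto simp: e_e Cons_Iseq subset_iff\<close>)
  also have "\<dots> = e (i # \<mu>)" using fin finite_I i assms by (simp add: sum.delta)
  finally show ?thesis .
qed

text \<open>Moving \<open>T k\<close> and then \<open>aL 1\<close> through \<open>H (Suc k)\<close>
  brings the product into the form of a generator of the module; the polynomial \<open>p\<close> is
  absorbed because the module is stable under \<open>Xalg\<close> from the right.\<close>

lemma error_term:
  assumes k: "k < n" and p: "p \<in> Xalg"
  shows "aL 1 * T k * H (Suc k) * f * p \<in> J"
proof -
  let ?E = "\<Sum>\<mu>\<in>Ibeta I B. e \<mu>" and ?X = "\<Sum>\<nu>\<in>Ibeta I \<beta>. \<Sum>j\<in>I. e (j # \<nu>)"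
  have k': "Suc k < m" using k m by simp
  obtain \<mu> where \<mu>: "\<mu> \<in> Ibeta I \<beta>" "T' (Suc k) * f = e (i # \<mu>) * (T' (Suc k) * f)"
    using T'_e[OF k \<nu>] by blast
  have "?X * (T' (Suc k) * f) = ?X * (e (i # \<mu>) * (T' (Suc k) * f))" by (simp only: \<mu>(2)[symmetric])
  also have "\<dots> = T' (Suc k) * f" by (simp only: xi_idem_e[OF \<mu>(1)] \<mu>(2)[symmetric] mult.assoc[symmetric])
       (simp only: mult.assoc \<mu>(2)[symmetric])
  finally have X: "?X * (T' (Suc k) * f) = T' (Suc k) * f" .
  have "aL 1 * T k * H (Suc k) = aL 1 * H (Suc k) * T' (Suc k)"
    using T_H[of k "Suc k"] k' by (simp only: mult.assoc lessI)
  moreover have "?E * (aL 1 * H (Suc k)) = aL 1 * H (Suc k)"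
    using block_idem_aLam[OF B, of 1 c hh L] m by (simp flip: mult.assoc)
  then have "aL 1 * H (Suc k) = ?E * H (Suc k) * aL 2"
    by (simp only: aLam_H[OF B k'] mult.assoc)
  ultimately have "aL 1 * T k * H (Suc k) * f = ?E * H (Suc k) * aL 2 * (T' (Suc k) * f)"
    by (simp only: mult.assoc)
  \<comment> \<open>Generators of the module need coefficients in the block and in
    \<open>\<xi>(R(\<beta>))\<close>, hence the idempotents on both sides of
    \<open>aL 2\<close>.\<close>
  then have *: "aL 1 * T k * H (Suc k) * f = ?E * H (Suc k) * aL 2 * (?X * T' (Suc k)) * f"
    using X by (simp add: mult.assoc)
  have mem: "aL 1 * T k * H (Suc k) * f \<in> J"
    unfolding * by (rule lsub_single)
      (use T'_kalg[OF k] H_Rgen[OF k'] in \<open>auto simp: Rblock_def xiRblock_def\<close>)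
  show ?thesis by (rule J_Xalg[OF _ mem p]) (use k in simp)
qed

text \<open>The label \<open>i\<close> has travelled to position \<open>k + 1\<close> and the labels
  behind it are still those of \<open>\<nu>\<close>; these two decide the type of the next
  crossing.\<close>

lemma H_f:
  "k \<le> n \<Longrightarrow> \<exists>\<mu>\<in>Ibeta I B. H k * f = e \<mu> * (H k * f) \<and> ent \<mu> (Suc k) = i \<and>
     (\<forall>b. Suc k < b \<and> b \<le> m \<longrightarrow> ent \<mu> b = ent (i # \<nu>) b)"
proof (induction k)
  case 0
  show ?case using i\<nu>_B e_e[OF i\<nu>_Iseq i\<nu>_Iseq] by (intro bexI[OF _ i\<nu>_B]) (auto simp: ent_def)
next
  case (Suc k)
  from Suc.IH[OF Suc_leD[OF Suc.prems]]
  obtain \<mu> where \<mu>: "\<mu> \<in> Ibeta I B" "H k * f = e \<mu> * (H k * f)" "ent \<mu> (Suc k) = i"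
    "\<And>b. Suc k < b \<Longrightarrow> b \<le> m \<Longrightarrow> ent \<mu> b = ent (i # \<nu>) b" by blast
  have k: "Suc k \<in> {1..<m}" using Suc.prems m by simp
  have \<mu>': "\<mu> \<in> Iseq I m" using \<mu>(1) B by auto
  have "H (Suc k) * f = (h (Suc k) * e \<mu>) * (H k * f)"
    using \<mu>(2) by (simp add: mult.assoc)
  also have "\<dots> = e (sw (Suc k) \<mu>) * (h (Suc k) * (e \<mu> * (H k * f)))"
    by (subst h_e_left[OF k \<mu>']) (simp only: mult.assoc)
  also have "\<dots> = e (sw (Suc k) \<mu>) * (H (Suc k) * f)"
    using \<mu>(2) by (simp add: mult.assoc)
  finally have "H (Suc k) * f = e (sw (Suc k) \<mu>) * (H (Suc k) * f)" .
  moreover have "sw (Suc k) \<mu> \<in> Ibeta I B"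
    using \<mu>(1) k \<mu>' by (subst sw_in_Ibeta_iff) (auto simp: Iseq_def)
  moreover have "ent (sw (Suc k) \<mu>) (Suc (Suc k)) = i"
    using ent_sw'[OF k \<mu>', of "Suc (Suc k)"] k \<mu>(3) by (simp add: sidx_def)
  moreover have "ent (sw (Suc k) \<mu>) b = ent (i # \<nu>) b" if "Suc (Suc k) < b" "b \<le> m" for b
    using ent_sw'[OF k \<mu>', of b] \<mu>(4)[of b] that by (simp add: sidx_def)
  ultimately show ?case by blast
qed

text \<open>Each \<open>g\<^sub>a\<close> is \<open>h\<^sub>a\<close> times a polynomial, which is
  moved to the far right. Its exact form is immaterial: it commutes with polynomials and is absorbed
  by the module.\<close>

lemma G_f: "k \<le> n \<Longrightarrow> \<exists>p\<in>Xalg. G B k * f = H k * f * p"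
proof (induction k)
  case 0
  show ?case by (rule bexI[OF _ kalg_one[OF sc_hom]]) simp
next
  case (Suc k)
  from Suc.IH[OF Suc_leD[OF Suc.prems]]
  obtain p where p: "p \<in> Xalg" "G B k * f = H k * f * p" by blast
  obtain \<mu> where \<mu>: "\<mu> \<in> Ibeta I B" "H k * f = e \<mu> * (H k * f)" using H_f[of k] Suc.prems by auto
  have k: "Suc k \<in> {1..<m}" "k < m" "Suc (Suc k) \<le> m" using Suc.prems m by auto
  define q where "q = (if ent \<mu> (Suc k) = ent \<mu> (Suc k + 1) then x (Suc k) - x (Suc k + 1) else 1)"
  \<comment> \<open>This is \<open>q\<close> after passing \<open>H k\<close>, which replaces
    \<open>x (Suc k)\<close> by \<open>x 1\<close>.\<close>
  define q' where "q' = (if ent \<mu> (Suc k) = ent \<mu> (Suc k + 1) then x 1 - x (Suc k + 1) else 1)"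
  have q: "q * H k = H k * q'"
    using H_x[OF k(2)] k(3) by (simp add: q_def q'_def left_diff_distrib right_diff_distrib)
  have "x 1 \<in> Xalg" "x (Suc k + 1) \<in> Xalg" by (rule x_Xalg, use k in simp)+
  then have q': "q' \<in> Xalg" unfolding q'_def by (auto intro: kalg_diff kalg_one sc_hom)
  have "G B (Suc k) * f = gel I sc w e x \<tau> B (Suc k) * e \<mu> * (H k * f) * p"
    using p(2) \<mu>(2) by (simp add: mult.assoc)
  also have "\<dots> = h (Suc k) * (q * H k) * f * p"
    unfolding gel_h[OF B \<mu>(1) k(1)] q_def[symmetric] using \<mu>(2) by (simp add: mult.assoc)
  also have "\<dots> = H (Suc k) * (q' * f) * p" by (simp add: q mult.assoc)
  also have "\<dots> = H (Suc k) * f * (q' * p)" by (simp add: Xalg_e[OF q' i\<nu>_Iseq] mult.assoc)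
  finally show ?case using kalg_mult[OF q' p(1)] by blast
qed

lemma pe_G:
  assumes k: "k < n"
  shows "pe sc cf (x (Suc k)) (x (Suc (Suc k))) * (G B k * f) = G B k * f * pe sc cf (x 1) (x (Suc (Suc k)))"
    and "pe sc cf (x (Suc (Suc k))) (x (Suc k)) * (G B k * f) = G B k * f * pe sc cf (x (Suc (Suc k))) (x 1)"
proof -
  obtain p where p: "p \<in> Xalg" "G B k * f = H k * f * p" using G_f[of k] k by auto
  have k': "Suc k < m" using k m by simp
  have comm: "q * (G B k * f) = G B k * f * q'" if q: "q * H k = H k * q'" and q': "q' \<in> Xalg" for q q'
  proof -
    have "q * (G B k * f) = H k * (q' * f) * p" unfolding p(2) by (simp add: q flip: mult.assoc)
    also have "\<dots> = H k * f * (q' * p)" by (simp add: Xalg_e[OF q' i\<nu>_Iseq] mult.assoc)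
    also have "\<dots> = G B k * f * q'" unfolding p(2) by (simp add: Xalg_Xalg[OF q' p(1)] mult.assoc)
    finally show ?thesis .
  qed
  have X: "x 1 \<in> Xalg" "x (Suc (Suc k)) \<in> Xalg" by (rule x_Xalg, use k' in simp)+
  show "pe sc cf (x (Suc k)) (x (Suc (Suc k))) * (G B k * f) = G B k * f * pe sc cf (x 1) (x (Suc (Suc k)))"
    "pe sc cf (x (Suc (Suc k))) (x (Suc k)) * (G B k * f) = G B k * f * pe sc cf (x (Suc (Suc k))) (x 1)"
    by (rule comm[OF pe_H(1)[OF k']] comm[OF pe_H(2)[OF k']], intro kalg_pe sc_hom X)+
qed

text \<open>The word is reduced from its middle, where \<open>\<tau>\<^sub>k\<^sub>+\<^sub>1\<close>
  meets \<open>g\<^sub>k\<^sub>+\<^sub>1\<close>; the resulting polynomial is then moved to the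
  right of \<open>G B k\<close>.\<close>

lemma tau_gel_step:
  assumes k: "k < n"
  shows "\<exists>Z\<in>J. aL 1 * T (Suc k) * G B (Suc k) * f = aL 1 * T k * G B k * f *
    (if ent \<nu> (Suc k) = i then Pev sc w i (x 1) (x (Suc (Suc k))) * Pev sc w i (x (Suc (Suc k))) (x 1)
     else Qev sc t i (ent \<nu> (Suc k)) (x 1) (x (Suc (Suc k)))) + Z"
proof -
  obtain p where p: "p \<in> Xalg" "G B k * f = H k * f * p" using G_f[of k] k by auto
  obtain \<mu> where \<mu>: "\<mu> \<in> Ibeta I B" "H k * f = e \<mu> * (H k * f)" "ent \<mu> (Suc k) = i"
    "ent \<mu> (Suc (Suc k)) = ent (i # \<nu>) (Suc (Suc k))" using H_f[of k] k m by auto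
  have \<mu>': "\<mu> \<in> Iseq I m" using \<mu>(1) B by auto
  have j: "ent \<mu> (Suc (Suc k)) = ent \<nu> (Suc k)" using \<mu>(4) by (simp add: ent_def)
  have k': "Suc k \<in> {1..<m}" "Suc k \<in> {1..m}" "Suc (Suc k) \<in> {1..m}" "1 \<in> {1..m}" "Suc k < m"
    using k m by auto
  have G: "e \<mu> * (G B k * f) = G B k * f" using p(2) \<mu>(2) by (metis mult.assoc)
  have start: "aL 1 * T (Suc k) * G B (Suc k) * f
    = aL 1 * T k * (\<tau> (Suc k) * (gel I sc w e x \<tau> B (Suc k) * e \<mu>) * (G B k * f))"
    by (simp add: mult.assoc G)
  show ?thesis
  proof (cases "ent \<nu> (Suc k) = i")
    case False
    then have ne: "ent \<mu> (Suc k) \<noteq> ent \<mu> (Suc k + 1)" using \<mu>(3) j by simp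
    have "\<tau> (Suc k) * (gel I sc w e x \<tau> B (Suc k) * e \<mu>) = \<tau> (Suc k) * \<tau> (Suc k) * e \<mu>"
      using ne by (simp add: gel_e[OF B \<mu>(1)] mult.assoc)
    also have "\<dots> = Qev sc t i (ent \<nu> (Suc k)) (x (Suc k)) (x (Suc (Suc k))) * e \<mu>"
      using tau_square[OF k'(1) \<mu>'] ne \<mu>(3) j by simp
    finally have "aL 1 * T (Suc k) * G B (Suc k) * f = aL 1 * T k *
       (Qev sc t i (ent \<nu> (Suc k)) (x (Suc k)) (x (Suc (Suc k))) * (G B k * f))"
      unfolding start by (simp add: mult.assoc G)
    also have "\<dots> = aL 1 * T k * G B k * f * Qev sc t i (ent \<nu> (Suc k)) (x 1) (x (Suc (Suc k)))"
      unfolding Qev_pe[OF k'(2,3)] Qev_pe[OF k'(4,3)] pe_G[OF k] by (simp add: mult.assoc)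
    finally show ?thesis using False by (intro bexI[OF _ lsub_zero]) simp
  next
    case True
    define P1 P2 where "P1 = Pev sc w i (x (Suc k)) (x (Suc (Suc k)))"
      and "P2 = Pev sc w i (x (Suc (Suc k))) (x (Suc k))"
    define R1 R2 where "R1 = Pev sc w i (x 1) (x (Suc (Suc k)))"
      and "R2 = Pev sc w i (x (Suc (Suc k))) (x 1)"
    have R: "R1 \<in> Xalg" "R2 \<in> Xalg" unfolding R1_def R2_def by (intro Pev_Xalg k')+
    have PG: "P1 * (G B k * f) = G B k * f * R1" "P2 * (G B k * f) = G B k * f * R2"
      unfolding P1_def P2_def R1_def R2_def Pev_pe[OF k'(2,3)] Pev_pe[OF k'(3,2)] Pev_pe[OF k'(4,3)] Pev_pe[OF k'(3,4)]
      by (rule pe_G[OF k])+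
    have eq: "ent \<mu> (Suc k) = ent \<mu> (Suc k + 1)" using True \<mu>(3) j by simp
    have "\<tau> (Suc k) * (gel I sc w e x \<tau> B (Suc k) * e \<mu>) = (P1 * P2 + P1 * h (Suc k)) * e \<mu>"
      using tau_g_same[OF k'(1) \<mu>' eq] eq \<mu>(3) by (simp add: gel_e[OF B \<mu>(1)] mult.assoc P1_def P2_def)
    \<comment> \<open>With the polynomial to the right of \<open>h (Suc k)\<close>, the intertwiners
      combine to \<open>H (Suc k)\<close> and the summand takes the form treated by
      \<open>error_term\<close>.\<close>
    also have "P1 * h (Suc k) = h (Suc k) * P2"
      using h_Pev[OF k'(1,3,2), of i] by (simp add: P1_def P2_def sidx_def)
    finally have "aL 1 * T (Suc k) * G B (Suc k) * f
       = aL 1 * T k * (P1 * (P2 * (G B k * f))) + aL 1 * T k * h (Suc k) * (P2 * (G B k * f))"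
      unfolding start by (simp add: mult.assoc G distrib_left distrib_right)
    also have "P1 * (P2 * (G B k * f)) = G B k * f * (R1 * R2)"
    proof -
      have "P1 * (P2 * (G B k * f)) = P1 * (G B k * f) * R2" unfolding PG(2) by (simp add: mult.assoc)
      then show ?thesis unfolding PG(1) by (simp add: mult.assoc)
    qed
    also have "aL 1 * T k * h (Suc k) * (P2 * (G B k * f)) = aL 1 * T k * H (Suc k) * f * (p * R2)"
      unfolding PG(2) unfolding p(2) by (simp add: mult.assoc)
    finally show ?thesis
      using error_term[OF k kalg_mult[OF p(1) R(2)]] True
      by (intro bexI) (simp_all add: mult.assoc R1_def R2_def)
  qed
qed

text \<open>\<open>A k\<close> is the partial product of \<open>\<A>\<^sub>\<nu>\<close> over the
  first \<open>k\<close> strands crossed; each step multiplies it by one factor and adds an element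
  of the module.\<close>

lemma Anu_upto:
  assumes "k \<le> n"
  defines "A \<equiv> \<lambda>k. aev sc c hh L i (x 1)
     * prod_list (map (\<lambda>a. Qev sc t i (ent \<nu> a) (x 1) (x (a + 1))) (filter (\<lambda>a. ent \<nu> a \<noteq> i) [1..<k + 1]))
     * prod_list (map (\<lambda>a. Pev sc w i (x 1) (x (a + 1)) * Pev sc w i (x (a + 1)) (x 1))
                     (filter (\<lambda>a. ent \<nu> a = i) [1..<k + 1]))"
  shows "aL 1 * T k * G B k * f - A k * f \<in> J"
  using assms(1)
proof (induction k)
  case 0
  \<comment> \<open>Without crossings there is equality: on \<open>f\<close> the element
    \<open>aL 1\<close> is \<open>a\<^sub>i(x\<^sub>1)\<close>.\<close>
  have "ent (i # \<nu>) 1 = i" by (simp add: ent_def)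
  then show ?case using aLam_e[OF B i\<nu>_Iseq, of c hh L 1] i\<nu>_B by (simp add: A_def lsub_zero)
next
  case (Suc k)
  define F where "F = (if ent \<nu> (Suc k) = i then Pev sc w i (x 1) (x (Suc (Suc k))) * Pev sc w i (x (Suc (Suc k))) (x 1)
     else Qev sc t i (ent \<nu> (Suc k)) (x 1) (x (Suc (Suc k))))"
  have k': "1 \<in> {1..m}" "Suc (Suc k) \<in> {1..m}" using Suc.prems m by auto
  have F: "F \<in> Xalg" unfolding F_def
    by (simp only: split: if_split) (intro conjI impI kalg_mult Pev_Xalg Qev_Xalg k')
  have P: "prod_list (map (\<lambda>a. Pev sc w i (x 1) (x (a + 1)) * Pev sc w i (x (a + 1)) (x 1))
                     (filter (\<lambda>a. ent \<nu> a = i) [1..<k + 1])) \<in> Xalg"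
  proof (rule kalg_prod_list[OF sc_hom])
    fix y
    assume "y \<in> set (map (\<lambda>a. Pev sc w i (x 1) (x (a + 1)) * Pev sc w i (x (a + 1)) (x 1))
                     (filter (\<lambda>a. ent \<nu> a = i) [1..<k + 1]))"
    then obtain a where a: "a \<in> {1..<k + 1}" "y = Pev sc w i (x 1) (x (a + 1)) * Pev sc w i (x (a + 1)) (x 1)"
      unfolding set_map set_filter set_upt by blast
    show "y \<in> Xalg" unfolding a(2)
      by (intro kalg_mult Pev_Xalg) (use a(1) Suc.prems m in auto)
  qed
  have A: "A (Suc k) = A k * F"
  proof -
    define Qs Ps where
      "Qs = prod_list (map (\<lambda>a. Qev sc t i (ent \<nu> a) (x 1) (x (a + 1))) (filter (\<lambda>a. ent \<nu> a \<noteq> i) [1..<k + 1]))"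
      and "Ps = prod_list (map (\<lambda>a. Pev sc w i (x 1) (x (a + 1)) * Pev sc w i (x (a + 1)) (x 1))
                     (filter (\<lambda>a. ent \<nu> a = i) [1..<k + 1]))"
    have upt: "[1..<Suc k + 1] = [1..<k + 1] @ [Suc k]" by simp
    have Ak: "A k = aev sc c hh L i (x 1) * Qs * Ps" by (simp only: A_def Qs_def Ps_def)
    \<comment> \<open>All factors \<open>Q\<close> precede all factors \<open>P\<close>, so a new
      factor \<open>Q\<close> is inserted in the middle; commutativity of \<open>Xalg\<close> moves
      it to the end.\<close>
    have "A (Suc k) = aev sc c hh L i (x 1) * (Qs * (if ent \<nu> (Suc k) = i then 1 else F)) *
        (Ps * (if ent \<nu> (Suc k) = i then F else 1))"
      unfolding A_def upt filter_append map_append prod_list.append Qs_def[symmetric] Ps_def[symmetric]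
      by (simp add: F_def)
    then show ?thesis unfolding Ak using Xalg_Xalg[OF P F, folded Ps_def] by (simp add: mult.assoc)
  qed
  obtain Z where Z: "Z \<in> J" "aL 1 * T (Suc k) * G B (Suc k) * f = aL 1 * T k * G B k * f * F + Z"
    using tau_gel_step[of k] Suc.prems unfolding F_def by auto
  have "aL 1 * T (Suc k) * G B (Suc k) * f - A (Suc k) * f = (aL 1 * T k * G B k * f - A k * f) * F + Z"
    unfolding Z(2) A by (simp add: left_diff_distrib mult.assoc Xalg_e[OF F i\<nu>_Iseq])
  moreover have "(aL 1 * T k * G B k * f - A k * f) * F \<in> J"
    by (rule J_Xalg[OF _ Suc.IH F]) (use Suc.prems in auto)
  ultimately show ?case using Z(1) by (simp add: lsub_add)
qed

lemma Anu_congruence: "aL 1 * T n * G B n * f - Anu sc t w c hh L x i \<nu> * f \<in> J"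
  using Anu_upto[of n] by (simp only: Anu_def length_\<nu> order_refl)

end

end

theorem theorem4p10:
  fixes I :: "'i set" and A :: "'i \<Rightarrow> 'i \<Rightarrow> int" and d :: "'i \<Rightarrow> int"
    and alpha :: "'i \<Rightarrow> 'b \<Rightarrow> int" and hh :: "'i \<Rightarrow> ('b \<Rightarrow> int) \<Rightarrow> int"
    and kgr :: "int \<Rightarrow> 'k::comm_ring_1 set"
    and t :: "'i \<Rightarrow> 'i \<Rightarrow> nat \<Rightarrow> nat \<Rightarrow> 'k" and w :: "'i \<Rightarrow> nat \<Rightarrow> nat \<Rightarrow> 'k"
    and L :: "'b \<Rightarrow> int" and c :: "'i \<Rightarrow> nat \<Rightarrow> 'k"
    and sc :: "'k \<Rightarrow> 'a::ring_1" and e :: "'i list \<Rightarrow> 'a" and x :: "nat \<Rightarrow> 'a" and \<tau> :: "nat \<Rightarrow> 'a"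
    and i :: 'i and \<beta> :: "'i \<Rightarrow> nat" and n :: nat and \<nu> :: "'i list"
  assumes "finite I"
    and "cartan_datum I A d"
    and "realization I A alpha hh"
    and "graded_ring kgr"
    and "Q_data I A d kgr t"
    and "P_data I A d kgr w"
    and "L \<in> Pplus I hh"
    and "a_data I d kgr hh L c"
    and "qH_rels I t w sc (Suc n) e x \<tau>"
    and "i \<in> I"
    and "\<beta> \<in> Qplus I"
    and "sum \<beta> I = n"
    and "\<nu> \<in> Ibeta I \<beta>"
  shows "aLam I sc c hh L e x (\<beta>(i := Suc (\<beta> i))) 1
           * prod_list (map \<tau> [1..<n + 1])
           * prod_list (map (gel I sc w e x \<tau> (\<beta>(i := Suc (\<beta> i)))) (rev [1..<n + 1]))
           * e (i # \<nu>)
         - Anu sc t w c hh L x i \<nu> * e (i # \<nu>)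
         \<in> lsub (Rblock I sc (Suc n) e x \<tau> (\<beta>(i := Suc (\<beta> i))))
                (aLam I sc c hh L e x (\<beta>(i := Suc (\<beta> i))) 2)
                (xiRblock I sc n e x \<tau> \<beta>)
                (e (i # \<nu>))"
proof -
  let ?B = "\<beta>(i := Suc (\<beta> i))"
  interpret quiver_hecke I t w sc "Suc n" e x \<tau>
    by unfold_locales (use assms in \<open>auto simp: Q_data_def\<close>)
  have I: "Ibeta I B \<subseteq> Iseq I (sum B I)" for B :: "'i \<Rightarrow> nat"
    using length_Ibeta[OF assms(1)] by (auto simp: Iseq_def Ibeta_def)
  have "sum ?B I = Suc (sum \<beta> I)"
    using assms(1,10) by (simp add: sum.remove[of I i])
  then have "Ibeta I ?B \<subseteq> Iseq I (Suc n)" "Ibeta I \<beta> \<subseteq> Iseq I n"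
    using I[of ?B] I[of \<beta>] assms(12) by simp_all
  moreover have "i # \<nu> \<in> Ibeta I ?B"
    using assms(10,13) by (auto simp: Ibeta_def)
  ultimately show ?thesis
    using Anu_congruence[OF refl assms(10,13), where B = ?B and hh = hh and L = L and c = c] by (simp only: T_def G_def)
qed

end
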